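(* There exists $\beta_0>0$ such that for every $\beta<\beta_0$ the following holds. For any natural numbers $n\ge 1$ and $k_1,\dots,k_n\ge 0$, with $k=k_1+\dots+k_n$, there is a constant $C$ depending on $\beta_0,n,k$ but not on $N$ nor on the vector $(t_1,\dots,t_N)$ such that for every $N$ and every $(t_1,\dots,t_N)$ with $\sum_{i\le N}t_i^2=1$, $$\Bigl|\,\mathbb{E}\Bigl\langle \prod_{l=1}^n S_l^{k_l}\Bigr\rangle-\prod_{l=1}^n a(k_l)\,\mathbb{E}\bigl[\langle S_1^2\rangle^{k/2}\bigr]\Bigr|\le C\max_{i\le N}|t_i|.$$
   Context: Sherrington–Kirkpatrick model: $\Sigma_N=\{-1,1\}^N$; $(g_{ij})_{i,j\le N}$ i.i.d. standard Gaussians (the disorder); parameters $\beta>0$, $h\ge0$. Hamiltonian $-H_N(\sigma)=\frac{\beta}{\sqrt N}\sum_{1\le i<j\le N}g_{ij}\sigma_i\sigma_j+h\sum_{i\le N}\sigma_i$, Gibbs measure $G(\{\sigma\})=e^{-H_N(\sigma)}/Z_N$ with $Z_N=\sum_\sigma e^{-H_N(\sigma)}$. For a function $f$ of several configurations (replicas) $\sigma^1,\sigma^2,\dots$, $\langle f\rangle$ denotes expectation with respect to the product Gibbs measure $G^{\otimes\infty}$ (replicas are i.i.d. with law $G$ given the disorder), and $\mathbb{E}$ denotes expectation over the disorder. Fix $(t_1,\dots,t_N)$ with $\sum_i t_i^2=1$. Let $(\sigma^{1(l)})_{l\ge0}$, $(\sigma^{2(l)})_{l\ge0}$ be distinct replicas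 (all indices $1(l),2(l)$ distinct), $\bar\sigma^l=\sigma^{1(l)}-\sigma^{2(l)}$, and $S_l=\sum_{i=1}^N t_i\bar\sigma^l_i$. $a(l)=\mathbb{E}g^l$ for $g$ standard normal. *)

theory Defs
  imports "HOL-Probability.Probability"
begin

definition gauss :: "real measure" where
  "gauss = density lborel std_normal_density"

definition disorder :: "nat \<Rightarrow> (nat \<times> nat \<Rightarrow> real) measure" where
  "disorder N = PiM ({..<N} \<times> {..<N}) (\<lambda>_. gauss)"

definition configs :: "nat \<Rightarrow> (nat \<Rightarrow> real) set" where
  "configs N = PiE {..<N} (\<lambda>_. {-1, 1})"

definition minusH :: "nat \<Rightarrow> real \<Rightarrow> real \<Rightarrow> (nat \<times> nat \<Rightarrow> real) \<Rightarrow> (nat \<Rightarrow> real) \<Rightarrow> real" where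
  "minusH N \<beta> h g \<sigma> =
     \<beta> / sqrt (real N) * (\<Sum>i<N. \<Sum>j\<in>{i<..<N}. g (i, j) * \<sigma> i * \<sigma> j)
     + h * (\<Sum>i<N. \<sigma> i)"

definition Zpart :: "nat \<Rightarrow> real \<Rightarrow> real \<Rightarrow> (nat \<times> nat \<Rightarrow> real) \<Rightarrow> real" where
  "Zpart N \<beta> h g = (\<Sum>\<sigma>\<in>configs N. exp (minusH N \<beta> h g \<sigma>))"

definition gibbs_avg :: "nat \<Rightarrow> real \<Rightarrow> real \<Rightarrow> (nat \<times> nat \<Rightarrow> real) \<Rightarrow> nat
    \<Rightarrow> ((nat \<Rightarrow> nat \<Rightarrow> real) \<Rightarrow> real) \<Rightarrow> real" where
  "gibbs_avg N \<beta> h g m F =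
     (\<Sum>\<rho>\<in>PiE {..<m} (\<lambda>_. configs N). F \<rho> * (\<Prod>r<m. exp (minusH N \<beta> h g (\<rho> r))))
     / Zpart N \<beta> h g ^ m"

definition a :: "nat \<Rightarrow> real" where
  "a l = (\<integral>x. x ^ l \<partial>gauss)"

text \<open>S_l = sum_i t_i (sigma^{1(l)}_i - sigma^{2(l)}_i) with 1(l) = 2l, 2(l) = 2l+1.\<close>
definition Sval :: "(nat \<Rightarrow> real) \<Rightarrow> nat \<Rightarrow> (nat \<Rightarrow> nat \<Rightarrow> real) \<Rightarrow> nat \<Rightarrow> real" where
  "Sval t N \<rho> l = (\<Sum>i<N. t i * (\<rho> (2 * l) i - \<rho> (2 * l + 1) i))"

end

theory Submission
  imports Defs "HOL-Real_Asymp.Real_Asymp" "HOL-Combinatorics.Transposition" "HOL-Combinatorics.Permutations"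
begin

text \<open>
  Write \<open>\<nu> = E\<langle>\<cdot>\<rangle>\<close> and let \<open>\<delta> = max |t_i|\<close>, so that \<open>1 / sqrt N \<le> \<delta>\<close>. It suffices to find a number \<open>v\<close>, depending on
  \<open>N\<close>, \<open>\<beta>\<close>, \<open>t\<close> only, with \<open>\<nu>(S_1 F) = v \<nu>(\<partial>_1 F) + O(\<delta>)\<close> for every monomial \<open>F\<close> in the \<open>S_l\<close>: iterating
  gives \<open>\<nu>(\<Prod> S_l^k_l) = v^(k/2) \<Prod> a(k_l) + O(\<delta>)\<close> for even exponents, and \<open>E\<langle>S_1^2\<rangle>^(k/2)\<close> is itself the moment
  \<open>\<nu>(S_1^2 \<cdots> S_{k/2}^2)\<close>. Odd exponents give zero by exchanging the two replicas of a pair.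

  For small \<open>\<beta>\<close> the moments of \<open>S_l\<close> and of \<open>sqrt N (R_{12} - q)\<close> are bounded by Latala's interpolation argument.
  Writing \<open>\<nu>(S_1 F) = \<Sum>_p t_p \<nu>(\<epsilon>_p F)\<close>, with \<open>\<epsilon>_p\<close> the difference of the spins of the first pair at site \<open>p\<close>, each site is
  decoupled by the cavity method. To first order this produces \<open>\<nu>(\<partial>_1 F)\<close> and the quantities \<open>A_d = \<nu>(X_d F)\<close>, where
  \<open>X_d\<close> is \<open>N^(-1/2)\<close> times the scalar product of the first pair difference with replica \<open>d\<close>. The same expansion applied to
  \<open>A_d\<close> gives a closed linear system that determines the combination needed.\<close>

section \<open>Gaussian integration by parts\<close>

text \<open>Two quantitative demands shape the proof. (1) The threshold for \<beta> may not depend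
  on n or the exponents, while the derivative of an m-replica average carries coefficients of order
  m^2. Concentration is therefore proved once, for an exponential moment of a single pair of
  replicas; every power for any number of replicas follows by exchangeability. Its exponent drops by
  2 \<beta>^2 along the path, and \<beta> < 1/16 keeps this below 1/128, half of the initial 1/64.
  (2) The identities at the sites p are summed with weights t_p (for S_1) or 1/sqrt N (for X_d). An
  error 1/sqrt N per site would be useless, since the sum of |t_p| can be of order sqrt N. The error
  allowed at one site is t_p^2 + |t_p|/sqrt N + 1/N, whose weighted sums are O(\<delta>). Hence the
  first derivative at the decoupled site is kept explicitly and only the second-order term is
  estimated. Each derivative along the cavity path gains 1/sqrt N because it inserts a centred
  overlap; this is where concentration enters. All constants are chosen before N, \<beta>, q and
  t.\<close>

lemma sets_gauss [measurable_cong, simp]: "sets gauss = sets borel"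
  by (simp add: gauss_def)

lemma space_gauss [simp]: "space gauss = UNIV"
  by (simp add: gauss_def)

lemma prob_space_gauss: "prob_space gauss"
  unfolding gauss_def by (rule prob_space_normal_density) simp

lemma integral_gauss:
  assumes [measurable]: "f \<in> borel_measurable borel"
  shows "(\<integral>x. f x \<partial>gauss) = (\<integral>x. std_normal_density x * f x \<partial>lborel)" (is ?A)
    and "integrable gauss f \<longleftrightarrow> integrable lborel (\<lambda>x. std_normal_density x * f x)" (is ?B)
proof -
  show ?A unfolding gauss_def by (subst integral_density) (auto simp: normal_density_nonneg)
  show ?B unfolding gauss_def by (subst integrable_density) (auto simp: normal_density_nonneg)
qed

lemma integrable_gauss_bounded:
  fixes f :: "real \<Rightarrow> real"
  assumes [measurable]: "f \<in> borel_measurable borel" and "\<And>x. \<bar>f x\<bar> \<le> B"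
  shows "integrable gauss f"
proof -
  interpret prob_space gauss by (rule prob_space_gauss)
  show ?thesis by (rule integrable_const_bound[where B=B]) (use assms in \<open>auto simp: gauss_def\<close>)
qed

lemma integrable_gauss_abs: "integrable gauss (\<lambda>x. \<bar>x\<bar>)"
  using integrable_std_normal_moment_abs[of 1] by (subst integral_gauss) auto

lemma a_even: "a (2 * k) = fact (2 * k) / (2 ^ k * fact k)"
  unfolding a_def by (subst integral_gauss) (auto intro: integral_std_normal_moment_even)

lemma a_odd: "odd k \<Longrightarrow> a k = 0"
  unfolding a_def
  by (subst integral_gauss) (auto elim!: oddE simp: integral_std_normal_moment_odd[simplified])

lemma std_normal_density_deriv:
  "(std_normal_density has_real_derivative - x * std_normal_density x) (at x)"
  unfolding normal_density_def
  by (auto intro!: derivative_eq_intros simp: field_simps power2_eq_square)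

text \<open>The derivative of \<open>std_normal_density x * u x\<close> is integrable, and the
  product tends to 0 at both ends because \<open>u\<close> is bounded; so the fundamental theorem of
  calculus on the whole line gives 0.\<close>

lemma gauss_ibp:
  fixes u u' :: "real \<Rightarrow> real"
  assumes d: "\<And>x. (u has_real_derivative u' x) (at x)"
    and b: "\<And>x. \<bar>u x\<bar> \<le> B" and b': "\<And>x. \<bar>u' x\<bar> \<le> B'" and c: "\<And>x. isCont u' x"
  shows "(\<integral>x. x * u x \<partial>gauss) = (\<integral>x. u' x \<partial>gauss)"
proof -
  have cu: "isCont u x" for x using d by (rule DERIV_isCont)
  have [measurable]: "u \<in> borel_measurable borel" "u' \<in> borel_measurable borel"
    by (auto intro!: borel_measurable_continuous_onI continuous_at_imp_continuous_on cu c)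
  have i0: "integrable lborel (\<lambda>x. std_normal_density x * \<bar>x\<bar>)"
    using integrable_std_normal_moment_abs[of 1] by simp
  have i1: "integrable lborel (\<lambda>x. std_normal_density x * (x * u x))"
  proof (rule Bochner_Integration.integrable_bound)
    show "integrable lborel (\<lambda>x. B * (std_normal_density x * \<bar>x\<bar>))"
      by (rule integrable_mult_right[OF i0])
    have "0 \<le> B" using b[of 0] by linarith
    have "std_normal_density x * (\<bar>x\<bar> * \<bar>u x\<bar>) \<le> B * (std_normal_density x * \<bar>x\<bar>)" for x
      using mult_left_mono[OF b[of x], of "std_normal_density x * \<bar>x\<bar>"]
      by (simp add: mult_ac)
    then show "AE x in lborel. norm (std_normal_density x * (x * u x)) \<le> norm (B * (std_normal_density x * \<bar>x\<bar>))"
      using \<open>0 \<le> B\<close> by (simp add: abs_mult)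
  qed simp
  have i2: "integrable lborel (\<lambda>x. std_normal_density x * u' x)"
    using integrable_gauss_bounded[of u' B'] b' integral_gauss(2)[of u'] by simp
  let ?F = "\<lambda>x. std_normal_density x * u x"
  let ?f = "\<lambda>x. std_normal_density x * u' x - std_normal_density x * (x * u x)"
  have dens: "(std_normal_density \<longlongrightarrow> 0) at_top" "(std_normal_density \<longlongrightarrow> 0) at_bot"
  proof -
    have "filterlim (\<lambda>x::real. x\<^sup>2 / 2) at_top at_top"
      by real_asymp
    moreover have "filterlim (\<lambda>x::real. x\<^sup>2 / 2) at_top at_bot"
      by real_asymp
    ultimately have "((\<lambda>x::real. exp (- (x\<^sup>2 / 2))) \<longlongrightarrow> 0) at_top" "((\<lambda>x::real. exp (- (x\<^sup>2 / 2))) \<longlongrightarrow> 0) at_bot"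
      by (auto intro!: filterlim_compose[OF exp_at_bot] simp: filterlim_uminus_at_top[symmetric] filterlim_uminus_at_bot)
    from tendsto_mult_right_zero[OF this(1), of "1 / sqrt (2*pi)"] tendsto_mult_right_zero[OF this(2), of "1 / sqrt (2*pi)"]
    show "(std_normal_density \<longlongrightarrow> 0) at_top" "(std_normal_density \<longlongrightarrow> 0) at_bot"
      unfolding std_normal_density_def by (simp_all add: mult_ac)
  qed
  have "(LBINT x=-\<infinity>..\<infinity>. ?f x) = 0 - 0"
  proof (rule interval_integral_FTC_integrable[where F="?F"])
    show "(?F has_vector_derivative ?f x) (at x)" for x
      unfolding has_real_derivative_iff_has_vector_derivative[symmetric]
      by (rule derivative_eq_intros std_normal_density_deriv d refl)+ (simp add: algebra_simps)
    have "isCont std_normal_density x" for x by (rule DERIV_isCont[OF std_normal_density_deriv])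
    then show "isCont ?f x" for x by (intro continuous_intros cu c)
    show "set_integrable lborel (einterval (- \<infinity>) \<infinity>) ?f"
      using i1 i2 by (simp add: set_integrable_def)
    have lim: "(?F \<longlongrightarrow> 0) F" if "(std_normal_density \<longlongrightarrow> 0) F" for F
    proof (rule Lim_null_comparison)
      show "\<forall>\<^sub>F x in F. norm (?F x) \<le> std_normal_density x * B"
        using mult_left_mono[OF b] by (auto simp: abs_mult)
      show "((\<lambda>x. std_normal_density x * B) \<longlongrightarrow> 0) F"
        by (rule tendsto_mult_left_zero[OF that])
    qed
    from lim[OF dens(1)] lim[OF dens(2)]
    show "((?F \<circ> real_of_ereal) \<longlongrightarrow> 0) (at_right (-\<infinity>))" "((?F \<circ> real_of_ereal) \<longlongrightarrow> 0) (at_left \<infinity>)"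
      by (simp_all add: ereal_tendsto_simps1)
  qed simp
  then have "(\<integral>x. ?f x \<partial>lborel) = 0"
    by (simp add: interval_integral_to_infinity_eq interval_lebesgue_integral_def set_lebesgue_integral_def)
  then show ?thesis
    using i1 i2 by (simp add: integral_gauss)
qed

text \<open>Dominated convergence for the difference quotients: the mean value inequality bounds
  each of them by \<open>G\<close>, since \<open>G\<close> dominates the derivative at every
  parameter value.\<close>

lemma deriv_integral:
  fixes F F' :: "real \<Rightarrow> 'a \<Rightarrow> real"
  assumes F: "\<And>s. integrable M (F s)"
    and F' [measurable]: "F' t \<in> borel_measurable M"
    and d: "\<And>s x. x \<in> space M \<Longrightarrow> ((\<lambda>s. F s x) has_real_derivative F' s x) (at s)"
    and b: "\<And>s x. x \<in> space M \<Longrightarrow> \<bar>F' s x\<bar> \<le> G x" and G: "integrable M G"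
  shows "((\<lambda>s. \<integral>x. F s x \<partial>M) has_real_derivative (\<integral>x. F' t x \<partial>M)) (at t)"
  unfolding DERIV_def tendsto_at_iff_sequentially
proof (intro allI impI)
  fix X :: "nat \<Rightarrow> real" assume X: "\<forall>i. X i \<in> UNIV - {0}" "X \<longlonglongrightarrow> 0"
  have [measurable]: "F s \<in> borel_measurable M" for s using F by auto
  have "(\<lambda>i. \<integral>x. (F (t + X i) x - F t x) / X i \<partial>M) \<longlonglongrightarrow> (\<integral>x. F' t x \<partial>M)"
  proof (rule integral_dominated_convergence[where w=G])
    show "AE x in M. (\<lambda>i. (F (t + X i) x - F t x) / X i) \<longlonglongrightarrow> F' t x"
    proof (rule AE_I2)
      fix x assume x: "x \<in> space M"
      from d[OF x, of t] show "(\<lambda>i. (F (t + X i) x - F t x) / X i) \<longlonglongrightarrow> F' t x"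
        using X unfolding DERIV_def tendsto_at_iff_sequentially comp_def by blast
    qed
    show "AE x in M. norm ((F (t + X i) x - F t x) / X i) \<le> G x" for i
    proof (rule AE_I2)
      fix x assume x: "x \<in> space M"
      have "norm (F (t + X i) x - F t x) \<le> G x * norm (t + X i - t)"
        by (rule field_differentiable_bound[OF convex_UNIV, where f'="\<lambda>s. F' s x"]) (use d[OF x] b[OF x] in auto)
      then show "norm ((F (t + X i) x - F t x) / X i) \<le> G x"
        using X by (simp add: field_simps)
    qed
  qed (use G in auto)
  then show "((\<lambda>h. ((\<integral>x. F (t + h) x \<partial>M) - (\<integral>x. F t x \<partial>M)) / h) \<circ> X) \<longlonglongrightarrow> (\<integral>x. F' t x \<partial>M)"
    using F by (simp add: comp_def)
qed

section \<open>The disorder as a product of Gaussian measures\<close>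

lemma product_prob_space_gauss: "product_prob_space (\<lambda>_. gauss)"
  by (intro product_prob_spaceI prob_space_gauss)

lemma prob_space_disorder: "prob_space (disorder N)"
  unfolding disorder_def by (intro prob_space_PiM prob_space_gauss)

lemma measurable_disorder_component [measurable]:
  "k \<in> {..<N} \<times> {..<N} \<Longrightarrow> (\<lambda>g. g k) \<in> borel_measurable (disorder N)"
  unfolding disorder_def by (metis measurable_component_singleton measurable_cong_sets sets_gauss)

lemma integrable_disorder_bounded:
  fixes f :: "_ \<Rightarrow> real"
  assumes [measurable]: "f \<in> borel_measurable (disorder N)" and "\<And>x. \<bar>f x\<bar> \<le> B"
  shows "integrable (disorder N) f"
proof -
  interpret prob_space "disorder N" by (rule prob_space_disorder)
  show ?thesis by (rule integrable_const_bound[where B=B]) (use assms in auto)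
qed

lemma distr_disorder_component:
  assumes "k \<in> {..<N} \<times> {..<N}"
  shows "distr (disorder N) gauss (\<lambda>g. g k) = gauss"
  unfolding disorder_def by (rule distr_PiM_component[OF prob_space_gauss assms])

lemma integral_disorder_component:
  fixes f :: "real \<Rightarrow> real"
  assumes k: "k \<in> {..<N} \<times> {..<N}" and [measurable]: "f \<in> borel_measurable borel"
  shows "(\<integral>g. f (g k) \<partial>disorder N) = (\<integral>x. f x \<partial>gauss)"
    and "integrable (disorder N) (\<lambda>g. f (g k)) \<longleftrightarrow> integrable gauss f"
proof -
  have m: "(\<lambda>g. g k) \<in> measurable (disorder N) gauss"
    using measurable_disorder_component[OF k] by (simp cong: measurable_cong_sets)
  have f: "f \<in> borel_measurable gauss" using assms(2) by (simp cong: measurable_cong_sets)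
  show "(\<integral>g. f (g k) \<partial>disorder N) = (\<integral>x. f x \<partial>gauss)"
    using integral_distr[OF m f] distr_disorder_component[OF k] by simp
  show "integrable (disorder N) (\<lambda>g. f (g k)) \<longleftrightarrow> integrable gauss f"
    using integrable_distr_eq[OF m f] distr_disorder_component[OF k] by simp
qed

lemma integral_disorder_split:
  fixes f :: "_ \<Rightarrow> real"
  assumes k: "k \<in> {..<N} \<times> {..<N}" and f: "integrable (disorder N) f"
  shows "(\<integral>g. f g \<partial>disorder N) = (\<integral>g. (\<integral>x. f (g(k := x)) \<partial>gauss) \<partial>PiM ({..<N} \<times> {..<N} - {k}) (\<lambda>_. gauss))"
proof -
  interpret product_prob_space "\<lambda>_. gauss" by (rule product_prob_space_gauss)
  have "insert k ({..<N} \<times> {..<N} - {k}) = {..<N} \<times> {..<N}" using k by auto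
  then show ?thesis
    using product_integral_insert[of "{..<N} \<times> {..<N} - {k}" k f] f by (simp add: disorder_def)
qed

text \<open>Fubini in the coordinate \<open>k\<close> reduces this to \<open>gauss_ibp\<close> with
  all other coordinates frozen.\<close>

lemma disorder_ibp:
  fixes Y Y' :: "(nat \<times> nat \<Rightarrow> real) \<Rightarrow> real"
  assumes k: "k \<in> {..<N} \<times> {..<N}"
    and [measurable]: "Y \<in> borel_measurable (disorder N)" "Y' \<in> borel_measurable (disorder N)"
    and d: "\<And>g x. ((\<lambda>x. Y (g(k := x))) has_real_derivative Y' (g(k := x))) (at x)"
    and b: "\<And>g. \<bar>Y g\<bar> \<le> B" and b': "\<And>g. \<bar>Y' g\<bar> \<le> B'" and c: "\<And>g x. isCont (\<lambda>x. Y' (g(k := x))) x"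
  shows "(\<integral>g. g k * Y g \<partial>disorder N) = (\<integral>g. Y' g \<partial>disorder N)"
    and "integrable (disorder N) (\<lambda>g. g k * Y g)"
proof -
  note [measurable] = measurable_disorder_component[OF k]
  show i: "integrable (disorder N) (\<lambda>g. g k * Y g)"
  proof (rule Bochner_Integration.integrable_bound)
    show "integrable (disorder N) (\<lambda>g. B * \<bar>g k\<bar>)"
      using integral_disorder_component(2)[OF k, of abs] integrable_gauss_abs by (intro integrable_mult_right) simp
    have "0 \<le> B" using b[of undefined] by linarith
    then show "AE g in disorder N. norm (g k * Y g) \<le> norm (B * \<bar>g k\<bar>)"
      using mult_right_mono[OF b, OF abs_ge_zero] by (intro AE_I2) (simp add: abs_mult mult.commute)
  qed measurable
  have i': "integrable (disorder N) Y'" by (rule integrable_disorder_bounded) (use b' in auto)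
  have "(\<integral>x. x * Y (g(k := x)) \<partial>gauss) = (\<integral>x. Y' (g(k := x)) \<partial>gauss)" for g
    by (rule gauss_ibp[OF d b b' c])
  then show "(\<integral>g. g k * Y g \<partial>disorder N) = (\<integral>g. Y' g \<partial>disorder N)"
    by (simp add: integral_disorder_split[OF k i] integral_disorder_split[OF k i'])
qed

section \<open>Replicated Gibbs averages with general couplings\<close>

text \<open>The diagonal entries \<open>g (i, i)\<close> of the disorder do not occur in the Hamiltonian; here they are used as
  independent Gaussian fields acting on the single sites, so that all interpolations take place on the same space.\<close>

definition bonds :: "nat \<Rightarrow> (nat \<times> nat) set" where
  "bonds N = {(i, j). i \<le> j \<and> j < N}"

text \<open>A diagonal index is the interaction of one spin with a field, an off-diagonal one that
  of two spins. Both take values 1 and -1 on configurations, and \<open>phi_sq\<close> is what makes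
  the variance terms below so simple.\<close>

definition phi :: "nat \<times> nat \<Rightarrow> (nat \<Rightarrow> real) \<Rightarrow> real" where
  "phi k \<sigma> = (if fst k = snd k then \<sigma> (fst k) else \<sigma> (fst k) * \<sigma> (snd k))"

definition ham :: "nat \<Rightarrow> real \<Rightarrow> (nat \<times> nat \<Rightarrow> real) \<Rightarrow> (nat \<times> nat \<Rightarrow> real) \<Rightarrow> (nat \<Rightarrow> real) \<Rightarrow> real" where
  "ham N h c g \<sigma> = (\<Sum>k\<in>bonds N. c k * g k * phi k \<sigma>) + h * (\<Sum>i<N. \<sigma> i)"

definition gw :: "nat \<Rightarrow> real \<Rightarrow> (nat \<times> nat \<Rightarrow> real) \<Rightarrow> (nat \<times> nat \<Rightarrow> real) \<Rightarrow> (nat \<Rightarrow> real) \<Rightarrow> real" where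
  "gw N h c g \<sigma> = exp (ham N h c g \<sigma>) / (\<Sum>\<tau>\<in>configs N. exp (ham N h c g \<tau>))"

definition reps :: "nat \<Rightarrow> nat \<Rightarrow> (nat \<Rightarrow> nat \<Rightarrow> real) set" where
  "reps N m = PiE {..<m} (\<lambda>_. configs N)"

definition qavg :: "nat \<Rightarrow> real \<Rightarrow> (nat \<times> nat \<Rightarrow> real) \<Rightarrow> nat \<Rightarrow> (nat \<times> nat \<Rightarrow> real)
    \<Rightarrow> ((nat \<Rightarrow> nat \<Rightarrow> real) \<Rightarrow> real) \<Rightarrow> real" where
  "qavg N h c m g f = (\<Sum>\<rho>\<in>reps N m. f \<rho> * (\<Prod>r<m. gw N h c g (\<rho> r)))"

definition nu :: "nat \<Rightarrow> real \<Rightarrow> (nat \<times> nat \<Rightarrow> real) \<Rightarrow> nat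
    \<Rightarrow> ((nat \<Rightarrow> nat \<Rightarrow> real) \<Rightarrow> real) \<Rightarrow> real" where
  "nu N h c m f = (\<integral>g. qavg N h c m g f \<partial>disorder N)"

text \<open>The weight of a replica configuration after averaging over the disorder. It turns
  \<open>nu\<close> into a finite sum with nonnegative weights (\<open>nu_eq\<close>), so positivity
  and differentiation in the couplings become statements about \<open>om\<close>.\<close>

definition om :: "nat \<Rightarrow> real \<Rightarrow> (nat \<times> nat \<Rightarrow> real) \<Rightarrow> nat \<Rightarrow> (nat \<Rightarrow> nat \<Rightarrow> real) \<Rightarrow> real" where
  "om N h c m \<rho> = (\<integral>g. (\<Prod>r<m. gw N h c g (\<rho> r)) \<partial>disorder N)"

text \<open>Such an \<open>f\<close> has the same average in every system with at least m replicas.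
  This permits a fixed supply of replicas, with fresh ones always available, while \<open>m\<close>
  still enters the coefficients of \<open>br\<close>.\<close>

definition dep :: "nat \<Rightarrow> ((nat \<Rightarrow> nat \<Rightarrow> real) \<Rightarrow> real) \<Rightarrow> bool" where
  "dep m f \<longleftrightarrow> (\<forall>\<rho> \<rho>'. (\<forall>r<m. \<rho> r = \<rho>' r) \<longrightarrow> f \<rho> = f \<rho>')"

text \<open>The shape of the derivative of an \<open>m\<close>-replica average with respect to a Gaussian covariance \<open>\<Gamma>\<close>;
  \<open>m\<close> and \<open>m + 1\<close> are the indices of two fresh replicas.\<close>

definition br :: "nat \<Rightarrow> (nat \<Rightarrow> nat \<Rightarrow> real) \<Rightarrow> real" where
  "br m \<Gamma> = 2 * (\<Sum>b<m. \<Sum>a<b. \<Gamma> a b) - 2 * real m * (\<Sum>a<m. \<Gamma> a m)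
     + real m * (real m + 1) * \<Gamma> m (m + 1)"

lemma finite_configs [simp]: "finite (configs N)"
  unfolding configs_def by (intro finite_PiE) auto

lemma configs_nonempty [simp]: "configs N \<noteq> {}"
  unfolding configs_def by (simp add: PiE_eq_empty_iff)

lemma configs_spin: "\<sigma> \<in> configs N \<Longrightarrow> i < N \<Longrightarrow> \<sigma> i = -1 \<or> \<sigma> i = 1"
  unfolding configs_def by (auto simp: PiE_iff)

lemma configs_sq: "\<sigma> \<in> configs N \<Longrightarrow> i < N \<Longrightarrow> \<sigma> i * \<sigma> i = 1"
  using configs_spin by fastforce

lemma finite_reps [simp]: "finite (reps N m)"
  unfolding reps_def by (intro finite_PiE) auto

lemma reps_configs: "\<rho> \<in> reps N m \<Longrightarrow> r < m \<Longrightarrow> \<rho> r \<in> configs N"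
  unfolding reps_def by (auto simp: PiE_iff)

lemma finite_bonds [simp]: "finite (bonds N)"
  by (rule finite_subset[of _ "{..<N} \<times> {..<N}"]) (auto simp: bonds_def)

lemma bonds_sub: "k \<in> bonds N \<Longrightarrow> k \<in> {..<N} \<times> {..<N}"
  by (auto simp: bonds_def)

lemma phi_sq: "k \<in> bonds N \<Longrightarrow> \<sigma> \<in> configs N \<Longrightarrow> phi k \<sigma> * phi k \<sigma> = 1"
  using configs_spin[of \<sigma> N "fst k"] configs_spin[of \<sigma> N "snd k"]
  by (auto simp: phi_def bonds_def)

lemma phi_abs: "k \<in> bonds N \<Longrightarrow> \<sigma> \<in> configs N \<Longrightarrow> \<bar>phi k \<sigma>\<bar> = 1"
  using phi_sq[of k N \<sigma>] by (metis abs_mult_self_eq abs_one mult_1 real_sqrt_abs2 real_sqrt_one)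

lemma sum_reps_Suc:
  "(\<Sum>\<rho>\<in>reps N (Suc m). F \<rho>) = (\<Sum>\<rho>\<in>reps N m. \<Sum>\<sigma>\<in>configs N. F (\<rho>(m := \<sigma>)))"
proof -
  have inj: "inj_on (\<lambda>(\<sigma>, \<rho>). \<rho>(m := \<sigma>)) (configs N \<times> reps N m)"
    unfolding reps_def using inj_combinator[of m "{..<m}"] by simp
  have "reps N (Suc m) = (\<lambda>(\<sigma>, \<rho>). \<rho>(m := \<sigma>)) ` (configs N \<times> reps N m)"
    unfolding reps_def lessThan_Suc PiE_insert_eq ..
  then have "(\<Sum>\<rho>\<in>reps N (Suc m). F \<rho>) = (\<Sum>(\<sigma>, \<rho>)\<in>configs N \<times> reps N m. F (\<rho>(m := \<sigma>)))"
    using sum.reindex[OF inj, of F] by (simp add: comp_def split_def)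
  also have "\<dots> = (\<Sum>\<sigma>\<in>configs N. \<Sum>\<rho>\<in>reps N m. F (\<rho>(m := \<sigma>)))"
    by (simp add: sum.cartesian_product)
  finally show ?thesis by (subst sum.swap)
qed

section \<open>Derivatives of Gibbs weights and averages\<close>

lemma softmax_deriv:
  fixes e :: "real \<Rightarrow> 'b \<Rightarrow> real"
  assumes C: "finite C" "C \<noteq> {}"
    and d: "\<And>\<sigma>. \<sigma> \<in> C \<Longrightarrow> ((\<lambda>s. e s \<sigma>) has_real_derivative e' \<sigma>) (at s)"
    and \<sigma>: "\<sigma> \<in> C"
  defines "W \<equiv> \<lambda>s \<sigma>. exp (e s \<sigma>) / (\<Sum>\<tau>\<in>C. exp (e s \<tau>))"
  shows "((\<lambda>s. W s \<sigma>) has_real_derivative W s \<sigma> * (e' \<sigma> - (\<Sum>\<tau>\<in>C. W s \<tau> * e' \<tau>))) (at s)"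
proof -
  have Z: "(\<Sum>\<tau>\<in>C. exp (e s \<tau>)) > 0" by (rule sum_pos) (use C in auto)
  have "((\<lambda>s. W s \<sigma>) has_real_derivative
     (exp (e s \<sigma>) * e' \<sigma> * (\<Sum>\<tau>\<in>C. exp (e s \<tau>)) - exp (e s \<sigma>) * (\<Sum>\<tau>\<in>C. exp (e s \<tau>) * e' \<tau>))
      / ((\<Sum>\<tau>\<in>C. exp (e s \<tau>)) * (\<Sum>\<tau>\<in>C. exp (e s \<tau>)))) (at s)"
    unfolding W_def
  proof (rule DERIV_divide)
    show "((\<lambda>s. exp (e s \<sigma>)) has_real_derivative exp (e s \<sigma>) * e' \<sigma>) (at s)"
      by (rule DERIV_chain'[OF d[OF \<sigma>] DERIV_exp, THEN DERIV_cong]) simp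
    show "((\<lambda>s. \<Sum>\<tau>\<in>C. exp (e s \<tau>)) has_real_derivative (\<Sum>\<tau>\<in>C. exp (e s \<tau>) * e' \<tau>)) (at s)"
      by (intro DERIV_sum DERIV_chain'[OF d DERIV_exp, THEN DERIV_cong]) auto
  qed (use Z in auto)
  moreover have "(\<Sum>\<tau>\<in>C. W s \<tau> * e' \<tau>) = (\<Sum>\<tau>\<in>C. exp (e s \<tau>) * e' \<tau>) / (\<Sum>\<tau>\<in>C. exp (e s \<tau>))"
    unfolding W_def by (simp add: sum_divide_distrib)
  ultimately show ?thesis
    using Z unfolding W_def by (auto elim!: DERIV_cong simp: field_simps)
qed

lemma prod_log_deriv:
  fixes f :: "real \<Rightarrow> nat \<Rightarrow> real"
  assumes "\<And>r. r < m \<Longrightarrow> ((\<lambda>s. f s r) has_real_derivative f s r * d r) (at s)"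
  shows "((\<lambda>s. \<Prod>r<m. f s r) has_real_derivative (\<Prod>r<m. f s r) * (\<Sum>r<m. d r)) (at s)"
  using assms
proof (induction m)
  case (Suc m)
  have "((\<lambda>s. (\<Prod>r<m. f s r) * f s m) has_real_derivative
      (\<Prod>r<m. f s r) * (\<Sum>r<m. d r) * f s m + f s m * d m * (\<Prod>r<m. f s r)) (at s)"
    by (intro DERIV_mult Suc) auto
  then show ?case by (auto elim!: DERIV_cong simp: algebra_simps)
qed simp

lemma wsum_alg:
  fixes w X p :: "'b \<Rightarrow> real"
  shows "(\<Sum>\<sigma>\<in>C. w \<sigma> * (ck * p \<sigma> - ck * E) * X \<sigma>)
     = ck * ((\<Sum>\<sigma>\<in>C. w \<sigma> * (X \<sigma> * p \<sigma>)) - (\<Sum>\<sigma>\<in>C. w \<sigma> * X \<sigma>) * E)"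
proof -
  have "(\<Sum>\<sigma>\<in>C. w \<sigma> * (ck * p \<sigma> - ck * E) * X \<sigma>)
    = (\<Sum>\<sigma>\<in>C. ck * (w \<sigma> * (X \<sigma> * p \<sigma>)) - ck * (w \<sigma> * X \<sigma> * E))"
    by (intro sum.cong refl) (simp add: algebra_simps)
  then show ?thesis
    by (simp add: sum_subtractf sum_distrib_left sum_distrib_right right_diff_distrib mult.assoc)
qed

lemma bracket_bound:
  fixes S M E :: real
  assumes "\<bar>S\<bar> \<le> M" "\<bar>E\<bar> \<le> 1"
  shows "\<bar>S - M * E\<bar> \<le> 2 * M" and "\<bar>(S - M * E)\<^sup>2 - M * (1 - E\<^sup>2)\<bar> \<le> (2 * M)\<^sup>2 + M"
proof -
  have M: "0 \<le> M" using assms(1) by linarith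
  have "\<bar>M * E\<bar> \<le> M * 1" unfolding abs_mult using M assms(2) by (intro mult_mono) auto
  then show 1: "\<bar>S - M * E\<bar> \<le> 2 * M" using assms(1) by linarith
  have "(S - M * E)\<^sup>2 \<le> (2 * M)\<^sup>2" using 1 M by (intro abs_le_square_iff[THEN iffD1]) simp
  moreover have "E\<^sup>2 \<le> 1" using assms(2) by (simp add: abs_square_le_1)
  then have "0 \<le> M * (1 - E\<^sup>2)" "M * (1 - E\<^sup>2) \<le> M * 1"
    using M by (intro mult_nonneg_nonneg mult_left_mono; simp)+
  moreover have "0 \<le> (S - M * E)\<^sup>2" by simp
  ultimately show "\<bar>(S - M * E)\<^sup>2 - M * (1 - E\<^sup>2)\<bar> \<le> (2 * M)\<^sup>2 + M" by linarith
qed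

context
  fixes N :: nat and h :: real
begin

abbreviation "Eg c g X \<equiv> (\<Sum>\<sigma>\<in>configs N. gw N h c g \<sigma> * X \<sigma>)"

lemma Zham_pos: "(\<Sum>\<tau>\<in>configs N. exp (ham N h c g \<tau>)) > 0"
  by (rule sum_pos) auto

lemma gw_nonneg: "0 \<le> gw N h c g \<sigma>"
  unfolding gw_def using Zham_pos[of c g] by simp

lemma gw_sum: "(\<Sum>\<sigma>\<in>configs N. gw N h c g \<sigma>) = 1"
  unfolding gw_def using Zham_pos[of c g] by (simp add: sum_divide_distrib[symmetric])

lemma gw_le1: "\<sigma> \<in> configs N \<Longrightarrow> gw N h c g \<sigma> \<le> 1"
  using member_le_sum[of \<sigma> "configs N" "gw N h c g"] gw_nonneg gw_sum by auto

lemma Eg_bound: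
  assumes "\<And>\<sigma>. \<sigma> \<in> configs N \<Longrightarrow> \<bar>X \<sigma>\<bar> \<le> B"
  shows "\<bar>Eg c g X\<bar> \<le> B"
proof -
  have "\<bar>Eg c g X\<bar> \<le> (\<Sum>\<sigma>\<in>configs N. gw N h c g \<sigma> * B)"
    using assms gw_nonneg by (intro order_trans[OF sum_abs] sum_mono) (auto simp: abs_mult intro!: mult_left_mono)
  also have "\<dots> = B" using gw_sum by (simp add: sum_distrib_right[symmetric])
  finally show ?thesis .
qed

lemma measurable_ham [measurable]: "(\<lambda>g. ham N h c g \<sigma>) \<in> borel_measurable (disorder N)"
  unfolding ham_def
  by (intro borel_measurable_add borel_measurable_sum borel_measurable_times borel_measurable_const
      measurable_disorder_component bonds_sub)

lemma measurable_gw [measurable]: "(\<lambda>g. gw N h c g \<sigma>) \<in> borel_measurable (disorder N)"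
  unfolding gw_def by measurable

lemma measurable_prod_gw [measurable]:
  "(\<lambda>g. \<Prod>r<m. gw N h c g (\<rho> r)) \<in> borel_measurable (disorder N)"
  by (intro borel_measurable_prod measurable_gw)

lemma prod_gw_bounds:
  assumes "\<rho> \<in> reps N m"
  shows "0 \<le> (\<Prod>r<m. gw N h c g (\<rho> r))" "(\<Prod>r<m. gw N h c g (\<rho> r)) \<le> 1"
  using assms by (auto intro!: prod_nonneg prod_le_1 gw_nonneg gw_le1 reps_configs)

lemma integrable_prod_gw:
  assumes "\<rho> \<in> reps N m"
  shows "integrable (disorder N) (\<lambda>g. \<Prod>r<m. gw N h c g (\<rho> r))"
  by (rule integrable_disorder_bounded[where B=1]) (use prod_gw_bounds[OF assms] in auto)

lemma integrable_qavg: "integrable (disorder N) (\<lambda>g. qavg N h c m g f)"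
  unfolding qavg_def by (intro Bochner_Integration.integrable_sum integrable_mult_right integrable_prod_gw)

lemma nu_eq: "nu N h c m f = (\<Sum>\<rho>\<in>reps N m. f \<rho> * om N h c m \<rho>)"
  unfolding nu_def qavg_def om_def
  by (subst Bochner_Integration.integral_sum) (auto intro!: integrable_prod_gw)

lemma om_nonneg: "\<rho> \<in> reps N m \<Longrightarrow> 0 \<le> om N h c m \<rho>"
  unfolding om_def by (intro Bochner_Integration.integral_nonneg prod_gw_bounds)

lemma qavg_Suc: "qavg N h c (Suc m) g f = (\<Sum>\<sigma>\<in>configs N. gw N h c g \<sigma> * qavg N h c m g (\<lambda>\<rho>. f (\<rho>(m := \<sigma>))))"
proof -
  have "(\<Prod>r<m. gw N h c g ((\<rho>(m := \<sigma>)) r)) = (\<Prod>r<m. gw N h c g (\<rho> r))" for \<rho> \<sigma>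
    by (intro prod.cong) auto
  then show ?thesis
    unfolding qavg_def sum_reps_Suc
    by (subst sum.swap) (simp add: sum_distrib_left mult_ac)
qed

text \<open>Given the disorder, replica \<open>m\<close> is independent of those seen by
  \<open>f\<close>. Read from right to left, this turns a product with a Gibbs mean into an average
  with one more replica.\<close>

lemma qavg_mult_last:
  assumes "dep m f"
  shows "qavg N h c (Suc m) g (\<lambda>\<rho>. f \<rho> * X (\<rho> m)) = qavg N h c m g f * Eg c g X"
proof -
  have f: "f (\<rho>(m := \<sigma>)) = f \<rho>" for \<rho> \<sigma>
    using assms unfolding dep_def by auto
  have "qavg N h c m g (\<lambda>\<rho>. f (\<rho>(m := \<sigma>)) * X ((\<rho>(m := \<sigma>)) m)) = qavg N h c m g f * X \<sigma>" for \<sigma>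
    unfolding qavg_def f sum_distrib_right by (intro sum.cong refl) (simp add: mult_ac)
  then have "qavg N h c (Suc m) g (\<lambda>\<rho>. f \<rho> * X (\<rho> m)) = (\<Sum>\<sigma>\<in>configs N. gw N h c g \<sigma> * (qavg N h c m g f * X \<sigma>))"
    unfolding qavg_Suc by presburger
  also have "\<dots> = (\<Sum>\<sigma>\<in>configs N. qavg N h c m g f * (gw N h c g \<sigma> * X \<sigma>))"
    by (intro sum.cong refl) (simp only: mult_ac)
  also have "\<dots> = qavg N h c m g f * Eg c g X"
    by (rule sum_distrib_left[symmetric])
  finally show ?thesis .
qed

lemma qavg_dep_Suc:
  assumes "dep m f" shows "qavg N h c (Suc m) g f = qavg N h c m g f"
  using qavg_mult_last[OF assms, of c g "\<lambda>_. 1"] gw_sum by simp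

lemma dep_mono: "dep m f \<Longrightarrow> m \<le> m' \<Longrightarrow> dep m' f"
  unfolding dep_def by (meson less_le_trans)

lemma qavg_dep:
  assumes "dep m f" "m \<le> K" shows "qavg N h c K g f = qavg N h c m g f"
  using assms(2)
  by (induction rule: dec_induct) (auto simp: qavg_dep_Suc dep_mono[OF assms(1)])

lemma nu_dep:
  assumes "dep m f" "m \<le> K" shows "nu N h c K f = nu N h c m f"
  unfolding nu_def using qavg_dep[OF assms] by simp

lemma qavg_cmult: "qavg N h c m g (\<lambda>\<rho>. x * f \<rho>) = x * qavg N h c m g f"
  unfolding qavg_def by (simp add: sum_distrib_left mult.assoc)

lemma qavg_add: "qavg N h c m g (\<lambda>\<rho>. f \<rho> + f' \<rho>) = qavg N h c m g f + qavg N h c m g f'"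
  unfolding qavg_def by (simp add: distrib_right sum.distrib)

lemma qavg_diff: "qavg N h c m g (\<lambda>\<rho>. f \<rho> - f' \<rho>) = qavg N h c m g f - qavg N h c m g f'"
  unfolding qavg_def by (simp add: left_diff_distrib sum_subtractf)

lemma prod_gw_deriv:
  assumes \<rho>: "\<rho> \<in> reps N m"
    and d: "\<And>\<sigma>. \<sigma> \<in> configs N \<Longrightarrow> ((\<lambda>s. ham N h (c s) (g s) \<sigma>) has_real_derivative e' \<sigma>) (at s)"
  shows "((\<lambda>s. \<Prod>r<m. gw N h (c s) (g s) (\<rho> r)) has_real_derivative
     (\<Prod>r<m. gw N h (c s) (g s) (\<rho> r)) * ((\<Sum>r<m. e' (\<rho> r)) - m * Eg (c s) (g s) e')) (at s)"
proof -
  have "((\<lambda>s. gw N h (c s) (g s) (\<rho> r)) has_real_derivative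
     gw N h (c s) (g s) (\<rho> r) * (e' (\<rho> r) - Eg (c s) (g s) e')) (at s)" if "r < m" for r
    unfolding gw_def by (rule softmax_deriv) (use that \<rho> d in \<open>auto intro: reps_configs\<close>)
  from prod_log_deriv[where m=m and f="\<lambda>s r. gw N h (c s) (g s) (\<rho> r)" and d="\<lambda>r. e' (\<rho> r) - Eg (c s) (g s) e'" and s=s, OF this]
  show ?thesis by (simp only: sum_subtractf sum_constant card_lessThan)
qed

lemma ham_upd_deriv:
  assumes "k \<in> bonds N"
  shows "((\<lambda>x. ham N h c (g(k := x)) \<sigma>) has_real_derivative c k * phi k \<sigma>) (at x)"
proof -
  have "((\<lambda>x. c j * (g(k := x)) j * phi j \<sigma>) has_real_derivative (if j = k then c k * phi k \<sigma> else 0)) (at x)" for j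
    by (cases "j = k") (auto intro!: derivative_eq_intros)
  then have "((\<lambda>x. (\<Sum>j\<in>bonds N. c j * (g(k := x)) j * phi j \<sigma>) + h * (\<Sum>i<N. \<sigma> i)) has_real_derivative
      (\<Sum>j\<in>bonds N. if j = k then c k * phi k \<sigma> else 0) + 0) (at x)"
    by (intro DERIV_add DERIV_sum DERIV_const)
  then show ?thesis
    using assms unfolding ham_def by (simp add: sum.delta)
qed

lemma Eg_upd_deriv:
  assumes "k \<in> bonds N"
  shows "((\<lambda>x. Eg c (g(k := x)) X) has_real_derivative
      c k * (Eg c (g(k := x)) (\<lambda>\<sigma>. X \<sigma> * phi k \<sigma>) - Eg c (g(k := x)) X * Eg c (g(k := x)) (phi k))) (at x)"
proof -
  have "((\<lambda>x. gw N h c (g(k := x)) \<sigma>) has_real_derivative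
     gw N h c (g(k := x)) \<sigma> * (c k * phi k \<sigma> - Eg c (g(k := x)) (\<lambda>\<sigma>. c k * phi k \<sigma>))) (at x)"
    if "\<sigma> \<in> configs N" for \<sigma>
    unfolding gw_def by (rule softmax_deriv) (use that in \<open>auto intro: ham_upd_deriv[OF assms]\<close>)
  then have "((\<lambda>x. Eg c (g(k := x)) X) has_real_derivative
     (\<Sum>\<sigma>\<in>configs N. gw N h c (g(k := x)) \<sigma> * (c k * phi k \<sigma> - Eg c (g(k := x)) (\<lambda>\<sigma>. c k * phi k \<sigma>)) * X \<sigma>)) (at x)"
    by (intro DERIV_sum DERIV_cmult_right) auto
  then show ?thesis
  proof (rule DERIV_cong)
    let ?E = "Eg c (g(k := x)) (phi k)"
    have "Eg c (g(k := x)) (\<lambda>\<sigma>. c k * phi k \<sigma>) = c k * ?E"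
      by (simp add: sum_distrib_left mult_ac)
    then show "(\<Sum>\<sigma>\<in>configs N. gw N h c (g(k := x)) \<sigma> * (c k * phi k \<sigma> - Eg c (g(k := x)) (\<lambda>\<sigma>. c k * phi k \<sigma>)) * X \<sigma>)
      = c k * (Eg c (g(k := x)) (\<lambda>\<sigma>. X \<sigma> * phi k \<sigma>) - Eg c (g(k := x)) X * ?E)"
      using wsum_alg[of "gw N h c (g(k := x))" "c k" "phi k" ?E X "configs N"] by simp
  qed
qed

lemma Eg_phi_bound: "k \<in> bonds N \<Longrightarrow> \<bar>Eg c g (phi k)\<bar> \<le> 1"
  by (rule Eg_bound) (simp add: phi_abs)

lemma sum_phi_bound:
  assumes "k \<in> bonds N" "\<rho> \<in> reps N m"
  shows "\<bar>\<Sum>r<m. phi k (\<rho> r)\<bar> \<le> real m"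
proof -
  have "\<bar>\<Sum>r<m. phi k (\<rho> r)\<bar> \<le> (\<Sum>r<m. 1)"
    by (rule order_trans[OF sum_abs]) (intro sum_mono, simp add: phi_abs[OF assms(1) reps_configs[OF assms(2)]])
  then show ?thesis by simp
qed

text \<open>The square comes from differentiating the m Gibbs weights once more. The subtracted term
  comes from the mean of \<open>phi k\<close>, whose derivative is its variance times
  \<open>c k\<close>, that is, 1 minus the squared mean.\<close>

lemma prod_gw_ibp:
  assumes \<rho>: "\<rho> \<in> reps N m" and k: "k \<in> bonds N"
  shows "(\<integral>g. g k * ((\<Prod>r<m. gw N h c g (\<rho> r)) * ((\<Sum>r<m. phi k (\<rho> r)) - m * Eg c g (phi k))) \<partial>disorder N)
     = (\<integral>g. c k * ((\<Prod>r<m. gw N h c g (\<rho> r)) * (((\<Sum>r<m. phi k (\<rho> r)) - m * Eg c g (phi k))\<^sup>2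
         - m * (1 - (Eg c g (phi k))\<^sup>2))) \<partial>disorder N)"
    and "integrable (disorder N) (\<lambda>g. g k * ((\<Prod>r<m. gw N h c g (\<rho> r)) * ((\<Sum>r<m. phi k (\<rho> r)) - m * Eg c g (phi k))))"
      (is "integrable _ (\<lambda>g. g k * ?Y g)")
proof -
  let ?Y' = "\<lambda>g. c k * ((\<Prod>r<m. gw N h c g (\<rho> r)) * (((\<Sum>r<m. phi k (\<rho> r)) - m * Eg c g (phi k))\<^sup>2
         - m * (1 - (Eg c g (phi k))\<^sup>2)))"
  let ?P = "\<lambda>g. \<Prod>r<m. gw N h c g (\<rho> r)"
  have d: "((\<lambda>x. ?Y (g(k := x))) has_real_derivative ?Y' (g(k := x))) (at x)" for g x
  proof -
    have 1: "((\<lambda>x. ?P (g(k := x))) has_real_derivative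
       ?P (g(k := x)) * ((\<Sum>r<m. c k * phi k (\<rho> r)) - m * Eg c (g(k := x)) (\<lambda>\<sigma>. c k * phi k \<sigma>))) (at x)"
      by (rule prod_gw_deriv[where c="\<lambda>_. c" and g="\<lambda>x. g(k := x)" and e'="\<lambda>\<sigma>. c k * phi k \<sigma>",
            OF \<rho> ham_upd_deriv[OF k]])
    have sq: "Eg c g' (\<lambda>\<sigma>. phi k \<sigma> * phi k \<sigma>) = 1" for g'
    proof -
      have "Eg c g' (\<lambda>\<sigma>. phi k \<sigma> * phi k \<sigma>) = (\<Sum>\<sigma>\<in>configs N. gw N h c g' \<sigma>)"
        by (intro sum.cong refl) (simp only: phi_sq[OF k] mult_1_right)
      then show ?thesis by (simp only: gw_sum)
    qed
    have 2: "((\<lambda>x. (\<Sum>r<m. phi k (\<rho> r)) - m * Eg c (g(k := x)) (phi k)) has_real_derivative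
        0 - m * (c k * (1 - Eg c (g(k := x)) (phi k) * Eg c (g(k := x)) (phi k)))) (at x)"
      using Eg_upd_deriv[OF k, of c g "phi k" x] unfolding sq
      by (rule DERIV_diff[OF DERIV_const DERIV_cmult])
    have "Eg c (g(k := x)) (\<lambda>\<sigma>. c k * phi k \<sigma>) = c k * Eg c (g(k := x)) (phi k)"
      by (simp add: sum_distrib_left mult_ac)
    then have 3: "(\<Sum>r<m. c k * phi k (\<rho> r)) - m * Eg c (g(k := x)) (\<lambda>\<sigma>. c k * phi k \<sigma>)
       = c k * ((\<Sum>r<m. phi k (\<rho> r)) - m * Eg c (g(k := x)) (phi k))"
      by (simp only: sum_distrib_left[symmetric] right_diff_distrib mult.left_commute)
    have alg: "P * (ck * (S - m' * E)) * (S - m' * E) + (0 - m' * (ck * (1 - E * E))) * P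
       = ck * (P * ((S - m' * E)\<^sup>2 - m' * (1 - E\<^sup>2)))" for P ck S m' E :: real
      by (simp add: power2_eq_square algebra_simps)
    show ?thesis
      using DERIV_mult[OF 1 2] unfolding 3 alg .
  qed
  note bs = bracket_bound[OF sum_phi_bound[OF k \<rho>] Eg_phi_bound[OF k]]
  have bP: "\<bar>?P g\<bar> \<le> 1" for g using prod_gw_bounds[OF \<rho>, of c g] by simp
  have bY: "\<bar>?Y g\<bar> \<le> 1 * (2 * real m)" for g
    unfolding abs_mult[of "?P g"] by (rule mult_mono[OF bP bs(1)]) auto
  have bY': "\<bar>?Y' g\<bar> \<le> \<bar>c k\<bar> * (1 * ((2 * real m)\<^sup>2 + m))" for g
    unfolding abs_mult[of "c k"] abs_mult[of "?P g"] by (rule mult_left_mono[OF mult_mono[OF bP bs(2)]]) auto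
  have cont: "isCont (\<lambda>x. ?Y' (g(k := x))) x" for g x
  proof -
    have 1: "isCont (\<lambda>x. ?P (g(k := x))) x"
      by (rule DERIV_isCont[OF prod_gw_deriv[where c="\<lambda>_. c" and g="\<lambda>x. g(k := x)" and e'="\<lambda>\<sigma>. c k * phi k \<sigma>",
            OF \<rho> ham_upd_deriv[OF k]]])
    have 2: "isCont (\<lambda>x. Eg c (g(k := x)) (phi k)) x"
      by (rule DERIV_isCont[OF Eg_upd_deriv[OF k]])
    show ?thesis by (rule isCont_mult[OF continuous_const isCont_mult[OF 1 isCont_diff[OF isCont_power[OF isCont_diff[OF continuous_const isCont_mult[OF continuous_const 2]]] isCont_mult[OF continuous_const isCont_diff[OF continuous_const isCont_power[OF 2]]]]]])
  qed
  have mY: "?Y \<in> borel_measurable (disorder N)"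
    by (intro borel_measurable_times borel_measurable_diff borel_measurable_const borel_measurable_sum
        measurable_prod_gw measurable_gw)
  have mY': "?Y' \<in> borel_measurable (disorder N)"
    by (intro borel_measurable_times borel_measurable_diff borel_measurable_const borel_measurable_sum
        borel_measurable_power measurable_prod_gw measurable_gw)
  note ibp = disorder_ibp[OF bonds_sub[OF k] mY mY' d bY bY' cont]
  show "(\<integral>g. g k * ?Y g \<partial>disorder N) = (\<integral>g. ?Y' g \<partial>disorder N)" by (rule ibp(1))
  show "integrable (disorder N) (\<lambda>g. g k * ?Y g)" by (rule ibp(2))
qed

text \<open>Differentiating under the integral brings down \<open>g k\<close> for each bond, and
  Gaussian integration by parts removes it. Only \<open>c t k * c' t k\<close> remains, half the
  derivative of the variance of the bond.\<close>

lemma om_deriv: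
  assumes \<rho>: "\<rho> \<in> reps N m"
    and d: "\<And>k s. k \<in> bonds N \<Longrightarrow> ((\<lambda>s. c s k) has_real_derivative c' s k) (at s)"
    and b: "\<And>k s. k \<in> bonds N \<Longrightarrow> \<bar>c' s k\<bar> \<le> B"
  shows "((\<lambda>s. om N h (c s) m \<rho>) has_real_derivative
    (\<Sum>k\<in>bonds N. c t k * c' t k * (\<integral>g. (\<Prod>r<m. gw N h (c t) g (\<rho> r)) *
       (((\<Sum>r<m. phi k (\<rho> r)) - m * Eg (c t) g (phi k))\<^sup>2
         - m * (1 - (Eg (c t) g (phi k))\<^sup>2)) \<partial>disorder N))) (at t)"
proof -
  let ?P = "\<lambda>s g. \<Prod>r<m. gw N h (c s) g (\<rho> r)"
  let ?V = "\<lambda>s k g. (\<Sum>r<m. phi k (\<rho> r)) - m * Eg (c s) g (phi k)"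
  let ?F' = "\<lambda>s g. \<Sum>k\<in>bonds N. c' s k * (g k * (?P s g * ?V s k g))"
  have "((\<lambda>s. \<integral>g. ?P s g \<partial>disorder N) has_real_derivative (\<integral>g. ?F' t g \<partial>disorder N)) (at t)"
  proof (rule deriv_integral[where G="\<lambda>g. \<Sum>k\<in>bonds N. B * \<bar>g k\<bar> * (2 * real m)"])
    show "integrable (disorder N) (?P s)" for s by (rule integrable_prod_gw[OF \<rho>])
    show "(\<lambda>g. ?F' t g) \<in> borel_measurable (disorder N)"
      by (intro borel_measurable_sum borel_measurable_times borel_measurable_const borel_measurable_diff
          measurable_disorder_component bonds_sub measurable_prod_gw measurable_gw)
    show "((\<lambda>s. ?P s g) has_real_derivative ?F' s g) (at s)" for s g
    proof -
      let ?e = "\<lambda>\<sigma>. \<Sum>k\<in>bonds N. c' s k * g k * phi k \<sigma>"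
      have "((\<lambda>s. ham N h (c s) g \<sigma>) has_real_derivative ?e \<sigma>) (at s)" for \<sigma>
        unfolding ham_def
        by (rule DERIV_cong, rule DERIV_add, rule DERIV_sum, rule DERIV_cmult_right, rule DERIV_cmult_right, erule d, rule DERIV_const) simp
      from prod_gw_deriv[OF \<rho>, of c "\<lambda>_. g" ?e s, OF this]
      have D: "((\<lambda>s. ?P s g) has_real_derivative ?P s g * ((\<Sum>r<m. ?e (\<rho> r)) - m * Eg (c s) g ?e)) (at s)"
        by simp
      have 1: "(\<Sum>r<m. ?e (\<rho> r)) = (\<Sum>k\<in>bonds N. c' s k * g k * (\<Sum>r<m. phi k (\<rho> r)))"
        by (subst sum.swap) (simp add: sum_distrib_left)
      have 2: "Eg (c s) g ?e = (\<Sum>k\<in>bonds N. c' s k * g k * Eg (c s) g (phi k))"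
        unfolding sum_distrib_left by (subst sum.swap) (simp add: mult_ac)
      show ?thesis
      proof (rule DERIV_cong[OF D])
        have "P * ((\<Sum>k\<in>B. a k * b k * S k) - M * (\<Sum>k\<in>B. a k * b k * E k)) = (\<Sum>k\<in>B. a k * (b k * (P * (S k - M * E k))))"
          for P M :: real and B and a b S E :: "nat \<times> nat \<Rightarrow> real"
        proof -
          have "P * ((\<Sum>k\<in>B. a k * b k * S k) - M * (\<Sum>k\<in>B. a k * b k * E k))
            = (\<Sum>k\<in>B. P * (a k * b k * S k) - P * (M * (a k * b k * E k)))"
            by (simp only: right_diff_distrib sum_distrib_left sum_subtractf)
          also have "\<dots> = (\<Sum>k\<in>B. a k * (b k * (P * (S k - M * E k))))"
            by (intro sum.cong refl) (simp add: algebra_simps)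
          finally show ?thesis .
        qed
        then show "?P s g * ((\<Sum>r<m. ?e (\<rho> r)) - m * Eg (c s) g ?e) = ?F' s g"
          unfolding 1 2 .
      qed
    qed
    show "integrable (disorder N) (\<lambda>g. \<Sum>k\<in>bonds N. B * \<bar>g k\<bar> * (2 * real m))"
      by (intro Bochner_Integration.integrable_sum integrable_mult_left integrable_mult_right)
        (use integral_disorder_component(2)[OF bonds_sub, of _ N abs] integrable_gauss_abs in auto)
    show "\<bar>?F' s g\<bar> \<le> (\<Sum>k\<in>bonds N. B * \<bar>g k\<bar> * (2 * real m))" for s g
    proof (rule order_trans[OF sum_abs], rule sum_mono)
      fix k assume k: "k \<in> bonds N"
      have V: "\<bar>?V s k g\<bar> \<le> 2 * real m"
        by (rule bracket_bound(1)[OF sum_phi_bound[OF k \<rho>] Eg_phi_bound[OF k]])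
      have P: "\<bar>?P s g\<bar> \<le> 1" using prod_gw_bounds[OF \<rho>, of "c s" g] by simp
      have "\<bar>?P s g * ?V s k g\<bar> \<le> 1 * (2 * real m)" unfolding abs_mult[of "?P s g"] by (rule mult_mono[OF P V]) auto
      then have "\<bar>g k * (?P s g * ?V s k g)\<bar> \<le> \<bar>g k\<bar> * (2 * real m)"
        unfolding abs_mult[of "g k"] mult_1 by (rule mult_left_mono) simp
      then have "\<bar>c' s k * (g k * (?P s g * ?V s k g))\<bar> \<le> B * (\<bar>g k\<bar> * (2 * real m))"
        unfolding abs_mult[of "c' s k"] using b[OF k, of s] by (intro mult_mono) auto
      then show "\<bar>c' s k * (g k * (?P s g * ?V s k g))\<bar> \<le> B * \<bar>g k\<bar> * (2 * real m)"
        by (simp only: mult.assoc)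
    qed
  qed
  moreover have "(\<integral>g. ?F' t g \<partial>disorder N) =
     (\<Sum>k\<in>bonds N. c t k * c' t k * (\<integral>g. ?P t g * ((?V t k g)\<^sup>2 - m * (1 - (Eg (c t) g (phi k))\<^sup>2)) \<partial>disorder N))"
  proof -
    have "(\<integral>g. ?F' t g \<partial>disorder N) = (\<Sum>k\<in>bonds N. c' t k * (\<integral>g. g k * (?P t g * ?V t k g) \<partial>disorder N))"
      by (subst Bochner_Integration.integral_sum) (use prod_gw_ibp(2)[OF \<rho>] in \<open>auto intro!: integrable_mult_right\<close>)
    also have "\<dots> = (\<Sum>k\<in>bonds N. c' t k * (\<integral>g. c t k * (?P t g * ((?V t k g)\<^sup>2 - m * (1 - (Eg (c t) g (phi k))\<^sup>2))) \<partial>disorder N))"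
      by (intro sum.cong refl arg_cong2[where f="(*)"] prod_gw_ibp(1)[OF \<rho>])
    finally show ?thesis by (simp add: mult_ac)
  qed
  ultimately show ?thesis unfolding om_def by simp
qed

lemma sum_sq_pairs:
  fixes x :: "nat \<Rightarrow> real"
  shows "(\<Sum>r<m. x r)\<^sup>2 = (\<Sum>r<m. x r * x r) + 2 * (\<Sum>b<m. \<Sum>a<b. x a * x b)"
  by (induction m) (auto simp: power2_eq_square algebra_simps sum_distrib_left sum_distrib_right)

text \<open>Expand the square. The diagonal terms add up to m and cancel the constant. Each factor
  equal to the mean E of \<open>phi k\<close> is then realised by a fresh replica, E by
  \<open>m\<close> and E^2 by \<open>m\<close> together with \<open>m + 1\<close>, with total
  coefficient m^2 + m for E^2.\<close>

lemma qavg_bracket: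
  assumes f: "dep m f" and k: "k \<in> bonds N"
  shows "(\<Sum>\<rho>\<in>reps N m. f \<rho> * ((\<Prod>r<m. gw N h c g (\<rho> r)) *
       (((\<Sum>r<m. phi k (\<rho> r)) - m * Eg c g (phi k))\<^sup>2 - m * (1 - (Eg c g (phi k))\<^sup>2))))
     = qavg N h c (m + 2) g (\<lambda>\<rho>. f \<rho> * br m (\<lambda>a b. phi k (\<rho> a) * phi k (\<rho> b)))"
proof -
  let ?E = "Eg c g (phi k)"
  have dp: "dep m (\<lambda>\<rho>. f \<rho> * G \<rho>)" if "dep m G" for G
    using f that unfolding dep_def by metis
  have d1: "dep m (\<lambda>\<rho>. \<Sum>b<m. \<Sum>a<b. phi k (\<rho> a) * phi k (\<rho> b))"
    unfolding dep_def by (intro allI impI sum.cong refl) auto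
  have d2: "dep m (\<lambda>\<rho>. \<Sum>a<m. phi k (\<rho> a))"
    unfolding dep_def by (intro allI impI sum.cong refl) auto
  have 1: "qavg N h c (m + 2) g (\<lambda>\<rho>. f \<rho> * (\<Sum>b<m. \<Sum>a<b. phi k (\<rho> a) * phi k (\<rho> b)))
     = qavg N h c m g (\<lambda>\<rho>. f \<rho> * (\<Sum>b<m. \<Sum>a<b. phi k (\<rho> a) * phi k (\<rho> b)))"
    by (rule qavg_dep) (auto intro: dp d1)
  have "qavg N h c (m + 2) g (\<lambda>\<rho>. (f \<rho> * (\<Sum>a<m. phi k (\<rho> a))) * phi k (\<rho> m))
     = qavg N h c (Suc m) g (\<lambda>\<rho>. (f \<rho> * (\<Sum>a<m. phi k (\<rho> a))) * phi k (\<rho> m))"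
    by (rule qavg_dep) (use dp[OF d2] in \<open>auto simp: dep_def\<close>)
  also have "\<dots> = qavg N h c m g (\<lambda>\<rho>. f \<rho> * (\<Sum>a<m. phi k (\<rho> a))) * ?E"
    by (rule qavg_mult_last[OF dp[OF d2]])
  finally have 2: "qavg N h c (m + 2) g (\<lambda>\<rho>. f \<rho> * (\<Sum>a<m. phi k (\<rho> a) * phi k (\<rho> m)))
     = qavg N h c m g (\<lambda>\<rho>. f \<rho> * (\<Sum>a<m. phi k (\<rho> a))) * ?E"
    by (simp add: sum_distrib_right mult.assoc)
  have "qavg N h c (Suc (Suc m)) g (\<lambda>\<rho>. (f \<rho> * phi k (\<rho> m)) * phi k (\<rho> (Suc m)))
     = qavg N h c (Suc m) g (\<lambda>\<rho>. f \<rho> * phi k (\<rho> m)) * ?E"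
    by (rule qavg_mult_last) (use f in \<open>auto simp: dep_def\<close>)
  also have "\<dots> = qavg N h c m g f * ?E * ?E"
    by (subst qavg_mult_last[OF f]) simp
  finally have 3: "qavg N h c (m + 2) g (\<lambda>\<rho>. f \<rho> * (phi k (\<rho> m) * phi k (\<rho> (m + 1)))) = qavg N h c m g f * ?E * ?E"
    by (simp add: mult.assoc)
  have "(\<lambda>\<rho>. f \<rho> * br m (\<lambda>a b. phi k (\<rho> a) * phi k (\<rho> b))) =
     (\<lambda>\<rho>. 2 * (f \<rho> * (\<Sum>b<m. \<Sum>a<b. phi k (\<rho> a) * phi k (\<rho> b)))
        - 2 * m * (f \<rho> * (\<Sum>a<m. phi k (\<rho> a) * phi k (\<rho> m)))
        + real m * (real m + 1) * (f \<rho> * (phi k (\<rho> m) * phi k (\<rho> (m + 1)))))"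
    unfolding br_def by (auto simp: algebra_simps)
  then have "qavg N h c (m + 2) g (\<lambda>\<rho>. f \<rho> * br m (\<lambda>a b. phi k (\<rho> a) * phi k (\<rho> b))) =
     2 * qavg N h c m g (\<lambda>\<rho>. f \<rho> * (\<Sum>b<m. \<Sum>a<b. phi k (\<rho> a) * phi k (\<rho> b)))
     - 2 * m * (qavg N h c m g (\<lambda>\<rho>. f \<rho> * (\<Sum>a<m. phi k (\<rho> a))) * ?E)
     + real m * (real m + 1) * (qavg N h c m g f * ?E * ?E)"
    by (simp only: qavg_add qavg_diff qavg_cmult 1 2 3)
  also have "\<dots> = qavg N h c m g (\<lambda>\<rho>. f \<rho> * (2 * (\<Sum>b<m. \<Sum>a<b. phi k (\<rho> a) * phi k (\<rho> b))
      - 2 * m * ?E * (\<Sum>a<m. phi k (\<rho> a)) + real m * (real m + 1) * ?E * ?E))"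
  proof -
    have "(\<lambda>\<rho>. f \<rho> * (2 * A \<rho> - 2 * m * E * B \<rho> + real m * (real m + 1) * E * E)) =
       (\<lambda>\<rho>. 2 * (f \<rho> * A \<rho>) - 2 * m * E * (f \<rho> * B \<rho>) + real m * (real m + 1) * E * E * f \<rho>)"
      for E :: real and A B :: "(nat \<Rightarrow> nat \<Rightarrow> real) \<Rightarrow> real"
      by (auto simp: algebra_simps)
    then show ?thesis
      unfolding qavg_add qavg_diff qavg_cmult by (simp only: qavg_add qavg_diff qavg_cmult) (simp only: mult_ac)
  qed
  also have "\<dots> = (\<Sum>\<rho>\<in>reps N m. f \<rho> * ((\<Prod>r<m. gw N h c g (\<rho> r)) *
       (((\<Sum>r<m. phi k (\<rho> r)) - m * Eg c g (phi k))\<^sup>2 - m * (1 - (Eg c g (phi k))\<^sup>2))))"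
    unfolding qavg_def
  proof (intro sum.cong refl)
    fix \<rho> assume \<rho>: "\<rho> \<in> reps N m"
    have sq: "(\<Sum>r<m. phi k (\<rho> r) * phi k (\<rho> r)) = m"
      using phi_sq[OF k reps_configs[OF \<rho>]] by simp
    have T: "2 * (\<Sum>b<m. \<Sum>a<b. phi k (\<rho> a) * phi k (\<rho> b)) = (\<Sum>r<m. phi k (\<rho> r))\<^sup>2 - m"
      using sum_sq_pairs[of "\<lambda>r. phi k (\<rho> r)" m] sq by simp
    have alg: "x * (S\<^sup>2 - M - 2 * M * E * S + M * (M + 1) * E * E) * P = x * (P * ((S - M * E)\<^sup>2 - M * (1 - E\<^sup>2)))"
      for x S M E P :: real
      by (simp add: power2_eq_square algebra_simps)
    show "f \<rho> * (2 * (\<Sum>b<m. \<Sum>a<b. phi k (\<rho> a) * phi k (\<rho> b))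
      - 2 * m * ?E * (\<Sum>a<m. phi k (\<rho> a)) + real m * (real m + 1) * ?E * ?E) * (\<Prod>r<m. gw N h c g (\<rho> r)) =
      f \<rho> * ((\<Prod>r<m. gw N h c g (\<rho> r)) *
       (((\<Sum>r<m. phi k (\<rho> r)) - m * ?E)\<^sup>2 - m * (1 - ?E\<^sup>2)))"
      unfolding T of_nat_mult of_nat_numeral by (rule alg)
  qed
  finally show ?thesis ..
qed

text \<open>Product rule over the finite sum of replica configurations. Both sides are averages over
  the same \<open>K\<close> replicas, so that derivatives can be compared with the original average
  and differentiated again.\<close>

lemma nu_deriv:
  assumes f: "\<And>s. dep m (f s)" and K: "m + 2 \<le> K"
    and fd: "\<And>\<rho>. ((\<lambda>s. f s \<rho>) has_real_derivative f' \<rho>) (at t)"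
    and d: "\<And>k s. k \<in> bonds N \<Longrightarrow> ((\<lambda>s. c s k) has_real_derivative c' s k) (at s)"
    and b: "\<And>k s. k \<in> bonds N \<Longrightarrow> \<bar>c' s k\<bar> \<le> B"
  shows "((\<lambda>s. nu N h (c s) K (f s)) has_real_derivative
    nu N h (c t) K f' +
    (\<Sum>k\<in>bonds N. c t k * c' t k * nu N h (c t) K (\<lambda>\<rho>. f t \<rho> * br m (\<lambda>a b. phi k (\<rho> a) * phi k (\<rho> b))))) (at t)"
proof -
  let ?W = "\<lambda>k \<rho> g. (\<Prod>r<m. gw N h (c t) g (\<rho> r)) *
       (((\<Sum>r<m. phi k (\<rho> r)) - m * Eg (c t) g (phi k))\<^sup>2 - m * (1 - (Eg (c t) g (phi k))\<^sup>2))"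
  have f': "dep m f'"
    unfolding dep_def
  proof (intro allI impI)
    fix \<rho> \<rho>' :: "nat \<Rightarrow> nat \<Rightarrow> real" assume "\<forall>r<m. \<rho> r = \<rho>' r"
    then have "f s \<rho> = f s \<rho>'" for s using f[of s] unfolding dep_def by blast
    then show "f' \<rho> = f' \<rho>'" using fd[of \<rho>] fd[of \<rho>'] DERIV_unique by auto
  qed
  have int: "integrable (disorder N) (?W k \<rho>)" if k: "k \<in> bonds N" and \<rho>: "\<rho> \<in> reps N m" for k \<rho>
  proof (rule integrable_disorder_bounded[where B="1 * ((2 * real m)\<^sup>2 + m)"])
    show "?W k \<rho> \<in> borel_measurable (disorder N)" by measurable
    fix g
    show "\<bar>?W k \<rho> g\<bar> \<le> 1 * ((2 * real m)\<^sup>2 + m)"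
      unfolding abs_mult[of "\<Prod>r<m. gw N h (c t) g (\<rho> r)"]
      using prod_gw_bounds[OF \<rho>, of "c t" g]
      by (intro mult_mono bracket_bound(2) sum_phi_bound[OF k \<rho>] Eg_phi_bound[OF k]) auto
  qed
  have eq: "(\<Sum>\<rho>\<in>reps N m. f t \<rho> * (\<integral>g. ?W k \<rho> g \<partial>disorder N))
      = nu N h (c t) K (\<lambda>\<rho>. f t \<rho> * br m (\<lambda>a b. phi k (\<rho> a) * phi k (\<rho> b)))" if k: "k \<in> bonds N" for k
  proof -
    have "(\<Sum>\<rho>\<in>reps N m. f t \<rho> * (\<integral>g. ?W k \<rho> g \<partial>disorder N))
       = (\<integral>g. (\<Sum>\<rho>\<in>reps N m. f t \<rho> * ?W k \<rho> g) \<partial>disorder N)"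
      by (subst Bochner_Integration.integral_sum) (auto intro!: int k integrable_mult_right)
    also have "\<dots> = nu N h (c t) (m + 2) (\<lambda>\<rho>. f t \<rho> * br m (\<lambda>a b. phi k (\<rho> a) * phi k (\<rho> b)))"
      unfolding nu_def qavg_bracket[OF f k, symmetric] by simp
    also have "\<dots> = nu N h (c t) K (\<lambda>\<rho>. f t \<rho> * br m (\<lambda>a b. phi k (\<rho> a) * phi k (\<rho> b)))"
    proof (rule nu_dep[OF _ K, symmetric])
      show "dep (m + 2) (\<lambda>\<rho>. f t \<rho> * br m (\<lambda>a b. phi k (\<rho> a) * phi k (\<rho> b)))"
        unfolding dep_def
      proof (intro allI impI)
        fix \<rho> \<rho>' :: "nat \<Rightarrow> nat \<Rightarrow> real" assume eq: "\<forall>r<m + 2. \<rho> r = \<rho>' r"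
        then have "f t \<rho> = f t \<rho>'" using f[of t] unfolding dep_def by auto
        moreover have "br m (\<lambda>a b. phi k (\<rho> a) * phi k (\<rho> b)) = br m (\<lambda>a b. phi k (\<rho>' a) * phi k (\<rho>' b))"
          unfolding br_def using eq by (auto intro!: sum.cong arg_cong2[where f="(+)"] arg_cong2[where f="(-)"])
        ultimately show "f t \<rho> * br m (\<lambda>a b. phi k (\<rho> a) * phi k (\<rho> b)) = f t \<rho>' * br m (\<lambda>a b. phi k (\<rho>' a) * phi k (\<rho>' b))"
          by simp
      qed
    qed
    finally show ?thesis .
  qed
  have "((\<lambda>s. \<Sum>\<rho>\<in>reps N m. f s \<rho> * om N h (c s) m \<rho>) has_real_derivative
     (\<Sum>\<rho>\<in>reps N m. f' \<rho> * om N h (c t) m \<rho> +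
        (\<Sum>k\<in>bonds N. c t k * c' t k * (\<integral>g. ?W k \<rho> g \<partial>disorder N)) * f t \<rho>)) (at t)"
    by (rule DERIV_sum, rule DERIV_mult[OF fd om_deriv[OF _ d b]])
  moreover have "(\<Sum>\<rho>\<in>reps N m. f' \<rho> * om N h (c t) m \<rho> +
        (\<Sum>k\<in>bonds N. c t k * c' t k * (\<integral>g. ?W k \<rho> g \<partial>disorder N)) * f t \<rho>) =
     nu N h (c t) K f' + (\<Sum>k\<in>bonds N. c t k * c' t k * (\<Sum>\<rho>\<in>reps N m. f t \<rho> * (\<integral>g. ?W k \<rho> g \<partial>disorder N)))"
    using nu_dep[OF f', of K "c t"] K
    unfolding sum.distrib nu_eq sum_distrib_right sum_distrib_left
    by (subst (2) sum.swap) (simp add: mult_ac)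
  moreover have "nu N h (c s) K (f s) = (\<Sum>\<rho>\<in>reps N m. f s \<rho> * om N h (c s) m \<rho>)" for s
    using nu_dep[OF f, of K "c s" s] K by (simp add: nu_eq)
  ultimately show ?thesis
    by (simp add: eq cong: sum.cong)
qed

end

section \<open>Symmetry and decoupling of a site\<close>

lemma sum_bonds:
  fixes F :: "nat \<times> nat \<Rightarrow> real"
  shows "(\<Sum>k\<in>bonds N. F k) = (\<Sum>i<N. F (i, i)) + (\<Sum>i<N. \<Sum>j\<in>{i<..<N}. F (i, j))"
proof -
  have "bonds N = (\<lambda>i. (i, i)) ` {..<N} \<union> Sigma {..<N} (\<lambda>i. {i<..<N})"
    by (auto simp: bonds_def image_iff)
  then have "(\<Sum>k\<in>bonds N. F k) = (\<Sum>k\<in>(\<lambda>i. (i, i)) ` {..<N}. F k) + (\<Sum>k\<in>Sigma {..<N} (\<lambda>i. {i<..<N}). F k)"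
    by (simp only:) (rule sum.union_disjoint, auto)
  also have "(\<Sum>k\<in>(\<lambda>i. (i, i)) ` {..<N}. F k) = (\<Sum>i<N. F (i, i))"
    by (subst sum.reindex) (auto simp: inj_on_def)
  also have "(\<Sum>k\<in>Sigma {..<N} (\<lambda>i. {i<..<N}). F k) = (\<Sum>i<N. \<Sum>j\<in>{i<..<N}. F (i, j))"
    by (subst sum.Sigma) (auto simp: split_def)
  finally show ?thesis .
qed

section \<open>Identification with the given Gibbs average\<close>

definition skc :: "nat \<Rightarrow> real \<Rightarrow> nat \<times> nat \<Rightarrow> real" where
  "skc N \<beta> = (\<lambda>(i, j). if i < j then \<beta> / sqrt N else 0)"

lemma ham_skc: "ham N h (skc N \<beta>) g \<sigma> = minusH N \<beta> h g \<sigma>"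
proof -
  have "(\<Sum>i<N. \<Sum>j\<in>{i<..<N}. skc N \<beta> (i, j) * g (i, j) * phi (i, j) \<sigma>)
     = \<beta> / sqrt N * (\<Sum>i<N. \<Sum>j\<in>{i<..<N}. g (i, j) * \<sigma> i * \<sigma> j)"
    unfolding sum_distrib_left by (intro sum.cong refl) (auto simp: skc_def phi_def)
  then show ?thesis
    unfolding ham_def minusH_def sum_bonds by (simp add: skc_def)
qed

lemma gibbs_avg_eq: "gibbs_avg N \<beta> h g m F = qavg N h (skc N \<beta>) m g F"
proof -
  have "(\<Prod>r<m. gw N h (skc N \<beta>) g (\<rho> r)) = (\<Prod>r<m. exp (minusH N \<beta> h g (\<rho> r))) / Zpart N \<beta> h g ^ m" for \<rho>
    unfolding gw_def ham_skc Zpart_def[symmetric] by (simp only: prod_dividef prod_constant card_lessThan)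
  then show ?thesis
    unfolding gibbs_avg_def qavg_def reps_def by (simp only: sum_divide_distrib times_divide_eq_right)
qed

section \<open>Replica expectation: linearity, positivity, exchangeability\<close>

context
  fixes N :: nat and h :: real
begin

lemma qavg_one: "qavg N h c m g (\<lambda>_. 1) = 1"
proof (induction m)
  case 0 show ?case by (simp add: qavg_def reps_def)
next
  case (Suc m) then show ?case by (simp add: qavg_Suc gw_sum)
qed

lemma nu_one: "nu N h c m (\<lambda>_. 1) = 1"
proof -
  interpret prob_space "disorder N" by (rule prob_space_disorder)
  show ?thesis unfolding nu_def qavg_one by (simp add: prob_space)
qed

lemma nu_cmult: "nu N h c m (\<lambda>\<rho>. x * f \<rho>) = x * nu N h c m f"
  unfolding nu_eq by (simp only: sum_distrib_left mult.assoc)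

lemma nu_add: "nu N h c m (\<lambda>\<rho>. f \<rho> + f' \<rho>) = nu N h c m f + nu N h c m f'"
  unfolding nu_eq by (simp only: distrib_right sum.distrib)

lemma nu_diff: "nu N h c m (\<lambda>\<rho>. f \<rho> - f' \<rho>) = nu N h c m f - nu N h c m f'"
  unfolding nu_eq by (simp only: left_diff_distrib sum_subtractf)

lemma nu_uminus: "nu N h c m (\<lambda>\<rho>. - f \<rho>) = - nu N h c m f"
  using nu_cmult[of c m "-1" f] by simp

lemma nu_sum: "nu N h c m (\<lambda>\<rho>. \<Sum>i\<in>I. f i \<rho>) = (\<Sum>i\<in>I. nu N h c m (f i))"
  unfolding nu_eq sum_distrib_right by (rule sum.swap)

lemma nu_const: "nu N h c m (\<lambda>_. x) = x"
  using nu_cmult[of c m x "\<lambda>_. 1"] by (simp add: nu_one)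

lemma nu_cong: "(\<And>\<rho>. \<rho> \<in> reps N m \<Longrightarrow> f \<rho> = f' \<rho>) \<Longrightarrow> nu N h c m f = nu N h c m f'"
  unfolding nu_eq by (intro sum.cong) auto

lemma nu_mono: "(\<And>\<rho>. \<rho> \<in> reps N m \<Longrightarrow> f \<rho> \<le> f' \<rho>) \<Longrightarrow> nu N h c m f \<le> nu N h c m f'"
  unfolding nu_eq by (intro sum_mono mult_right_mono om_nonneg) auto

lemma nu_nonneg: "(\<And>\<rho>. \<rho> \<in> reps N m \<Longrightarrow> 0 \<le> f \<rho>) \<Longrightarrow> 0 \<le> nu N h c m f"
  unfolding nu_eq by (intro sum_nonneg mult_nonneg_nonneg om_nonneg) auto

lemma nu_abs: "\<bar>nu N h c m f\<bar> \<le> nu N h c m (\<lambda>\<rho>. \<bar>f \<rho>\<bar>)"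
  unfolding nu_eq
proof (rule order_trans[OF sum_abs], rule sum_mono)
  fix \<rho> assume "\<rho> \<in> reps N m"
  then show "\<bar>f \<rho> * om N h c m \<rho>\<bar> \<le> \<bar>f \<rho>\<bar> * om N h c m \<rho>"
    using om_nonneg[of \<rho> N m h c] by (simp add: abs_mult)
qed

lemma nu_abs_le:
  assumes "\<And>\<rho>. \<rho> \<in> reps N m \<Longrightarrow> \<bar>f \<rho>\<bar> \<le> f' \<rho>"
  shows "\<bar>nu N h c m f\<bar> \<le> nu N h c m f'"
  by (rule order_trans[OF nu_abs nu_mono[OF assms]])

lemma reps_perm:
  assumes "\<rho> \<in> reps N m" "\<pi> permutes {..<m}" shows "\<rho> \<circ> \<pi> \<in> reps N m"
  unfolding reps_def
proof (rule PiE_I)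
  fix r assume "r \<in> {..<m}"
  then have "\<pi> r < m" using permutes_in_image[OF assms(2)] by auto
  then show "(\<rho> \<circ> \<pi>) r \<in> configs N" using reps_configs[OF assms(1)] by simp
next
  fix r assume "r \<notin> {..<m}"
  then show "(\<rho> \<circ> \<pi>) r = undefined"
    using assms permutes_not_in[OF assms(2)] by (auto simp: reps_def PiE_iff extensional_def)
qed

lemma nu_perm:
  assumes \<pi>: "\<pi> permutes {..<m}"
  shows "nu N h c m (\<lambda>\<rho>. f (\<rho> \<circ> \<pi>)) = nu N h c m f"
proof -
  have inv: "inv \<pi> permutes {..<m}" by (rule permutes_inv[OF \<pi>])
  have bij: "bij_betw (\<lambda>\<rho>. \<rho> \<circ> \<pi>) (reps N m) (reps N m)"
  proof (rule bij_betw_byWitness[where f'="\<lambda>\<rho>. \<rho> \<circ> inv \<pi>"])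
    show "\<forall>\<rho>\<in>reps N m. (\<rho> \<circ> \<pi>) \<circ> inv \<pi> = \<rho>" "\<forall>\<rho>\<in>reps N m. (\<rho> \<circ> inv \<pi>) \<circ> \<pi> = \<rho>"
      using permutes_inv_o[OF \<pi>] by (simp_all add: o_assoc[symmetric])
  qed (use reps_perm[OF _ \<pi>] reps_perm[OF _ inv] in auto)
  have "om N h c m (\<rho> \<circ> \<pi>) = om N h c m \<rho>" for \<rho>
  proof -
    have "(\<Prod>r<m. gw N h c g ((\<rho> \<circ> \<pi>) r)) = (\<Prod>r<m. gw N h c g (\<rho> r))" for g
      using prod.permute[OF \<pi>, of "\<lambda>r. gw N h c g (\<rho> r)"] by (simp add: comp_def)
    then show ?thesis unfolding om_def by simp
  qed
  then have "nu N h c m (\<lambda>\<rho>. f (\<rho> \<circ> \<pi>)) = (\<Sum>\<rho>\<in>reps N m. f (\<rho> \<circ> \<pi>) * om N h c m (\<rho> \<circ> \<pi>))"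
    unfolding nu_eq by simp
  also have "\<dots> = (\<Sum>\<rho>\<in>reps N m. f \<rho> * om N h c m \<rho>)"
    by (rule sum.reindex_bij_betw[OF bij, of "\<lambda>\<rho>. f \<rho> * om N h c m \<rho>"])
  finally show ?thesis unfolding nu_eq .
qed

lemma nu_pair:
  assumes "u < K" "v < K" "u \<noteq> v"
  shows "nu N h c K (\<lambda>\<rho>. F (\<rho> u) (\<rho> v)) = nu N h c K (\<lambda>\<rho>. F (\<rho> 0) (\<rho> 1))"
proof -
  \<comment> \<open>The position of 1 after exchanging 0 and \<open>u\<close>; a second exchange, of
    \<open>x\<close> and \<open>v\<close>, brings it to \<open>v\<close> and leaves \<open>u\<close>
    in place.\<close>
  define x where "x = Transposition.transpose 0 u 1"
  have x: "x < K" "x \<noteq> u" using assms by (auto simp: x_def Transposition.transpose_def)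
  define \<pi> where "\<pi> = Transposition.transpose v x \<circ> Transposition.transpose 0 u"
  have "\<pi> permutes {..<K}"
    unfolding \<pi>_def by (rule permutes_compose; rule permutes_swap_id) (use assms x in auto)
  moreover have "\<pi> 0 = u" using assms x by (simp add: \<pi>_def Transposition.transpose_def)
  moreover have "\<pi> 1 = v" unfolding \<pi>_def comp_def x_def by simp
  ultimately show ?thesis
    using nu_perm[of \<pi> K c "\<lambda>\<rho>. F (\<rho> 0) (\<rho> 1)"] by (simp add: comp_def)
qed

text \<open>Expand the nonnegative product of the two differences between the pairs (0,1) and (2,3);
  exchanging the pairs identifies the four resulting terms two by two.\<close>

lemma nu_cheb:
  fixes F G :: "(nat \<Rightarrow> real) \<Rightarrow> (nat \<Rightarrow> real) \<Rightarrow> real"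
  assumes K: "4 \<le> K" and mono: "\<And>x y x' y'. 0 \<le> (F x y - F x' y') * (G x y - G x' y')"
  shows "nu N h c K (\<lambda>\<rho>. F (\<rho> 0) (\<rho> 1) * G (\<rho> 2) (\<rho> 3)) \<le> nu N h c K (\<lambda>\<rho>. F (\<rho> 0) (\<rho> 1) * G (\<rho> 0) (\<rho> 1))"
proof -
  define \<pi> where "\<pi> = Transposition.transpose (0::nat) 2 \<circ> Transposition.transpose 1 3"
  have \<pi>: "\<pi> permutes {..<K}"
    unfolding \<pi>_def by (rule permutes_compose; rule permutes_swap_id) (use K in auto)
  have v: "\<pi> 0 = 2" "\<pi> 1 = 3" "\<pi> 2 = 0" "\<pi> 3 = 1" "\<pi> (Suc 0) = 3" by (auto simp: \<pi>_def Transposition.transpose_def)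
  have 1: "nu N h c K (\<lambda>\<rho>. F (\<rho> 2) (\<rho> 3) * G (\<rho> 2) (\<rho> 3)) = nu N h c K (\<lambda>\<rho>. F (\<rho> 0) (\<rho> 1) * G (\<rho> 0) (\<rho> 1))"
    using nu_perm[OF \<pi>, of c "\<lambda>\<rho>. F (\<rho> 0) (\<rho> 1) * G (\<rho> 0) (\<rho> 1)"] by (simp only: comp_def v)
  have 2: "nu N h c K (\<lambda>\<rho>. F (\<rho> 2) (\<rho> 3) * G (\<rho> 0) (\<rho> 1)) = nu N h c K (\<lambda>\<rho>. F (\<rho> 0) (\<rho> 1) * G (\<rho> 2) (\<rho> 3))"
    using nu_perm[OF \<pi>, of c "\<lambda>\<rho>. F (\<rho> 0) (\<rho> 1) * G (\<rho> 2) (\<rho> 3)"] by (simp only: comp_def v)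
  have "0 \<le> nu N h c K (\<lambda>\<rho>. (F (\<rho> 0) (\<rho> 1) - F (\<rho> 2) (\<rho> 3)) * (G (\<rho> 0) (\<rho> 1) - G (\<rho> 2) (\<rho> 3)))"
    by (rule nu_nonneg) (rule mono)
  also have "\<dots> = nu N h c K (\<lambda>\<rho>. F (\<rho> 0) (\<rho> 1) * G (\<rho> 0) (\<rho> 1)) - nu N h c K (\<lambda>\<rho>. F (\<rho> 0) (\<rho> 1) * G (\<rho> 2) (\<rho> 3))
     - (nu N h c K (\<lambda>\<rho>. F (\<rho> 2) (\<rho> 3) * G (\<rho> 0) (\<rho> 1)) - nu N h c K (\<lambda>\<rho>. F (\<rho> 2) (\<rho> 3) * G (\<rho> 2) (\<rho> 3)))"
    unfolding nu_diff[symmetric] by (rule nu_cong) (simp only: left_diff_distrib right_diff_distrib)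
  finally show ?thesis unfolding 1 2 by linarith
qed

end

text \<open>\<open>nosite p B\<close>: the function \<open>B\<close> of the replicas does not depend on any spin at site \<open>p\<close>.\<close>

definition nosite :: "nat \<Rightarrow> ((nat \<Rightarrow> nat \<Rightarrow> real) \<Rightarrow> real) \<Rightarrow> bool" where
  "nosite p B \<longleftrightarrow> (\<forall>\<rho> r x. B (\<rho>(r := (\<rho> r)(p := x))) = B \<rho>)"

text \<open>Moments of the magnetisation of a single spin in the random field
  \<open>\<kappa> * x + h\<close>. At a decoupled site they are the averages of products of
  \<open>k\<close> spins from distinct replicas.\<close>

definition mom :: "real \<Rightarrow> real \<Rightarrow> nat \<Rightarrow> real" where
  "mom h \<kappa> k = (\<integral>x. tanh (\<kappa> * x + h) ^ k \<partial>gauss)"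

text \<open>Setting the spin at \<open>p\<close> to 0 erases every term containing it. The
  denominator still runs over both values of this spin, so these weights sum to 1 over
  \<open>configs N\<close>.\<close>

definition cw :: "nat \<Rightarrow> real \<Rightarrow> (nat \<times> nat \<Rightarrow> real) \<Rightarrow> nat \<Rightarrow> (nat \<times> nat \<Rightarrow> real) \<Rightarrow> (nat \<Rightarrow> real) \<Rightarrow> real" where
  "cw N h c p g \<sigma> = exp (ham N h c g (\<sigma>(p := 0))) / (\<Sum>\<tau>\<in>configs N. exp (ham N h c g (\<tau>(p := 0))))"

context
  fixes N :: nat and h :: real and p :: nat and c :: "nat \<times> nat \<Rightarrow> real"
  assumes p: "p < N"
    and decoupled: "\<And>i j. (i, j) \<in> bonds N \<Longrightarrow> i \<noteq> j \<Longrightarrow> i = p \<or> j = p \<Longrightarrow> c (i, j) = 0"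
begin

lemma ham_decoupled: "ham N h c g \<sigma> = (c (p, p) * g (p, p) + h) * \<sigma> p + ham N h c g (\<sigma>(p := 0))"
proof -
  have pp: "(p, p) \<in> bonds N" using p by (simp add: bonds_def)
  have "(\<Sum>k\<in>bonds N. c k * g k * phi k \<sigma>) = (\<Sum>k\<in>bonds N. (if k = (p, p) then c k * g k * \<sigma> p else 0) + c k * g k * phi k (\<sigma>(p := 0)))"
  proof (intro sum.cong refl)
    fix k assume "k \<in> bonds N"
    then show "c k * g k * phi k \<sigma> = (if k = (p, p) then c k * g k * \<sigma> p else 0) + c k * g k * phi k (\<sigma>(p := 0))"
      using decoupled by (cases k) (auto simp: phi_def)
  qed
  also have "\<dots> = c (p, p) * g (p, p) * \<sigma> p + (\<Sum>k\<in>bonds N. c k * g k * phi k (\<sigma>(p := 0)))"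
    unfolding sum.distrib using pp by (simp add: sum.delta)
  finally have 1: "(\<Sum>k\<in>bonds N. c k * g k * phi k \<sigma>) = c (p, p) * g (p, p) * \<sigma> p + (\<Sum>k\<in>bonds N. c k * g k * phi k (\<sigma>(p := 0)))" .
  have "(\<Sum>i<N. \<sigma> i) = (\<Sum>i<N. (if i = p then \<sigma> p else 0) + (\<sigma>(p := 0)) i)"
    by (intro sum.cong refl) auto
  also have "\<dots> = \<sigma> p + (\<Sum>i<N. (\<sigma>(p := 0)) i)"
    unfolding sum.distrib using p by (simp add: sum.delta)
  finally have 2: "(\<Sum>i<N. \<sigma> i) = \<sigma> p + (\<Sum>i<N. (\<sigma>(p := 0)) i)" .
  show ?thesis unfolding ham_def 1 2 distrib_left distrib_right by simp
qed

lemma cw_site: "cw N h c p g (\<sigma>(p := x)) = cw N h c p g \<sigma>"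
  unfolding cw_def by simp

lemma cw_diag: "cw N h c p (g((p, p) := x)) \<sigma> = cw N h c p g \<sigma>"
proof -
  have "ham N h c (g((p, p) := x)) (\<sigma>(p := 0)) = ham N h c g (\<sigma>(p := 0))" for \<sigma>
  proof -
    have "(\<Sum>k\<in>bonds N. c k * (g((p, p) := x)) k * phi k (\<sigma>(p := 0))) = (\<Sum>k\<in>bonds N. c k * g k * phi k (\<sigma>(p := 0)))"
      by (intro sum.cong refl) (auto simp: phi_def)
    then show ?thesis unfolding ham_def by simp
  qed
  then show ?thesis unfolding cw_def by simp
qed

lemma configs_flip: "\<sigma> \<in> configs N \<Longrightarrow> \<sigma>(p := - \<sigma> p) \<in> configs N"
  using p unfolding configs_def by (auto simp: PiE_iff extensional_def)

lemma sum_configs_flip: "(\<Sum>\<sigma>\<in>configs N. F \<sigma>) = (\<Sum>\<sigma>\<in>configs N. F (\<sigma>(p := - \<sigma> p)))" for F :: "_ \<Rightarrow> real"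
proof -
  have "bij_betw (\<lambda>\<sigma>. \<sigma>(p := - \<sigma> p)) (configs N) (configs N)"
    by (rule bij_betw_byWitness[where f'="\<lambda>\<sigma>. \<sigma>(p := - \<sigma> p)"]) (use configs_flip in auto)
  from sum.reindex_bij_betw[OF this, of F] show ?thesis by simp
qed

lemma sum_reps_flip:
  fixes F :: "_ \<Rightarrow> real"
  assumes u: "u < m"
  shows "(\<Sum>\<rho>\<in>reps N m. F \<rho>) = (\<Sum>\<rho>\<in>reps N m. F (\<rho>(u := (\<rho> u)(p := - \<rho> u p))))"
proof -
  let ?fl = "\<lambda>\<rho>::nat \<Rightarrow> nat \<Rightarrow> real. \<rho>(u := (\<rho> u)(p := - \<rho> u p))"
  have cl: "?fl \<rho> \<in> reps N m" if "\<rho> \<in> reps N m" for \<rho>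
    using that u configs_flip[OF reps_configs[OF that u]] unfolding reps_def by (auto simp: PiE_iff extensional_def)
  have "bij_betw ?fl (reps N m) (reps N m)"
    by (rule bij_betw_byWitness[where f'="?fl"]) (use cl in \<open>auto simp: fun_eq_iff\<close>)
  from sum.reindex_bij_betw[OF this, of F] show ?thesis by simp
qed

text \<open>For a spin s = 1 or -1 one has exp(y s) = cosh y (1 + s tanh y). In the partition
  function the part odd in s cancels under the flip at \<open>p\<close>, and cosh y drops out of the
  quotient.\<close>

lemma gw_decoupled:
  assumes \<sigma>: "\<sigma> \<in> configs N"
  shows "gw N h c g \<sigma> = (1 + \<sigma> p * tanh (c (p, p) * g (p, p) + h)) * cw N h c p g \<sigma>"
proof -
  let ?y = "c (p, p) * g (p, p) + h" let ?u = "\<lambda>\<sigma>. exp (ham N h c g (\<sigma>(p := 0)))"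
  have e: "exp (ham N h c g \<sigma>) = cosh ?y * ((1 + \<sigma> p * tanh ?y) * ?u \<sigma>)" if "\<sigma> \<in> configs N" for \<sigma>
  proof -
    have "exp (y * s) = cosh y + s * sinh y" if "s = -1 \<or> s = 1" for y s :: real
      using that by (auto simp: cosh_plus_sinh cosh_minus_sinh)
    then have "exp (?y * \<sigma> p) = cosh ?y + \<sigma> p * sinh ?y"
      using configs_spin[OF that p] by blast
    also have "\<dots> = cosh ?y * (1 + \<sigma> p * tanh ?y)"
      by (simp add: tanh_def distrib_left)
    finally show ?thesis unfolding ham_decoupled[of g \<sigma>] exp_add by (simp only: mult.assoc)
  qed
  have "(\<Sum>\<sigma>\<in>configs N. \<sigma> p * ?u \<sigma>) = (\<Sum>\<sigma>\<in>configs N. - (\<sigma> p * ?u \<sigma>))"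
    by (subst sum_configs_flip) simp
  then have 0: "(\<Sum>\<sigma>\<in>configs N. \<sigma> p * ?u \<sigma>) = 0" by (simp add: sum_negf)
  have "(\<Sum>\<sigma>\<in>configs N. exp (ham N h c g \<sigma>)) = (\<Sum>\<sigma>\<in>configs N. cosh ?y * ?u \<sigma> + cosh ?y * tanh ?y * (\<sigma> p * ?u \<sigma>))"
    by (intro sum.cong refl) (simp only: e, simp only: algebra_simps)
  also have "\<dots> = cosh ?y * (\<Sum>\<sigma>\<in>configs N. ?u \<sigma>)"
    unfolding sum.distrib sum_distrib_left[symmetric] 0 by simp
  finally show ?thesis
    unfolding gw_def cw_def e[OF \<sigma>] by simp
qed

text \<open>Add to the sum its image under the flip of the spin at \<open>p\<close> in replica
  \<open>b\<close>. Since the spin squares to 1, the two terms give 2 T if \<open>b\<close> belongs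
  to \<open>A\<close> and 2 otherwise; the induction removes one replica at a time.\<close>

lemma sum_reps_decoupled:
  fixes T :: real and X :: "(nat \<Rightarrow> nat \<Rightarrow> real) \<Rightarrow> real"
  assumes X: "nosite p X" and J: "finite J" "J \<subseteq> {..<m}"
  shows "(\<Sum>\<rho>\<in>reps N m. (\<Prod>r\<in>J. (if r \<in> A then \<rho> r p else 1) * (1 + \<rho> r p * T)) * X \<rho>)
    = T ^ card (A \<inter> J) * (\<Sum>\<rho>\<in>reps N m. X \<rho>)"
  using J
proof (induction J rule: finite_induct)
  case (insert b J)
  let ?P = "\<lambda>\<rho>. \<Prod>r\<in>J. (if r \<in> A then \<rho> r p else 1) * (1 + \<rho> r p * T)"
  let ?t = "if b \<in> A then T else 1"
  have b: "b < m" using insert by auto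
  have P: "?P (\<rho>(b := (\<rho> b)(p := x))) = ?P \<rho>" for \<rho> x
    by (intro prod.cong refl) (use insert in auto)
  have XX: "X (\<rho>(b := (\<rho> b)(p := x))) = X \<rho>" for \<rho> x using X by (simp add: nosite_def)
  let ?e = "\<lambda>s. (if b \<in> A then s else 1) * (1 + s * T)"
  let ?G = "\<lambda>\<rho>. ?e (\<rho> b p) * (?P \<rho> * X \<rho>)"
  have "2 * (\<Sum>\<rho>\<in>reps N m. ?G \<rho>) = (\<Sum>\<rho>\<in>reps N m. ?G \<rho> + ?G (\<rho>(b := (\<rho> b)(p := - \<rho> b p))))"
    unfolding sum.distrib using sum_reps_flip[OF b, of ?G] by simp
  also have "\<dots> = (\<Sum>\<rho>\<in>reps N m. (2 * ?t) * (?P \<rho> * X \<rho>))"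
  proof (intro sum.cong refl)
    fix \<rho> assume "\<rho> \<in> reps N m"
    then have "\<rho> b p * \<rho> b p = 1" using configs_sq[OF reps_configs p] b by auto
    then have 1: "?e (\<rho> b p) + ?e (- \<rho> b p) = 2 * ?t"
      by (auto simp: algebra_simps)
    have "?G (\<rho>(b := (\<rho> b)(p := - \<rho> b p))) = ?e (- \<rho> b p) * (?P \<rho> * X \<rho>)"
      unfolding P XX by simp
    then show "?G \<rho> + ?G (\<rho>(b := (\<rho> b)(p := - \<rho> b p))) = (2 * ?t) * (?P \<rho> * X \<rho>)"
      unfolding 1[symmetric] distrib_right by simp
  qed
  also have "\<dots> = (2 * ?t) * (T ^ card (A \<inter> J) * (\<Sum>\<rho>\<in>reps N m. X \<rho>))"
    unfolding sum_distrib_left[symmetric] using insert by simp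
  finally have "(\<Sum>\<rho>\<in>reps N m. ?G \<rho>) = ?t * (T ^ card (A \<inter> J) * (\<Sum>\<rho>\<in>reps N m. X \<rho>))" by simp
  moreover have "?t * T ^ card (A \<inter> J) = T ^ card (A \<inter> insert b J)"
    using insert by (auto simp: Int_insert_right)
  moreover have "(\<Prod>r\<in>insert b J. (if r \<in> A then \<rho> r p else 1) * (1 + \<rho> r p * T)) * X \<rho> = ?G \<rho>" for \<rho>
    using insert by (simp only: prod.insert mult.assoc not_False_eq_True)
  ultimately show ?case
    by (simp only: mult.assoc[symmetric])
qed simp

lemma qavg_decoupled:
  assumes B: "nosite p B" and A: "A \<subseteq> {..<m}"
  shows "qavg N h c m g (\<lambda>\<rho>. (\<Prod>r\<in>A. \<rho> r p) * B \<rho>) =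
    tanh (c (p, p) * g (p, p) + h) ^ card A * (\<Sum>\<rho>\<in>reps N m. B \<rho> * (\<Prod>r<m. cw N h c p g (\<rho> r)))"
proof -
  let ?T = "tanh (c (p, p) * g (p, p) + h)"
  have X: "nosite p (\<lambda>\<rho>. B \<rho> * (\<Prod>r<m. cw N h c p g (\<rho> r)))"
  proof -
    have "cw N h c p g ((\<rho>(u := (\<rho> u)(p := x))) r) = cw N h c p g (\<rho> r)" for \<rho> u x r
      using cw_site by (cases "r = u") auto
    then have "(\<Prod>r<m. cw N h c p g ((\<rho>(u := (\<rho> u)(p := x))) r)) = (\<Prod>r<m. cw N h c p g (\<rho> r))" for \<rho> u x
      by (intro prod.cong refl)
    then show ?thesis using B unfolding nosite_def by metis
  qed
  have "qavg N h c m g (\<lambda>\<rho>. (\<Prod>r\<in>A. \<rho> r p) * B \<rho>) =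
    (\<Sum>\<rho>\<in>reps N m. (\<Prod>r<m. (if r \<in> A then \<rho> r p else 1) * (1 + \<rho> r p * ?T)) * (B \<rho> * (\<Prod>r<m. cw N h c p g (\<rho> r))))"
    unfolding qavg_def
  proof (intro sum.cong refl)
    fix \<rho> assume \<rho>: "\<rho> \<in> reps N m"
    have 1: "(\<Prod>r<m. gw N h c g (\<rho> r)) = (\<Prod>r<m. 1 + \<rho> r p * ?T) * (\<Prod>r<m. cw N h c p g (\<rho> r))"
      unfolding prod.distrib[symmetric] by (intro prod.cong refl gw_decoupled reps_configs[OF \<rho>]) auto
    have 2: "(\<Prod>r\<in>A. \<rho> r p) = (\<Prod>r<m. if r \<in> A then \<rho> r p else 1)"
      using A by (simp add: prod.If_cases Int_commute[of _ A] Int_absorb2)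
    show "(\<Prod>r\<in>A. \<rho> r p) * B \<rho> * (\<Prod>r<m. gw N h c g (\<rho> r)) =
      (\<Prod>r<m. (if r \<in> A then \<rho> r p else 1) * (1 + \<rho> r p * ?T)) * (B \<rho> * (\<Prod>r<m. cw N h c p g (\<rho> r)))"
      unfolding 1 2 prod.distrib by (simp only: mult_ac)
  qed
  also have "\<dots> = ?T ^ card (A \<inter> {..<m}) * (\<Sum>\<rho>\<in>reps N m. B \<rho> * (\<Prod>r<m. cw N h c p g (\<rho> r)))"
    by (rule sum_reps_decoupled[OF X]) auto
  finally show ?thesis using A by (simp add: Int_absorb2)
qed

text \<open>The variable \<open>g (p, p)\<close> enters only through tanh, while the cavity weights
  do not see it (\<open>cw_diag\<close>); Fubini in this coordinate factorises the
  expectation.\<close>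

lemma nu_decoupled:
  assumes B: "nosite p B" and A: "A \<subseteq> {..<m}"
  shows "nu N h c m (\<lambda>\<rho>. (\<Prod>r\<in>A. \<rho> r p) * B \<rho>) = mom h (c (p, p)) (card A) * nu N h c m B"
proof -
  define R where "R g = (\<Sum>\<rho>\<in>reps N m. B \<rho> * (\<Prod>r<m. cw N h c p g (\<rho> r)))" for g
  let ?M = "PiM ({..<N} \<times> {..<N} - {(p, p)}) (\<lambda>_. gauss)"
  interpret G: prob_space gauss by (rule prob_space_gauss)
  have pp: "(p, p) \<in> {..<N} \<times> {..<N}" using p by simp
  have qB: "qavg N h c m g B = R g" for g
    using qavg_decoupled[OF B, of "{}"] by (simp add: R_def)
  have qA: "qavg N h c m g (\<lambda>\<rho>. (\<Prod>r\<in>A. \<rho> r p) * B \<rho>) = tanh (c (p, p) * g (p, p) + h) ^ card A * R g" for g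
    using qavg_decoupled[OF B A] by (simp add: R_def)
  have R': "R (g((p, p) := x)) = R g" for g x by (simp add: R_def cw_diag)
  have "nu N h c m (\<lambda>\<rho>. (\<Prod>r\<in>A. \<rho> r p) * B \<rho>) =
      (\<integral>g. \<integral>x. qavg N h c m (g((p, p) := x)) (\<lambda>\<rho>. (\<Prod>r\<in>A. \<rho> r p) * B \<rho>) \<partial>gauss \<partial>?M)"
    unfolding nu_def by (rule integral_disorder_split[OF pp integrable_qavg])
  also have "\<dots> = (\<integral>g. \<integral>x. tanh (c (p, p) * x + h) ^ card A * R g \<partial>gauss \<partial>?M)"
    by (simp add: qA R')
  also have "\<dots> = mom h (c (p, p)) (card A) * (\<integral>g. R g \<partial>?M)"
    by (simp add: mom_def)
  also have "(\<integral>g. R g \<partial>?M) = (\<integral>g. \<integral>x. qavg N h c m (g((p, p) := x)) B \<partial>gauss \<partial>?M)"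
    by (simp add: qB R' G.prob_space[simplified])
  also have "\<dots> = nu N h c m B"
    unfolding nu_def by (rule integral_disorder_split[OF pp integrable_qavg, symmetric])
  finally show ?thesis .
qed

end

section \<open>One-site moments and the equation for q\<close>

lemma mom_0 [simp]: "mom h \<kappa> 0 = 1"
  unfolding mom_def using prob_space.prob_space[OF prob_space_gauss] by simp

lemma tanh_power_abs_le: "\<bar>tanh (x::real) ^ k\<bar> \<le> 1"
  unfolding power_abs using tanh_real_lt_1[of x] tanh_real_gt_neg1[of x] by (intro power_le_one) auto

lemma mom_integrable: "integrable gauss (\<lambda>x. tanh (\<kappa> * x + h) ^ k)"
proof (rule integrable_gauss_bounded[where B=1])
  show "(\<lambda>x. tanh (\<kappa> * x + h) ^ k) \<in> borel_measurable borel"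
    by (intro borel_measurable_continuous_onI continuous_intros) auto
qed (rule tanh_power_abs_le)

lemma mom_abs_le: "\<bar>mom h \<kappa> k\<bar> \<le> 1"
proof -
  interpret G: prob_space gauss by (rule prob_space_gauss)
  have "\<bar>mom h \<kappa> k\<bar> \<le> (\<integral>x. \<bar>tanh (\<kappa> * x + h) ^ k\<bar> \<partial>gauss)"
    unfolding mom_def using integral_norm_bound[of gauss "\<lambda>x. tanh (\<kappa> * x + h) ^ k"] by simp
  also have "\<dots> \<le> (\<integral>x. 1 \<partial>gauss)"
  proof (rule integral_mono)
    show "integrable gauss (\<lambda>x. \<bar>tanh (\<kappa> * x + h) ^ k\<bar>)" by (rule integrable_abs[OF mom_integrable])
  qed (use tanh_power_abs_le in auto)
  finally show ?thesis using G.prob_space by simp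
qed

lemma mom_square_nonneg: "0 \<le> mom h \<kappa> 2"
  unfolding mom_def by (intro Bochner_Integration.integral_nonneg) simp

text \<open>Intermediate value theorem on [0,1], since the second moment lies in [0,1]; continuity
  is dominated convergence.\<close>

lemma q_exists: "\<exists>q. 0 \<le> q \<and> q \<le> 1 \<and> q = mom h (\<beta> * sqrt q) 2"
proof -
  have cont: "continuous_on {0..1} (\<lambda>q. mom h (\<beta> * sqrt q) 2)"
    unfolding continuous_on_sequentially
  proof (intro allI ballI impI)
    fix X :: "nat \<Rightarrow> real" and q assume "q \<in> {0..1}" "(\<forall>n. X n \<in> {0..1}) \<and> X \<longlonglongrightarrow> q"
    then have X: "X \<longlonglongrightarrow> q" by simp
    have "(\<lambda>n. \<integral>x. tanh (\<beta> * sqrt (X n) * x + h) ^ 2 \<partial>gauss) \<longlonglongrightarrow> (\<integral>x. tanh (\<beta> * sqrt q * x + h) ^ 2 \<partial>gauss)"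
    proof (rule integral_dominated_convergence[where w="\<lambda>_. 1"])
      show "AE x in gauss. (\<lambda>n. (tanh (\<beta> * sqrt (X n) * x + h))\<^sup>2) \<longlonglongrightarrow> (tanh (\<beta> * sqrt q * x + h))\<^sup>2"
        by (intro AE_I2 tendsto_intros X) auto
      show "AE x in gauss. norm ((tanh (\<beta> * sqrt (X n) * x + h))\<^sup>2) \<le> 1" for n
        unfolding real_norm_def by (intro AE_I2 tanh_power_abs_le)
      show "integrable gauss (\<lambda>_. 1 :: real)" by (rule integrable_gauss_bounded[where B=1]) auto
    qed (rule borel_measurable_integrable[OF mom_integrable])+
    then show "((\<lambda>q. mom h (\<beta> * sqrt q) 2) \<circ> X) \<longlonglongrightarrow> mom h (\<beta> * sqrt q) 2"
      unfolding mom_def comp_def .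
  qed
  have "\<exists>x\<ge>0. x \<le> 1 \<and> x - mom h (\<beta> * sqrt x) 2 = 0"
  proof (rule IVT')
    show "0 - mom h (\<beta> * sqrt 0) 2 \<le> 0" using mom_square_nonneg[of h 0] by simp
    show "0 \<le> 1 - mom h (\<beta> * sqrt 1) 2" using mom_abs_le[of h "\<beta> * sqrt 1" 2] by simp
    show "continuous_on {0..1} (\<lambda>x. x - mom h (\<beta> * sqrt x) 2)" by (intro continuous_intros cont)
  qed simp
  then show ?thesis by force
qed

section \<open>Concentration of the overlap\<close>

lemma br_scale: "br m (\<lambda>a b. x * \<Gamma> a b) = x * br m \<Gamma>"
  unfolding br_def by (simp only: sum_distrib_left[symmetric]) (simp add: algebra_simps)

lemma br_add: "br m (\<lambda>a b. \<Gamma> a b + \<Delta> a b) = br m \<Gamma> + br m \<Delta>"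
  unfolding br_def by (simp add: sum.distrib algebra_simps)

lemma br_sum: "br m (\<lambda>a b. \<Sum>k\<in>I. \<Gamma> k a b) = (\<Sum>k\<in>I. br m (\<Gamma> k))"
proof (induction I rule: infinite_finite_induct)
  case (insert k I) then show ?case by (simp add: br_add)
qed (auto simp: br_def)

text \<open>The coefficients sum to m(m-1) - 2m^2 + m(m+1) = 0. Hence a covariance matters only up
  to an additive constant, which is what allows a square to be completed around q.\<close>

lemma br_const: "br m (\<lambda>_ _. x) = 0"
proof -
  have "2 * (\<Sum>b<m. \<Sum>a<b. x) = real m * (real m - 1) * x"
    by (induction m) (auto simp: algebra_simps)
  then show ?thesis unfolding br_def by (simp add: algebra_simps)
qed

lemma br_cong:
  assumes "\<And>a b. a < b \<Longrightarrow> b < m + 2 \<Longrightarrow> \<Gamma> a b = \<Delta> a b" shows "br m \<Gamma> = br m \<Delta>"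
proof -
  have "(\<Sum>b<m. \<Sum>a<b. \<Gamma> a b) = (\<Sum>b<m. \<Sum>a<b. \<Delta> a b)" "(\<Sum>a<m. \<Gamma> a m) = (\<Sum>a<m. \<Delta> a m)"
    by (intro sum.cong refl assms; simp)+
  then show ?thesis unfolding br_def using assms[of m "m + 1"] by simp
qed

text \<open>The sum over bonds is moved inside \<open>br\<close>, where only the half-derivative of
  the covariance of the Hamiltonian remains; \<open>const\<close> absorbs the part annihilated by
  \<open>br_const\<close>.\<close>

lemma nu_deriv_cov:
  assumes f: "\<And>s. dep m (f s)" and K: "m + 2 \<le> K"
    and fd: "\<And>\<rho>. ((\<lambda>s. f s \<rho>) has_real_derivative f' \<rho>) (at t)"
    and d: "\<And>k s. k \<in> bonds N \<Longrightarrow> ((\<lambda>s. c s k) has_real_derivative c' s k) (at s)"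
    and b: "\<And>k s. k \<in> bonds N \<Longrightarrow> \<bar>c' s k\<bar> \<le> B"
    and cov: "\<And>\<sigma> \<tau>. \<sigma> \<in> configs N \<Longrightarrow> \<tau> \<in> configs N \<Longrightarrow>
      (\<Sum>k\<in>bonds N. c t k * c' t k * (phi k \<sigma> * phi k \<tau>)) = \<Gamma> \<sigma> \<tau> + const"
  shows "((\<lambda>s. nu N h (c s) K (f s)) has_real_derivative
    nu N h (c t) K f' + nu N h (c t) K (\<lambda>\<rho>. f t \<rho> * br m (\<lambda>a b. \<Gamma> (\<rho> a) (\<rho> b)))) (at t)"
proof -
  have "(\<Sum>k\<in>bonds N. c t k * c' t k * nu N h (c t) K (\<lambda>\<rho>. f t \<rho> * br m (\<lambda>a b. phi k (\<rho> a) * phi k (\<rho> b))))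
      = nu N h (c t) K (\<lambda>\<rho>. \<Sum>k\<in>bonds N. c t k * c' t k * (f t \<rho> * br m (\<lambda>a b. phi k (\<rho> a) * phi k (\<rho> b))))"
    unfolding nu_sum nu_cmult ..
  also have "\<dots> = nu N h (c t) K (\<lambda>\<rho>. f t \<rho> * br m (\<lambda>a b. \<Gamma> (\<rho> a) (\<rho> b)))"
  proof (rule nu_cong)
    fix \<rho> assume \<rho>: "\<rho> \<in> reps N K"
    have "(\<Sum>k\<in>bonds N. c t k * c' t k * (f t \<rho> * br m (\<lambda>a b. phi k (\<rho> a) * phi k (\<rho> b))))
       = f t \<rho> * br m (\<lambda>a b. \<Sum>k\<in>bonds N. c t k * c' t k * (phi k (\<rho> a) * phi k (\<rho> b)))"
      unfolding br_sum br_scale by (simp only: sum_distrib_left mult_ac)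
    also have "br m (\<lambda>a b. \<Sum>k\<in>bonds N. c t k * c' t k * (phi k (\<rho> a) * phi k (\<rho> b)))
       = br m (\<lambda>a b. \<Gamma> (\<rho> a) (\<rho> b) + const)"
      by (rule br_cong, rule cov) (use reps_configs[OF \<rho>] K in auto)
    finally show "(\<Sum>k\<in>bonds N. c t k * c' t k * (f t \<rho> * br m (\<lambda>a b. phi k (\<rho> a) * phi k (\<rho> b))))
       = f t \<rho> * br m (\<lambda>a b. \<Gamma> (\<rho> a) (\<rho> b))"
      by (simp add: br_add br_const)
  qed
  finally show ?thesis
    using nu_deriv[where f=f and f'=f' and c=c and c'=c' and t=t and N=N and h=h and B=B, OF f K fd d b] by simp
qed

definition ov :: "nat \<Rightarrow> (nat \<Rightarrow> real) \<Rightarrow> (nat \<Rightarrow> real) \<Rightarrow> real" where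
  "ov N \<sigma> \<tau> = (\<Sum>i<N. \<sigma> i * \<tau> i) / N"

lemma sum_offdiag:
  fixes x :: "nat \<Rightarrow> real"
  shows "(\<Sum>i<N. \<Sum>j\<in>{i<..<N}. x i * x j) = ((\<Sum>i<N. x i)\<^sup>2 - (\<Sum>i<N. x i * x i)) / 2"
proof (induction N)
  case (Suc N)
  have "(\<Sum>i<N. \<Sum>j\<in>{i<..<Suc N}. x i * x j) = (\<Sum>i<N. (\<Sum>j\<in>{i<..<N}. x i * x j) + x i * x N)"
  proof (rule sum.cong[OF refl])
    fix i assume "i \<in> {..<N}"
    then have "{i<..<Suc N} = insert N {i<..<N}" by auto
    then show "(\<Sum>j\<in>{i<..<Suc N}. x i * x j) = (\<Sum>j\<in>{i<..<N}. x i * x j) + x i * x N" by simp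
  qed
  moreover have "{N<..<Suc N} = {}" by auto
  ultimately show ?case
    using Suc by (simp add: sum.distrib power2_eq_square field_simps sum_distrib_left[symmetric] sum_distrib_right[symmetric])
qed simp

lemma sum_spin_sq: "\<sigma> \<in> configs N \<Longrightarrow> \<tau> \<in> configs N \<Longrightarrow> i < N \<Longrightarrow> (\<sigma> i * \<tau> i) * (\<sigma> i * \<tau> i) = 1"
  using configs_sq[of \<sigma> N i] configs_sq[of \<tau> N i] by (simp add: mult.assoc mult.left_commute)

text \<open>Made for centred variables: the linear term vanishes on averaging, and a subgaussian
  bound without a prefactor is left, which can be multiplied over the sites.\<close>

lemma exp_le_quadratic: "exp x \<le> x + exp (x\<^sup>2)" for x :: real
proof -
  have e: "1 + x\<^sup>2 \<le> exp (x\<^sup>2)" by (rule exp_ge_add_one_self)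
  consider "x \<ge> 1" | "x \<le> 1" "x \<ge> 0" | "x \<le> 0" by linarith
  then show ?thesis
  proof cases
    case 1
    then have "x * 1 \<le> x * x" by (intro mult_left_mono) auto
    then have "exp x \<le> exp (x\<^sup>2)" by (simp add: power2_eq_square)
    then show ?thesis using 1 by linarith
  next
    case 2
    then show ?thesis using exp_bound[of x] e by linarith
  next
    case 3
    define y where "y = - x"
    have y: "0 \<le> y" using 3 by (simp add: y_def)
    have *: "exp (- y) \<le> 1 - y + y\<^sup>2 / 2"
    proof -
      have "1 + y + y\<^sup>2 / 2 \<le> exp y" by (rule exp_lower_Taylor_quadratic[OF y])
      then have "exp (- y) \<le> 1 / (1 + y + y\<^sup>2 / 2)"
        using y by (simp add: exp_minus field_simps add_pos_nonneg)
      also have "\<dots> \<le> 1 - y + y\<^sup>2 / 2"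
      proof -
        have "(1 - y + y\<^sup>2 / 2) * (1 + y + y\<^sup>2 / 2) = 1 + y ^ 4 / 4"
          by (simp add: power2_eq_square power4_eq_xxxx field_simps)
        then have "1 \<le> (1 - y + y\<^sup>2 / 2) * (1 + y + y\<^sup>2 / 2)" by simp
        moreover have "0 < 1 + y + y\<^sup>2 / 2" using y by (simp add: add_pos_nonneg)
        ultimately show ?thesis by (simp add: pos_divide_le_eq)
      qed
      finally show ?thesis .
    qed
    then have "exp x \<le> 1 + x + x\<^sup>2 / 2" by (simp add: y_def)
    then show ?thesis using e zero_le_power2[of x] by linarith
  qed
qed

lemma cosh_le_exp_sq: "cosh s \<le> exp (s\<^sup>2)" for s :: real
  using exp_le_quadratic[of s] exp_le_quadratic[of "- s"] by (simp add: cosh_def)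

lemma gauss_mgf:
  "(\<integral>x. exp (y * x) \<partial>gauss) = exp (y\<^sup>2 / 2)" "integrable gauss (\<lambda>x. exp (y * x))"
proof -
  have eq: "std_normal_density x * exp (y * x) = exp (y\<^sup>2 / 2) * normal_density y 1 x" for x
    unfolding normal_density_def by (simp add: exp_add[symmetric] mult_exp_exp power2_eq_square field_simps)
  show "(\<integral>x. exp (y * x) \<partial>gauss) = exp (y\<^sup>2 / 2)"
    by (subst integral_gauss) (simp_all add: eq)
  show "integrable gauss (\<lambda>x. exp (y * x))"
    by (subst integral_gauss) (simp_all add: eq)
qed

lemma gauss_exp_sq:
  "(\<integral>x. exp (x\<^sup>2 / 4) \<partial>gauss) = sqrt 2" "integrable gauss (\<lambda>x. exp (x\<^sup>2 / 4))"
proof -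
  have eq: "std_normal_density x * exp (x\<^sup>2 / 4) = sqrt 2 * normal_density 0 (sqrt 2) x" for x
    unfolding normal_density_def by (simp add: mult_exp_exp real_sqrt_mult field_simps)
  show "(\<integral>x. exp (x\<^sup>2 / 4) \<partial>gauss) = sqrt 2"
    by (subst integral_gauss) (simp_all add: eq)
  show "integrable gauss (\<lambda>x. exp (x\<^sup>2 / 4))"
    by (subst integral_gauss) (simp_all add: eq)
qed

text \<open>Gaussian linearisation: exp(X^2/32) is the average of exp(X z/4) over a standard
  Gaussian z. The hypothesis at l = z/4 gives exp(z^2/4), still integrable, with integral sqrt 2;
  this fixes the constant 32.\<close>

lemma nu_exp_square:
  assumes sub: "\<And>l. nu N h c K (\<lambda>\<rho>. exp (l * X \<rho>)) \<le> exp (4 * l\<^sup>2)"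
  shows "nu N h c K (\<lambda>\<rho>. exp ((X \<rho>)\<^sup>2 / 32)) \<le> sqrt 2"
proof -
  have X: "exp ((X \<rho>)\<^sup>2 / 32) = (\<integral>z. exp (X \<rho> / 4 * z) \<partial>gauss)" for \<rho>
    using gauss_mgf(1)[of "X \<rho> / 4"] by (simp add: power_divide)
  have "nu N h c K (\<lambda>\<rho>. exp ((X \<rho>)\<^sup>2 / 32)) = (\<Sum>\<rho>\<in>reps N K. (\<integral>z. exp (X \<rho> / 4 * z) * om N h c K \<rho> \<partial>gauss))"
    unfolding nu_eq X by simp
  also have "\<dots> = (\<integral>z. (\<Sum>\<rho>\<in>reps N K. exp (X \<rho> / 4 * z) * om N h c K \<rho>) \<partial>gauss)"
    by (rule Bochner_Integration.integral_sum[symmetric]) (intro integrable_mult_left gauss_mgf(2))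
  also have "\<dots> \<le> (\<integral>z. exp (z\<^sup>2 / 4) \<partial>gauss)"
  proof (rule integral_mono[OF _ gauss_exp_sq(2)])
    show "integrable gauss (\<lambda>z. \<Sum>\<rho>\<in>reps N K. exp (X \<rho> / 4 * z) * om N h c K \<rho>)"
      by (intro Bochner_Integration.integrable_sum integrable_mult_left gauss_mgf(2))
    fix z
    have "(\<Sum>\<rho>\<in>reps N K. exp (X \<rho> / 4 * z) * om N h c K \<rho>) = nu N h c K (\<lambda>\<rho>. exp (z / 4 * X \<rho>))"
      unfolding nu_eq by (simp add: mult.commute)
    also have "\<dots> \<le> exp (4 * (z / 4)\<^sup>2)" by (rule sub)
    finally show "(\<Sum>\<rho>\<in>reps N K. exp (X \<rho> / 4 * z) * om N h c K \<rho>) \<le> exp (z\<^sup>2 / 4)"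
      by (simp add: power_divide)
  qed
  finally show ?thesis by (simp add: gauss_exp_sq)
qed

text \<open>At the starting point of the interpolation the sites are independent, so the exponential moment is built up
  one site at a time.\<close>

lemma product_state_mgf:
  fixes Y :: "nat \<Rightarrow> (nat \<Rightarrow> nat \<Rightarrow> real) \<Rightarrow> real"
  assumes J: "finite J" "J \<subseteq> {..<N}"
    and step: "\<And>p B. p < N \<Longrightarrow> nosite p B \<Longrightarrow> (\<And>\<rho>. 0 \<le> B \<rho>) \<Longrightarrow>
       nu N h c K (\<lambda>\<rho>. exp (s p * Y p \<rho>) * B \<rho>) \<le> exp (4 * (s p)\<^sup>2) * nu N h c K B"
    and loc: "\<And>p p'. p \<noteq> p' \<Longrightarrow> nosite p (Y p')"
  shows "nu N h c K (\<lambda>\<rho>. exp (\<Sum>p\<in>J. s p * Y p \<rho>)) \<le> exp (4 * (\<Sum>p\<in>J. (s p)\<^sup>2))"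
  using J
proof (induction J rule: finite_induct)
  case empty then show ?case by (simp add: nu_one)
next
  case (insert p J)
  have ns: "nosite p (\<lambda>\<rho>. exp (\<Sum>p\<in>J. s p * Y p \<rho>))"
    unfolding nosite_def
  proof (intro allI arg_cong[where f=exp] sum.cong refl)
    fix \<rho> r x p' assume "p' \<in> J"
    then have "p \<noteq> p'" using insert by auto
    then show "s p' * Y p' (\<rho>(r := (\<rho> r)(p := x))) = s p' * Y p' \<rho>"
      using loc[of p p'] unfolding nosite_def by simp
  qed
  have "nu N h c K (\<lambda>\<rho>. exp (\<Sum>p\<in>insert p J. s p * Y p \<rho>)) = nu N h c K (\<lambda>\<rho>. exp (s p * Y p \<rho>) * exp (\<Sum>p\<in>J. s p * Y p \<rho>))"
    using insert by (simp add: exp_add)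
  also have "\<dots> \<le> exp (4 * (s p)\<^sup>2) * nu N h c K (\<lambda>\<rho>. exp (\<Sum>p\<in>J. s p * Y p \<rho>))"
    by (rule step[OF _ ns]) (use insert in auto)
  also have "\<dots> \<le> exp (4 * (s p)\<^sup>2) * exp (4 * (\<Sum>p\<in>J. (s p)\<^sup>2))"
    by (rule mult_left_mono) (use insert in auto)
  also have "\<dots> = exp (4 * (\<Sum>p\<in>insert p J. (s p)\<^sup>2))"
    using insert by (simp add: exp_add[symmetric] algebra_simps)
  finally show ?case .
qed

section \<open>The product state at the start of the path\<close>

context
  fixes N :: nat and h :: real and c :: "nat \<times> nat \<Rightarrow> real" and K :: nat and q :: real
  assumes dec: "\<And>i j. i \<noteq> j \<Longrightarrow> c (i, j) = 0" and K_large: "2 \<le> K"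
    and q: "\<And>p. p < N \<Longrightarrow> mom h (c (p, p)) 2 = q" and q01: "0 \<le> q" "q \<le> 1"
begin

lemma nu_sites:
  assumes "p < N" "nosite p B"
  shows "nu N h c K (\<lambda>\<rho>. \<rho> 0 p * B \<rho>) = mom h (c (p, p)) 1 * nu N h c K B"
    "nu N h c K (\<lambda>\<rho>. \<rho> 1 p * B \<rho>) = mom h (c (p, p)) 1 * nu N h c K B"
    "nu N h c K (\<lambda>\<rho>. \<rho> 0 p * \<rho> 1 p * B \<rho>) = q * nu N h c K B"
proof -
  have D: "nu N h c K (\<lambda>\<rho>. (\<Prod>r\<in>A. \<rho> r p) * B \<rho>) = mom h (c (p, p)) (card A) * nu N h c K B" if "A \<subseteq> {..<K}" for A
    by (rule nu_decoupled[OF assms(1) _ assms(2) that]) (use dec in auto)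
  show "nu N h c K (\<lambda>\<rho>. \<rho> 0 p * B \<rho>) = mom h (c (p, p)) 1 * nu N h c K B"
    using D[of "{0}"] K_large by simp
  show "nu N h c K (\<lambda>\<rho>. \<rho> 1 p * B \<rho>) = mom h (c (p, p)) 1 * nu N h c K B"
    using D[of "{1}"] K_large by simp
  show "nu N h c K (\<lambda>\<rho>. \<rho> 0 p * \<rho> 1 p * B \<rho>) = q * nu N h c K B"
    using D[of "{0, 1}"] K_large q[OF assms(1)] by (simp add: numeral_2_eq_2)
qed

text \<open>The product of the two spins acts as a variable with values 1 and -1 and mean q. Its
  deviations 1 - q and -(1 + q) have weights (1 + q)/2 and (1 - q)/2, so the linear terms of
  \<open>exp_le_quadratic\<close> cancel; deviations of size at most 2 give the factor 4.\<close>

lemma product_overlap_step: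
  assumes p: "p < N" and B: "nosite p B" "\<And>\<rho>. 0 \<le> B \<rho>"
  shows "nu N h c K (\<lambda>\<rho>. exp (s * (\<rho> 0 p * \<rho> 1 p - q)) * B \<rho>) \<le> exp (4 * s\<^sup>2) * nu N h c K B"
proof -
  let ?n = "nu N h c K B"
  have "nu N h c K (\<lambda>\<rho>. exp (s * (\<rho> 0 p * \<rho> 1 p - q)) * B \<rho>)
     = nu N h c K (\<lambda>\<rho>. (exp (- s * q) * cosh s) * B \<rho> + (exp (- s * q) * sinh s) * (\<rho> 0 p * \<rho> 1 p * B \<rho>))"
  proof (rule nu_cong)
    fix \<rho> assume \<rho>: "\<rho> \<in> reps N K"
    have "\<rho> 0 p = -1 \<or> \<rho> 0 p = 1" "\<rho> 1 p = -1 \<or> \<rho> 1 p = 1"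
      using configs_spin[OF reps_configs[OF \<rho>] p] K_large by auto
    then have "\<rho> 0 p * \<rho> 1 p = 1 \<or> \<rho> 0 p * \<rho> 1 p = -1" by auto
    then have "exp (s * (\<rho> 0 p * \<rho> 1 p)) = cosh s + \<rho> 0 p * \<rho> 1 p * sinh s"
      by (auto simp: cosh_plus_sinh cosh_minus_sinh)
    moreover have "exp (s * (\<rho> 0 p * \<rho> 1 p - q)) = exp (- s * q) * exp (s * (\<rho> 0 p * \<rho> 1 p))"
      by (simp add: exp_add[symmetric] algebra_simps)
    ultimately have E: "exp (s * (\<rho> 0 p * \<rho> 1 p - q)) = exp (- s * q) * (cosh s + \<rho> 0 p * \<rho> 1 p * sinh s)"
      by (simp only:)
    show "exp (s * (\<rho> 0 p * \<rho> 1 p - q)) * B \<rho> =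
       (exp (- s * q) * cosh s) * B \<rho> + (exp (- s * q) * sinh s) * (\<rho> 0 p * \<rho> 1 p * B \<rho>)"
      unfolding E by (simp add: algebra_simps)
  qed
  also have "\<dots> = (exp (- s * q) * (cosh s + q * sinh s)) * ?n"
    unfolding nu_add nu_cmult nu_sites(3)[OF p B(1)] by (simp add: algebra_simps)
  also have "\<dots> \<le> exp (4 * s\<^sup>2) * ?n"
  proof (rule mult_right_mono)
    have 1: "exp (s * (1 - q)) \<le> s * (1 - q) + exp (4 * s\<^sup>2)"
    proof -
      have "(1 - q)\<^sup>2 \<le> 2\<^sup>2" by (rule power_mono) (use q01 in auto)
      then have "(s * (1 - q))\<^sup>2 \<le> 4 * s\<^sup>2" unfolding power_mult_distrib using mult_left_mono[of "(1-q)\<^sup>2" 4 "s\<^sup>2"] by simp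
      then have "exp ((s * (1 - q))\<^sup>2) \<le> exp (4 * s\<^sup>2)" by simp
      then show ?thesis using exp_le_quadratic[of "s * (1 - q)"] by linarith
    qed
    have 2: "exp (- s * (1 + q)) \<le> - s * (1 + q) + exp (4 * s\<^sup>2)"
    proof -
      have "(1 + q)\<^sup>2 \<le> 2\<^sup>2" by (rule power_mono) (use q01 in auto)
      then have "(- s * (1 + q))\<^sup>2 \<le> 4 * s\<^sup>2" unfolding power_mult_distrib using mult_left_mono[of "(1+q)\<^sup>2" 4 "s\<^sup>2"] by simp
      then have "exp ((- s * (1 + q))\<^sup>2) \<le> exp (4 * s\<^sup>2)" by simp
      then show ?thesis using exp_le_quadratic[of "- s * (1 + q)"] by linarith
    qed
    have "exp (- s * q) * (cosh s + q * sinh s) = (1 + q) / 2 * exp (s * (1 - q)) + (1 - q) / 2 * exp (- s * (1 + q))"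
    proof -
      have "exp (s * (1 - q)) = exp (- s * q) * exp s" "exp (- s * (1 + q)) = exp (- s * q) * exp (- s)"
        by (simp_all add: exp_add[symmetric] algebra_simps)
      then show ?thesis unfolding cosh_def sinh_def by (simp add: field_simps)
    qed
    also have "\<dots> \<le> (1 + q) / 2 * (s * (1 - q) + exp (4 * s\<^sup>2)) + (1 - q) / 2 * (- s * (1 + q) + exp (4 * s\<^sup>2))"
      using q01 1 2 by (intro add_mono mult_left_mono) auto
    also have "\<dots> = exp (4 * s\<^sup>2)" by (simp add: field_simps)
    finally show "exp (- s * q) * (cosh s + q * sinh s) \<le> exp (4 * s\<^sup>2)" .
    show "0 \<le> ?n" by (rule nu_nonneg[OF B(2)])
  qed
  finally show ?thesis .
qed

text \<open>Both replicas have the same mean at the site, so the terms linear in one spin cancel and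
  cosh^2 s - q sinh^2 s remains, which is at most cosh^2 s.\<close>

lemma product_diff_step:
  assumes p: "p < N" and B: "nosite p B" "\<And>\<rho>. 0 \<le> B \<rho>"
  shows "nu N h c K (\<lambda>\<rho>. exp (s * (\<rho> 0 p - \<rho> 1 p)) * B \<rho>) \<le> exp (4 * s\<^sup>2) * nu N h c K B"
proof -
  let ?n = "nu N h c K B"
  have "nu N h c K (\<lambda>\<rho>. exp (s * (\<rho> 0 p - \<rho> 1 p)) * B \<rho>)
     = nu N h c K (\<lambda>\<rho>. (cosh s)\<^sup>2 * B \<rho> + ((sinh s * cosh s) * (\<rho> 0 p * B \<rho> - \<rho> 1 p * B \<rho>) - (sinh s)\<^sup>2 * (\<rho> 0 p * \<rho> 1 p * B \<rho>)))"
  proof (rule nu_cong)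
    fix \<rho> assume \<rho>: "\<rho> \<in> reps N K"
    have sp: "\<rho> 0 p = -1 \<or> \<rho> 0 p = 1" "\<rho> 1 p = -1 \<or> \<rho> 1 p = 1"
      using configs_spin[OF reps_configs[OF \<rho>] p] K_large by auto
    have "exp (s * \<rho> 0 p) = cosh s + \<rho> 0 p * sinh s" "exp (- s * \<rho> 1 p) = cosh s - \<rho> 1 p * sinh s"
      using sp by (auto simp: cosh_plus_sinh cosh_minus_sinh)
    moreover have "exp (s * (\<rho> 0 p - \<rho> 1 p)) = exp (s * \<rho> 0 p) * exp (- s * \<rho> 1 p)"
      by (simp add: exp_add[symmetric] algebra_simps)
    ultimately have E: "exp (s * (\<rho> 0 p - \<rho> 1 p)) = (cosh s + \<rho> 0 p * sinh s) * (cosh s - \<rho> 1 p * sinh s)"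
      by (simp only:)
    show "exp (s * (\<rho> 0 p - \<rho> 1 p)) * B \<rho> =
       (cosh s)\<^sup>2 * B \<rho> + ((sinh s * cosh s) * (\<rho> 0 p * B \<rho> - \<rho> 1 p * B \<rho>) - (sinh s)\<^sup>2 * (\<rho> 0 p * \<rho> 1 p * B \<rho>))"
      unfolding E by (simp add: algebra_simps power2_eq_square)
  qed
  also have "\<dots> = (cosh s)\<^sup>2 * ?n - (sinh s)\<^sup>2 * (q * ?n)"
    unfolding nu_add nu_diff nu_cmult nu_sites[OF p B(1)] by simp
  also have "\<dots> \<le> (cosh s)\<^sup>2 * ?n"
    using q01 nu_nonneg[OF B(2)] by simp
  also have "\<dots> \<le> exp (4 * s\<^sup>2) * ?n"
  proof (rule mult_right_mono[OF _ nu_nonneg[OF B(2)]])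
    have "(cosh s)\<^sup>2 \<le> (exp (s\<^sup>2))\<^sup>2" by (rule power_mono[OF cosh_le_exp_sq]) simp
    also have "\<dots> = exp (2 * s\<^sup>2)" by (simp add: power2_eq_square exp_add[symmetric])
    also have "\<dots> \<le> exp (4 * s\<^sup>2)" by simp
    finally show "(cosh s)\<^sup>2 \<le> exp (4 * s\<^sup>2)" .
  qed
  finally show ?thesis .
qed

text \<open>Each square is controlled with the constant 32; the arithmetic-geometric mean inequality
  combines the two at the price of 64.\<close>

lemma product_exp_square:
  assumes N: "1 \<le> N" and t: "(\<Sum>i<N. (t i)\<^sup>2) = 1"
  shows "nu N h c K (\<lambda>\<rho>. exp ((real N * (ov N (\<rho> 0) (\<rho> 1) - q)\<^sup>2 + (Sval t N \<rho> 0)\<^sup>2) / 64)) \<le> 2"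
proof -
  let ?X = "\<lambda>\<rho>. sqrt N * (ov N (\<rho> 0) (\<rho> 1) - q)" and ?S = "\<lambda>\<rho>. Sval t N \<rho> 0"
  have X: "nu N h c K (\<lambda>\<rho>. exp ((?X \<rho>)\<^sup>2 / 32)) \<le> sqrt 2"
  proof (rule nu_exp_square)
    fix l :: real
    have X: "l * ?X \<rho> = (\<Sum>p<N. l / sqrt N * (\<rho> 0 p * \<rho> 1 p - q))" for \<rho>
    proof -
      have "(\<Sum>p<N. l / sqrt N * (\<rho> 0 p * \<rho> 1 p - q)) = l / sqrt N * ((\<Sum>p<N. \<rho> 0 p * \<rho> 1 p) - N * q)"
        unfolding sum_distrib_left[symmetric] sum_subtractf by simp
      also have "\<dots> = l / sqrt N * (N * (ov N (\<rho> 0) (\<rho> 1) - q))"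
        using N unfolding ov_def by (simp add: field_simps)
      also have "\<dots> = l * (N / sqrt N) * (ov N (\<rho> 0) (\<rho> 1) - q)" by simp
      also have "\<dots> = l * ?X \<rho>" by (simp add: real_div_sqrt)
      finally show ?thesis ..
    qed
    have "nu N h c K (\<lambda>\<rho>. exp (l * ?X \<rho>)) = nu N h c K (\<lambda>\<rho>. exp (\<Sum>p<N. l / sqrt N * (\<rho> 0 p * \<rho> 1 p - q)))"
      by (rule nu_cong, rule arg_cong[where f=exp], rule X)
    also have "\<dots> \<le> exp (4 * (\<Sum>p<N. (l / sqrt N)\<^sup>2))"
      by (rule product_state_mgf[where Y="\<lambda>p \<rho>. \<rho> 0 p * \<rho> 1 p - q" and s="\<lambda>_. l / sqrt N"])
        (simp, simp, rule product_overlap_step, assumption+, simp add: nosite_def)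
    also have "(\<Sum>p<N. (l / sqrt N)\<^sup>2) = l\<^sup>2" using N by (simp add: power_divide)
    finally show "nu N h c K (\<lambda>\<rho>. exp (l * ?X \<rho>)) \<le> exp (4 * l\<^sup>2)" .
  qed
  have S: "nu N h c K (\<lambda>\<rho>. exp ((?S \<rho>)\<^sup>2 / 32)) \<le> sqrt 2"
  proof (rule nu_exp_square)
    fix l :: real
    have "nu N h c K (\<lambda>\<rho>. exp (l * ?S \<rho>)) = nu N h c K (\<lambda>\<rho>. exp (\<Sum>p<N. (l * t p) * (\<rho> 0 p - \<rho> 1 p)))"
      unfolding Sval_def sum_distrib_left by (simp add: mult.assoc)
    also have "\<dots> \<le> exp (4 * (\<Sum>p<N. (l * t p)\<^sup>2))"
      by (rule product_state_mgf[where Y="\<lambda>p \<rho>. \<rho> 0 p - \<rho> 1 p" and s="\<lambda>p. l * t p"])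
        (simp, simp, rule product_diff_step, assumption+, simp add: nosite_def)
    also have "(\<Sum>p<N. (l * t p)\<^sup>2) = l\<^sup>2" unfolding power_mult_distrib sum_distrib_left[symmetric] t by simp
    finally show "nu N h c K (\<lambda>\<rho>. exp (l * ?S \<rho>)) \<le> exp (4 * l\<^sup>2)" .
  qed
  have "nu N h c K (\<lambda>\<rho>. exp ((real N * (ov N (\<rho> 0) (\<rho> 1) - q)\<^sup>2 + (?S \<rho>)\<^sup>2) / 64))
     \<le> nu N h c K (\<lambda>\<rho>. 1 / 2 * (exp ((?X \<rho>)\<^sup>2 / 32) + exp ((?S \<rho>)\<^sup>2 / 32)))"
  proof (rule nu_mono)
    fix \<rho>
    have "exp ((x + y) / 64) \<le> 1 / 2 * (exp (x / 32) + exp (y / 32))" for x y :: real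
    proof -
      have "2 * (exp (x / 64) * exp (y / 64)) \<le> (exp (x / 64))\<^sup>2 + (exp (y / 64))\<^sup>2"
        using sum_squares_bound[of "exp (x/64)" "exp (y/64)"] by (simp add: mult.assoc)
      moreover have "(exp (x / 64))\<^sup>2 = exp (x / 32)" for x :: real
        by (simp add: power2_eq_square exp_add[symmetric])
      ultimately show ?thesis by (simp add: add_divide_distrib exp_add)
    qed
    from this[of "(?X \<rho>)\<^sup>2" "(?S \<rho>)\<^sup>2"]
    show "exp ((real N * (ov N (\<rho> 0) (\<rho> 1) - q)\<^sup>2 + (?S \<rho>)\<^sup>2) / 64) \<le> 1 / 2 * (exp ((?X \<rho>)\<^sup>2 / 32) + exp ((?S \<rho>)\<^sup>2 / 32))"
      by (simp add: power_mult_distrib)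
  qed
  also have "\<dots> \<le> sqrt 2" unfolding nu_cmult nu_add using X S by simp
  also have "\<dots> \<le> 2" using real_sqrt_le_mono[of 2 4] by simp
  finally show ?thesis .
qed

end

text \<open>At \<open>\<theta> = 0\<close> the spins are independent in random fields of variance \<open>\<beta>\<^sup>2 q\<close>; at \<open>\<theta> = \<pi> / 2\<close> the path
  reaches the Sherrington--Kirkpatrick model. The angle keeps the square roots of the two variances smooth at
  both ends.\<close>

definition path_c :: "nat \<Rightarrow> real \<Rightarrow> real \<Rightarrow> real \<Rightarrow> nat \<times> nat \<Rightarrow> real" where
  "path_c N \<beta> q \<theta> = (\<lambda>(i, j). if i < j then \<beta> / sqrt N * sin \<theta> else if i = j then \<beta> * sqrt q * cos \<theta> else 0)"

definition path_c' :: "nat \<Rightarrow> real \<Rightarrow> real \<Rightarrow> real \<Rightarrow> nat \<times> nat \<Rightarrow> real" where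
  "path_c' N \<beta> q \<theta> = (\<lambda>(i, j). if i < j then \<beta> / sqrt N * cos \<theta> else if i = j then - (\<beta> * sqrt q * sin \<theta>) else 0)"

lemma path_c_deriv: "((\<lambda>s. path_c N \<beta> q s k) has_real_derivative path_c' N \<beta> q s k) (at s)"
proof -
  have "((\<lambda>s. \<beta> / sqrt N * sin s) has_real_derivative \<beta> / sqrt N * cos s) (at s)"
    by (rule DERIV_cmult[OF DERIV_sin])
  moreover have "((\<lambda>s. \<beta> * sqrt q * cos s) has_real_derivative - (\<beta> * sqrt q * sin s)) (at s)"
    using DERIV_cmult[OF DERIV_cos, of "\<beta> * sqrt q" s] by simp
  ultimately show ?thesis
    unfolding path_c_def path_c'_def by (cases k) auto
qed

lemma trig_abs_le:
  fixes x y z s :: real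
  assumes "z \<in> {x * cos s, - (y * sin s), 0}"
  shows "\<bar>z\<bar> \<le> \<bar>x\<bar> + \<bar>y\<bar>"
proof -
  have "\<bar>x * cos s\<bar> \<le> \<bar>x\<bar>" "\<bar>y * sin s\<bar> \<le> \<bar>y\<bar>"
    unfolding abs_mult using mult_left_mono[OF abs_cos_le_one, of "\<bar>x\<bar>" s] mult_left_mono[OF abs_sin_le_one, of "\<bar>y\<bar>" s] by auto
  then show ?thesis using assms by auto
qed

lemma path_c'_bound: "\<bar>path_c' N \<beta> q s k\<bar> \<le> \<bar>\<beta> / sqrt N\<bar> + \<bar>\<beta> * sqrt q\<bar>"
  by (rule trig_abs_le[where s=s]) (cases k, auto simp: path_c'_def)

text \<open>With overlap R, the bonds contribute N R^2 - 1 and the fields -2 N q R, both times sin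
  \<theta> cos \<theta> \<beta>^2/2; variance \<beta>^2 q for the fields is exactly what completes
  the square. The -1 comes from the excluded diagonal of the double sum.\<close>

lemma path_c_cov:
  assumes N: "1 \<le> N" and q: "0 \<le> q" and \<sigma>: "\<sigma> \<in> configs N" and \<tau>: "\<tau> \<in> configs N"
  shows "(\<Sum>k\<in>bonds N. path_c N \<beta> q \<theta> k * path_c' N \<beta> q \<theta> k * (phi k \<sigma> * phi k \<tau>))
    = sin \<theta> * cos \<theta> * (\<beta>\<^sup>2 / 2 * (N * (ov N \<sigma> \<tau> - q)\<^sup>2)) + sin \<theta> * cos \<theta> * (\<beta>\<^sup>2 / 2) * (- N * q\<^sup>2 - 1)"
proof -
  let ?x = "\<lambda>i. \<sigma> i * \<tau> i"
  have D: "(\<Sum>i<N. path_c N \<beta> q \<theta> (i, i) * path_c' N \<beta> q \<theta> (i, i) * (phi (i, i) \<sigma> * phi (i, i) \<tau>))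
     = (- (\<beta>\<^sup>2 * q * (sin \<theta> * cos \<theta>))) * (\<Sum>i<N. ?x i)"
    unfolding sum_distrib_left using q
    by (intro sum.cong refl) (simp add: path_c_def path_c'_def phi_def power2_eq_square)
  have O: "(\<Sum>i<N. \<Sum>j\<in>{i<..<N}. path_c N \<beta> q \<theta> (i, j) * path_c' N \<beta> q \<theta> (i, j) * (phi (i, j) \<sigma> * phi (i, j) \<tau>))
     = (\<beta>\<^sup>2 / N * (sin \<theta> * cos \<theta>)) * (\<Sum>i<N. \<Sum>j\<in>{i<..<N}. ?x i * ?x j)"
    unfolding sum_distrib_left using N
    by (intro sum.cong refl) (auto simp: path_c_def path_c'_def phi_def power2_eq_square field_simps)
  have "(\<Sum>i<N. ?x i * ?x i) = N" using sum_spin_sq[OF \<sigma> \<tau>] by simp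
  moreover have "(\<Sum>i<N. ?x i) = N * ov N \<sigma> \<tau>" using N by (simp add: ov_def)
  ultimately show ?thesis
    unfolding sum_bonds D O sum_offdiag using N by (simp add: field_simps power2_eq_square)
qed

lemma path_c_end: "path_c N \<beta> q (pi / 2) = skc N \<beta>"
  by (auto simp: path_c_def skc_def fun_eq_iff)

text \<open>Latala's argument. The exponent is lowered along the path by exactly the amount that makes the expectation
  nonincreasing: after the negative terms of the bracket are dropped, the overlap of the fresh replicas is absorbed
  by the Chebyshev inequality \<open>nu_cheb\<close>.\<close>

theorem overlap_exponential_moment:
  assumes N: "1 \<le> N" and \<beta>: "0 < \<beta>" "\<beta> < 1 / 16" and q: "0 \<le> q" "q \<le> 1" "q = mom h (\<beta> * sqrt q) 2"
    and t: "(\<Sum>i<N. (t i)\<^sup>2) = 1" and K: "4 \<le> K"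
  shows "nu N h (skc N \<beta>) K (\<lambda>\<rho>. exp ((real N * (ov N (\<rho> 0) (\<rho> 1) - q)\<^sup>2 + (Sval t N \<rho> 0)\<^sup>2) / 128)) \<le> 2"
proof -
  \<comment> \<open>The square of S travels along with the overlap. The covariance only produces the
    overlap part, which is at most \<open>G\<close>, so one monotone quantity controls both.\<close>
  define G where "G \<sigma> \<tau> = real N * (ov N \<sigma> \<tau> - q)\<^sup>2 + (\<Sum>i<N. t i * (\<sigma> i - \<tau> i))\<^sup>2" for \<sigma> \<tau>
  have G: "real N * (ov N (\<rho> 0) (\<rho> 1) - q)\<^sup>2 + (Sval t N \<rho> 0)\<^sup>2 = G (\<rho> 0) (\<rho> 1)" for \<rho>
    by (simp add: G_def Sval_def)
  have G0: "0 \<le> G \<sigma> \<tau>" for \<sigma> \<tau> by (simp add: G_def)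
  \<comment> \<open>1/64 is the exponent available for the product state. The slope 4 \<beta>^2 sin
    \<theta> cos \<theta> of the decrease pays for the bracket: coefficients 2 for the pair itself
    and 6 for the two fresh replicas, each times \<beta>^2/2.\<close>
  define C where "C \<theta> = 1 / 64 - 2 * \<beta>\<^sup>2 * (sin \<theta>)\<^sup>2" for \<theta>
  have b2: "2 * \<beta>\<^sup>2 \<le> 1 / 128"
  proof -
    have "\<beta>\<^sup>2 \<le> (1 / 16)\<^sup>2" using \<beta> by (intro power_mono) auto
    then show ?thesis by (simp add: power_divide)
  qed
  have C: "1 / 128 \<le> C \<theta>" for \<theta>
  proof -
    have "(sin \<theta>)\<^sup>2 \<le> 1" by (simp add: abs_square_le_1)
    then have "2 * \<beta>\<^sup>2 * (sin \<theta>)\<^sup>2 \<le> 2 * \<beta>\<^sup>2 * 1" by (intro mult_left_mono) auto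
    then show ?thesis using b2 unfolding C_def by linarith
  qed
  define e where "e \<theta> \<rho> = exp (C \<theta> * G (\<rho> 0) (\<rho> 1))" for \<theta> and \<rho> :: "nat \<Rightarrow> nat \<Rightarrow> real"
  define \<psi> where "\<psi> \<theta> = nu N h (path_c N \<beta> q \<theta>) K (e \<theta>)" for \<theta>
  have d: "\<exists>y. (\<psi> has_real_derivative y) (at \<theta>) \<and> y \<le> 0" if \<theta>: "0 \<le> \<theta>" "\<theta> \<le> pi / 2" for \<theta>
  proof -
    let ?c = "path_c N \<beta> q \<theta>"
    define sc where "sc = sin \<theta> * cos \<theta>"
    have sc: "0 \<le> sc" unfolding sc_def using \<theta> by (intro mult_nonneg_nonneg sin_ge_zero cos_ge_zero) auto
    define \<Gamma> where "\<Gamma> \<sigma> \<tau> = sc * (\<beta>\<^sup>2 / 2 * (N * (ov N \<sigma> \<tau> - q)\<^sup>2))" for \<sigma> \<tau>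
    let ?f' = "\<lambda>\<rho>. (- (4 * \<beta>\<^sup>2 * sc)) * (G (\<rho> 0) (\<rho> 1) * e \<theta> \<rho>)"
    have D: "(\<psi> has_real_derivative nu N h ?c K ?f' + nu N h ?c K (\<lambda>\<rho>. e \<theta> \<rho> * br 2 (\<lambda>a b. \<Gamma> (\<rho> a) (\<rho> b)))) (at \<theta>)"
      unfolding \<psi>_def
    proof (rule nu_deriv_cov[where c'="path_c' N \<beta> q" and B="\<bar>\<beta> / sqrt N\<bar> + \<bar>\<beta> * sqrt q\<bar>"
          and const="sin \<theta> * cos \<theta> * (\<beta>\<^sup>2 / 2) * (- N * q\<^sup>2 - 1)"])
      show "dep 2 (e s)" for s unfolding dep_def e_def by simp
      show "((\<lambda>s. e s \<rho>) has_real_derivative ?f' \<rho>) (at \<theta>)" for \<rho>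
        unfolding e_def C_def sc_def by (auto intro!: derivative_eq_intros)
    qed (use K N q path_c_deriv path_c'_bound in \<open>auto simp: \<Gamma>_def sc_def path_c_cov\<close>)
    have "nu N h ?c K (\<lambda>\<rho>. e \<theta> \<rho> * br 2 (\<lambda>a b. \<Gamma> (\<rho> a) (\<rho> b)))
      \<le> nu N h ?c K (\<lambda>\<rho>. (sc * \<beta>\<^sup>2) * (G (\<rho> 0) (\<rho> 1) * e \<theta> \<rho>) + (3 * sc * \<beta>\<^sup>2) * (e \<theta> \<rho> * G (\<rho> 2) (\<rho> 3)))"
    proof (rule nu_mono)
      fix \<rho>
      have g: "0 \<le> \<Gamma> \<sigma> \<tau>" "\<Gamma> \<sigma> \<tau> \<le> sc * (\<beta>\<^sup>2 / 2 * G \<sigma> \<tau>)" for \<sigma> \<tau>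
        unfolding \<Gamma>_def G_def using sc by (auto intro!: mult_left_mono mult_nonneg_nonneg)
      have "br 2 (\<lambda>a b. \<Gamma> (\<rho> a) (\<rho> b)) = 2 * \<Gamma> (\<rho> 0) (\<rho> 1) - 4 * (\<Gamma> (\<rho> 0) (\<rho> 2) + \<Gamma> (\<rho> 1) (\<rho> 2)) + 6 * \<Gamma> (\<rho> 2) (\<rho> 3)"
        unfolding br_def by (simp add: numeral_2_eq_2 numeral_3_eq_3)
      also have "\<dots> \<le> 2 * (sc * (\<beta>\<^sup>2 / 2 * G (\<rho> 0) (\<rho> 1))) + 6 * (sc * (\<beta>\<^sup>2 / 2 * G (\<rho> 2) (\<rho> 3)))"
      proof -
        have "2 * x - 4 * (y + z) + 6 * w \<le> 2 * x' + 6 * w'" if "x \<le> x'" "w \<le> w'" "0 \<le> y" "0 \<le> z" for x y z w x' w' :: real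
          using that by auto
        from this[OF g(2) g(2) g(1) g(1)] show ?thesis .
      qed
      finally have "e \<theta> \<rho> * br 2 (\<lambda>a b. \<Gamma> (\<rho> a) (\<rho> b)) \<le> e \<theta> \<rho> * \<dots>"
        by (rule mult_left_mono) (simp add: e_def)
      then show "e \<theta> \<rho> * br 2 (\<lambda>a b. \<Gamma> (\<rho> a) (\<rho> b)) \<le> (sc * \<beta>\<^sup>2) * (G (\<rho> 0) (\<rho> 1) * e \<theta> \<rho>) + (3 * sc * \<beta>\<^sup>2) * (e \<theta> \<rho> * G (\<rho> 2) (\<rho> 3))"
        by (simp add: algebra_simps)
    qed
    also have "\<dots> = (sc * \<beta>\<^sup>2) * nu N h ?c K (\<lambda>\<rho>. G (\<rho> 0) (\<rho> 1) * e \<theta> \<rho>) + (3 * sc * \<beta>\<^sup>2) * nu N h ?c K (\<lambda>\<rho>. e \<theta> \<rho> * G (\<rho> 2) (\<rho> 3))"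
      unfolding nu_add nu_cmult ..
    also have "(3 * sc * \<beta>\<^sup>2) * nu N h ?c K (\<lambda>\<rho>. e \<theta> \<rho> * G (\<rho> 2) (\<rho> 3))
        \<le> (3 * sc * \<beta>\<^sup>2) * nu N h ?c K (\<lambda>\<rho>. e \<theta> \<rho> * G (\<rho> 0) (\<rho> 1))"
      unfolding e_def
    proof (rule mult_left_mono[OF nu_cheb[OF K, where F="\<lambda>x y. exp (C \<theta> * G x y)"]])
      fix x y x' y'
      have "0 < C \<theta>" using C[of \<theta>] by simp
      then show "0 \<le> (exp (C \<theta> * G x y) - exp (C \<theta> * G x' y')) * (G x y - G x' y')"
        by (cases "G x y \<le> G x' y'") (auto intro: mult_nonpos_nonpos mult_nonneg_nonneg)
    qed (use sc in simp)
    also have "(\<lambda>\<rho>. e \<theta> \<rho> * G (\<rho> 0) (\<rho> 1)) = (\<lambda>\<rho>. G (\<rho> 0) (\<rho> 1) * e \<theta> \<rho>)" by (simp only: mult.commute)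
    also have "(sc * \<beta>\<^sup>2) * nu N h ?c K (\<lambda>\<rho>. G (\<rho> 0) (\<rho> 1) * e \<theta> \<rho>) + (3 * sc * \<beta>\<^sup>2) * nu N h ?c K (\<lambda>\<rho>. G (\<rho> 0) (\<rho> 1) * e \<theta> \<rho>)
       = (4 * \<beta>\<^sup>2 * sc) * nu N h ?c K (\<lambda>\<rho>. G (\<rho> 0) (\<rho> 1) * e \<theta> \<rho>)"
      by (simp add: algebra_simps)
    finally have "nu N h ?c K (\<lambda>\<rho>. e \<theta> \<rho> * br 2 (\<lambda>a b. \<Gamma> (\<rho> a) (\<rho> b)))
      \<le> (4 * \<beta>\<^sup>2 * sc) * nu N h ?c K (\<lambda>\<rho>. G (\<rho> 0) (\<rho> 1) * e \<theta> \<rho>)" by simp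
    then show ?thesis using D nu_cmult[of N h ?c K "- (4 * \<beta>\<^sup>2 * sc)" "\<lambda>\<rho>. G (\<rho> 0) (\<rho> 1) * e \<theta> \<rho>"] by auto
  qed
  have "\<psi> (pi / 2) \<le> \<psi> 0"
    by (rule DERIV_nonpos_imp_nonincreasing[where f=\<psi>]) (use d in auto)
  also have "\<psi> 0 \<le> 2"
    unfolding \<psi>_def e_def C_def G[symmetric]
    using product_exp_square[of "path_c N \<beta> q 0" K N h q t] K N q t by (simp add: path_c_def)
  finally have "nu N h (skc N \<beta>) K (e (pi / 2)) \<le> 2"
    unfolding \<psi>_def path_c_end .
  moreover have "nu N h (skc N \<beta>) K (\<lambda>\<rho>. exp (G (\<rho> 0) (\<rho> 1) / 128)) \<le> nu N h (skc N \<beta>) K (e (pi / 2))"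
  proof (rule nu_mono)
    fix \<rho>
    show "exp (G (\<rho> 0) (\<rho> 1) / 128) \<le> e (pi / 2) \<rho>"
      unfolding e_def using mult_right_mono[OF C[of "pi / 2"] G0[of "\<rho> 0" "\<rho> 1"]] by simp
  qed
  ultimately show ?thesis unfolding G by linarith
qed

section \<open>The cavity path\<close>

text \<open>The overlap parameter \<open>q\<close> is any solution of the replica-symmetric equation; its uniqueness plays no role.\<close>

definition sk :: "real \<Rightarrow> nat \<Rightarrow> real \<Rightarrow> real \<Rightarrow> (nat \<Rightarrow> real) \<Rightarrow> bool" where
  "sk h N \<beta> q t \<longleftrightarrow> 1 \<le> N \<and> 0 < \<beta> \<and> \<beta> < 1 / 16 \<and> 0 \<le> q \<and> q \<le> 1 \<and> q = mom h (\<beta> * sqrt q) 2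
     \<and> (\<Sum>i<N. (t i)\<^sup>2) = 1"

text \<open>All error terms are bounded by powers of this quantity, whose moments are bounded uniformly in \<open>N\<close>, \<open>\<beta>\<close> and \<open>t\<close>.\<close>

definition Dom :: "nat \<Rightarrow> nat \<Rightarrow> nat \<Rightarrow> real \<Rightarrow> (nat \<Rightarrow> real) \<Rightarrow> (nat \<Rightarrow> nat \<Rightarrow> real) \<Rightarrow> real" where
  "Dom N K n q t \<rho> = 1 + (\<Sum>b<K. \<Sum>a<b. sqrt N * \<bar>ov N (\<rho> a) (\<rho> b) - q\<bar>) + (\<Sum>l<n. \<bar>Sval t N \<rho> l\<bar>)"

lemma pow_sum_le:
  fixes x :: "nat \<Rightarrow> real"
  assumes "\<And>i. i < n \<Longrightarrow> 0 \<le> x i"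
  shows "(\<Sum>i<n. x i) ^ r \<le> real (n + 1) ^ r * (1 + (\<Sum>i<n. x i ^ r))"
proof (cases "n = 0")
  case True then show ?thesis by (cases r) auto
next
  case False
  define M where "M = Max (x ` {..<n})"
  have "M \<in> x ` {..<n}" unfolding M_def using False by (intro Max_in) auto
  then obtain j where j: "j < n" "M = x j" by auto
  have le: "x i \<le> M" if "i < n" for i unfolding M_def using that by simp
  have M0: "0 \<le> M" using j assms by simp
  have "(\<Sum>i<n. x i) \<le> (\<Sum>i<n. M)" by (intro sum_mono le) auto
  also have "\<dots> \<le> real (n + 1) * M" using M0 by (simp add: mult_right_mono)
  finally have "(\<Sum>i<n. x i) ^ r \<le> (real (n + 1) * M) ^ r"
    by (intro power_mono sum_nonneg assms) auto
  also have "\<dots> = real (n + 1) ^ r * x j ^ r" by (simp add: power_mult_distrib j)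
  also have "x j ^ r \<le> (\<Sum>i<n. x i ^ r)"
    by (rule member_le_sum) (use j assms in auto)
  also have "\<dots> \<le> 1 + (\<Sum>i<n. x i ^ r)" by simp
  finally show ?thesis by (simp add: mult_left_mono)
qed

lemma pow_add3_le:
  fixes x y :: real
  assumes "0 \<le> x" "0 \<le> y"
  shows "(1 + x + y) ^ r \<le> 3 ^ r * (1 + x ^ r + y ^ r)"
proof -
  define M where "M = max 1 (max x y)"
  have "(1 + x + y) ^ r \<le> (3 * M) ^ r"
    by (intro power_mono) (use assms in \<open>auto simp: M_def\<close>)
  also have "\<dots> = 3 ^ r * M ^ r" by (rule power_mult_distrib)
  also have "M ^ r \<le> 1 + x ^ r + y ^ r"
    using assms by (auto simp: M_def max_def)
  finally show ?thesis by (simp add: mult_left_mono)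
qed

lemma power_le_fact_exp:
  fixes z :: real assumes "0 \<le> z" shows "z ^ r \<le> fact r * exp z"
proof -
  have "(\<Sum>n\<in>{r}. z ^ n /\<^sub>R fact n) \<le> (\<Sum>n. z ^ n /\<^sub>R fact n)"
    by (rule sum_le_suminf[OF summable_exp_generic]) (use assms in auto)
  then have "z ^ r / fact r \<le> exp z" by (simp add: exp_def divide_inverse mult.commute)
  then show ?thesis by (simp add: field_simps)
qed

lemma abs_power_le_exp:
  fixes y w :: real
  assumes "y\<^sup>2 \<le> w"
  shows "\<bar>y\<bar> ^ r \<le> 1 + 128 ^ r * fact r * exp (w / 128)"
proof -
  have "\<bar>y\<bar> ^ r \<le> 1 + (y\<^sup>2) ^ r"
  proof (cases "\<bar>y\<bar> \<le> 1")
    case True then show ?thesis by (simp add: power_le_one add_increasing2)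
  next
    case False
    then have "\<bar>y\<bar> ^ r \<le> \<bar>y\<bar> ^ (2 * r)" by (intro power_increasing) auto
    then show ?thesis by (simp add: power_mult)
  qed
  also have "(y\<^sup>2) ^ r \<le> w ^ r" by (rule power_mono[OF assms]) simp
  also have "w ^ r = 128 ^ r * (w / 128) ^ r" by (simp add: power_divide)
  also have "\<dots> \<le> 128 ^ r * (fact r * exp (w / 128))"
    using order_trans[OF zero_le_power2 assms] by (intro mult_left_mono power_le_fact_exp) auto
  finally show ?thesis by (simp add: mult.assoc)
qed

lemma Dom_ge1: "1 \<le> Dom N K n q t \<rho>"
  unfolding Dom_def by (auto intro!: add_nonneg_nonneg sum_nonneg)

lemma Dom_dep: "2 * n \<le> K \<Longrightarrow> dep K (\<lambda>\<rho>. Dom N K n q t \<rho> ^ r)"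
  unfolding dep_def
proof (intro allI impI arg_cong[where f="\<lambda>x. x ^ r"])
  fix \<rho> \<rho>' :: "nat \<Rightarrow> nat \<Rightarrow> real" assume K: "2 * n \<le> K" and eq: "\<forall>r<K. \<rho> r = \<rho>' r"
  have "(\<Sum>b<K. \<Sum>a<b. sqrt N * \<bar>ov N (\<rho> a) (\<rho> b) - q\<bar>) = (\<Sum>b<K. \<Sum>a<b. sqrt N * \<bar>ov N (\<rho>' a) (\<rho>' b) - q\<bar>)"
    by (intro sum.cong refl) (use eq in auto)
  moreover have "(\<Sum>l<n. \<bar>Sval t N \<rho> l\<bar>) = (\<Sum>l<n. \<bar>Sval t N \<rho>' l\<bar>)"
    by (intro sum.cong refl) (use eq K in \<open>auto simp: Sval_def\<close>)
  ultimately show "Dom N K n q t \<rho> = Dom N K n q t \<rho>'" unfolding Dom_def by simp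
qed

lemma Dom_S: "l < n \<Longrightarrow> \<bar>Sval t N \<rho> l\<bar> \<le> Dom N K n q t \<rho>"
proof -
  assume "l < n"
  then have "\<bar>Sval t N \<rho> l\<bar> \<le> (\<Sum>l<n. \<bar>Sval t N \<rho> l\<bar>)" by (intro member_le_sum) auto
  moreover have "0 \<le> (\<Sum>b<K. \<Sum>a<b. sqrt N * \<bar>ov N (\<rho> a) (\<rho> b) - q\<bar>)" by (intro sum_nonneg) auto
  ultimately show ?thesis unfolding Dom_def by linarith
qed

lemma Dom_ov:
  assumes "a' < b" "b < K"
  shows "1 + sqrt N * \<bar>ov N (\<rho> a') (\<rho> b) - q\<bar> \<le> Dom N K n q t \<rho>"
proof -
  have "sqrt N * \<bar>ov N (\<rho> a') (\<rho> b) - q\<bar> \<le> (\<Sum>a<b. sqrt N * \<bar>ov N (\<rho> a) (\<rho> b) - q\<bar>)"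
    by (rule member_le_sum[where i=a' and f="\<lambda>a. sqrt N * \<bar>ov N (\<rho> a) (\<rho> b) - q\<bar>"]) (use assms in auto)
  also have "\<dots> \<le> (\<Sum>b<K. \<Sum>a<b. sqrt N * \<bar>ov N (\<rho> a) (\<rho> b) - q\<bar>)"
    by (rule member_le_sum[where i=b and f="\<lambda>b. \<Sum>a<b. sqrt N * \<bar>ov N (\<rho> a) (\<rho> b) - q\<bar>"]) (use assms in \<open>auto intro: sum_nonneg\<close>)
  moreover have "0 \<le> (\<Sum>l<n. \<bar>Sval t N \<rho> l\<bar>)" by (intro sum_nonneg) auto
  ultimately show ?thesis unfolding Dom_def by linarith
qed

text \<open>By exchangeability every overlap and every S_l is distributed like the one built from
  replicas 0 and 1. The exponential moment of that single pair thus controls all powers, with a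
  constant built only from r, n and \<open>K'\<close>.\<close>

lemma sk_moment:
  assumes K: "4 \<le> K" "K' \<le> K" "2 * n \<le> K"
  shows "\<exists>C. \<forall>N \<beta> q t. sk h N \<beta> q t \<longrightarrow> nu N h (skc N \<beta>) K (\<lambda>\<rho>. Dom N K' n q t \<rho> ^ r) \<le> C"
proof (intro exI allI impI)
  fix N \<beta> q t assume sk: "sk h N \<beta> q t"
  define M where "M = 1 + 128 ^ r * fact r * (2 :: real)"
  let ?nu = "nu N h (skc N \<beta>) K"
  let ?E = "\<lambda>\<rho>. exp ((real N * (ov N (\<rho> 0) (\<rho> 1) - q)\<^sup>2 + (Sval t N \<rho> 0)\<^sup>2) / 128)"
  have E: "?nu ?E \<le> 2"
    by (rule overlap_exponential_moment) (use sk K in \<open>auto simp: sk_def\<close>)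
  have M: "?nu (\<lambda>\<rho>. 1 + 128 ^ r * fact r * ?E \<rho>) \<le> M"
    unfolding nu_add nu_cmult nu_const M_def using mult_left_mono[OF E, of "128 ^ r * fact r"] by simp
  have ov: "?nu (\<lambda>\<rho>. (sqrt N * \<bar>ov N (\<rho> u) (\<rho> v) - q\<bar>) ^ r) \<le> M" if "u < v" "v < K" for u v
  proof -
    have "?nu (\<lambda>\<rho>. (sqrt N * \<bar>ov N (\<rho> u) (\<rho> v) - q\<bar>) ^ r) = ?nu (\<lambda>\<rho>. (sqrt N * \<bar>ov N (\<rho> 0) (\<rho> 1) - q\<bar>) ^ r)"
      by (rule nu_pair[where F="\<lambda>\<sigma> \<tau>. (sqrt N * \<bar>ov N \<sigma> \<tau> - q\<bar>) ^ r"]) (use that in auto)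
    also have "\<dots> \<le> ?nu (\<lambda>\<rho>. 1 + 128 ^ r * fact r * ?E \<rho>)"
    proof (rule nu_mono)
      fix \<rho>
      show "(sqrt N * \<bar>ov N (\<rho> 0) (\<rho> 1) - q\<bar>) ^ r \<le> 1 + 128 ^ r * fact r * ?E \<rho>"
        using abs_power_le_exp[of "sqrt N * (ov N (\<rho> 0) (\<rho> 1) - q)" "real N * (ov N (\<rho> 0) (\<rho> 1) - q)\<^sup>2 + (Sval t N \<rho> 0)\<^sup>2" r]
        by (simp add: abs_mult power_mult_distrib)
    qed
    finally show ?thesis using M by linarith
  qed
  have S: "?nu (\<lambda>\<rho>. \<bar>Sval t N \<rho> l\<bar> ^ r) \<le> M" if "l < n" for l
  proof -
    have "?nu (\<lambda>\<rho>. \<bar>Sval t N \<rho> l\<bar> ^ r) = ?nu (\<lambda>\<rho>. \<bar>Sval t N \<rho> 0\<bar> ^ r)"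
      unfolding Sval_def
      using nu_pair[of "2 * l" K "2 * l + 1" N h "skc N \<beta>" "\<lambda>\<sigma> \<tau>. \<bar>\<Sum>i<N. t i * (\<sigma> i - \<tau> i)\<bar> ^ r"] that K by simp
    also have "\<dots> \<le> ?nu (\<lambda>\<rho>. 1 + 128 ^ r * fact r * ?E \<rho>)"
      by (rule nu_mono, rule abs_power_le_exp) simp
    finally show ?thesis using M by linarith
  qed
  let ?A = "\<lambda>b \<rho>. \<Sum>a<b. sqrt N * \<bar>ov N (\<rho> a) (\<rho> b) - q\<bar>"
  let ?R = "\<lambda>\<rho>. 3 ^ r * (1 + real (K' + 1) ^ r * (1 + (\<Sum>b<K'. real (b + 1) ^ r * (1 + (\<Sum>a<b. (sqrt N * \<bar>ov N (\<rho> a) (\<rho> b) - q\<bar>) ^ r))))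
       + real (n + 1) ^ r * (1 + (\<Sum>l<n. \<bar>Sval t N \<rho> l\<bar> ^ r)))"
  have "?nu (\<lambda>\<rho>. Dom N K' n q t \<rho> ^ r) \<le> ?nu ?R"
  proof (rule nu_mono)
    fix \<rho>
    have 1: "(\<Sum>b<K'. ?A b \<rho>) ^ r \<le> real (K' + 1) ^ r * (1 + (\<Sum>b<K'. real (b + 1) ^ r * (1 + (\<Sum>a<b. (sqrt N * \<bar>ov N (\<rho> a) (\<rho> b) - q\<bar>) ^ r))))"
    proof -
      have "(\<Sum>b<K'. ?A b \<rho>) ^ r \<le> real (K' + 1) ^ r * (1 + (\<Sum>b<K'. ?A b \<rho> ^ r))"
        by (intro pow_sum_le sum_nonneg) auto
      also have "(\<Sum>b<K'. ?A b \<rho> ^ r) \<le> (\<Sum>b<K'. real (b + 1) ^ r * (1 + (\<Sum>a<b. (sqrt N * \<bar>ov N (\<rho> a) (\<rho> b) - q\<bar>) ^ r)))"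
        by (intro sum_mono pow_sum_le) auto
      finally show ?thesis by (simp add: mult_left_mono)
    qed
    have 2: "(\<Sum>l<n. \<bar>Sval t N \<rho> l\<bar>) ^ r \<le> real (n + 1) ^ r * (1 + (\<Sum>l<n. \<bar>Sval t N \<rho> l\<bar> ^ r))"
      by (intro pow_sum_le) auto
    have "Dom N K' n q t \<rho> ^ r \<le> 3 ^ r * (1 + (\<Sum>b<K'. ?A b \<rho>) ^ r + (\<Sum>l<n. \<bar>Sval t N \<rho> l\<bar>) ^ r)"
      unfolding Dom_def by (rule pow_add3_le) (auto intro!: sum_nonneg)
    also have "\<dots> \<le> ?R \<rho>"
      using 1 2 by (intro mult_left_mono add_mono) auto
    finally show "Dom N K' n q t \<rho> ^ r \<le> ?R \<rho>" .
  qed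
  also have "\<dots> = 3 ^ r * (1 + real (K' + 1) ^ r * (1 + (\<Sum>b<K'. real (b + 1) ^ r * (1 + (\<Sum>a<b. ?nu (\<lambda>\<rho>. (sqrt N * \<bar>ov N (\<rho> a) (\<rho> b) - q\<bar>) ^ r)))))
       + real (n + 1) ^ r * (1 + (\<Sum>l<n. ?nu (\<lambda>\<rho>. \<bar>Sval t N \<rho> l\<bar> ^ r))))"
    unfolding nu_cmult nu_add nu_sum nu_const ..
  also have "\<dots> \<le> 3 ^ r * (1 + real (K' + 1) ^ r * (1 + (\<Sum>b<K'. real (b + 1) ^ r * (1 + (\<Sum>a<b. M))))
       + real (n + 1) ^ r * (1 + (\<Sum>l<n. M)))"
    by (intro mult_left_mono add_mono order_refl sum_mono ov S) (use K in auto)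
  finally show "?nu (\<lambda>\<rho>. Dom N K' n q t \<rho> ^ r) \<le> 3 ^ r * (1 + real (K' + 1) ^ r * (1 + (\<Sum>b<K'. real (b + 1) ^ r * (1 + (\<Sum>a<b. 1 + 128 ^ r * fact r * (2 :: real)))))
       + real (n + 1) ^ r * (1 + (\<Sum>l<n. 1 + 128 ^ r * fact r * (2 :: real))))"
    unfolding M_def .
qed

text \<open>Only the couplings of site \<open>p\<close> are interpolated; at \<open>\<theta> = 0\<close> this site is decoupled from the others.\<close>

definition cav_c :: "nat \<Rightarrow> real \<Rightarrow> real \<Rightarrow> nat \<Rightarrow> real \<Rightarrow> nat \<times> nat \<Rightarrow> real" where
  "cav_c N \<beta> q p \<theta> = (\<lambda>(i, j). if i < j then (if i = p \<or> j = p then \<beta> / sqrt N * sin \<theta> else \<beta> / sqrt N)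
     else if i = j \<and> i = p then \<beta> * sqrt q * cos \<theta> else 0)"

definition cav_c' :: "nat \<Rightarrow> real \<Rightarrow> real \<Rightarrow> nat \<Rightarrow> real \<Rightarrow> nat \<times> nat \<Rightarrow> real" where
  "cav_c' N \<beta> q p \<theta> = (\<lambda>(i, j). if i < j then (if i = p \<or> j = p then \<beta> / sqrt N * cos \<theta> else 0)
     else if i = j \<and> i = p then - (\<beta> * sqrt q * sin \<theta>) else 0)"

lemma cav_c_deriv: "((\<lambda>s. cav_c N \<beta> q p s k) has_real_derivative cav_c' N \<beta> q p s k) (at s)"
proof -
  have "((\<lambda>s. \<beta> / sqrt N * sin s) has_real_derivative \<beta> / sqrt N * cos s) (at s)"
    by (rule DERIV_cmult[OF DERIV_sin])
  moreover have "((\<lambda>s. \<beta> * sqrt q * cos s) has_real_derivative - (\<beta> * sqrt q * sin s)) (at s)"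
    using DERIV_cmult[OF DERIV_cos, of "\<beta> * sqrt q" s] by simp
  ultimately show ?thesis
    unfolding cav_c_def cav_c'_def by (cases k) auto
qed

lemma cav_c'_bound: "\<bar>cav_c' N \<beta> q p s k\<bar> \<le> \<bar>\<beta> / sqrt N\<bar> + \<bar>\<beta> * sqrt q\<bar>"
  by (rule trig_abs_le[where s=s]) (cases k, auto simp: cav_c'_def)

lemma cav_c_end: "cav_c N \<beta> q p (pi / 2) = skc N \<beta>"
  by (auto simp: cav_c_def skc_def fun_eq_iff)

text \<open>One site is removed, but the divisor stays \<open>N\<close>: the quantity is free of the
  spins at \<open>p\<close> and differs from \<open>ov\<close> by just the product of these spins
  over N.\<close>

definition ovm :: "nat \<Rightarrow> nat \<Rightarrow> (nat \<Rightarrow> real) \<Rightarrow> (nat \<Rightarrow> real) \<Rightarrow> real" where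
  "ovm N p \<sigma> \<tau> = (\<Sum>i\<in>{..<N} - {p}. \<sigma> i * \<tau> i) / N"

lemma ovm_ov: "p < N \<Longrightarrow> ovm N p \<sigma> \<tau> = ov N \<sigma> \<tau> - \<sigma> p * \<tau> p / N"
  unfolding ovm_def ov_def by (simp add: sum_diff1 diff_divide_distrib)

text \<open>The bonds at \<open>p\<close> are obtained as the full double sum minus the one with the
  spin product at \<open>p\<close> set to 0; this leaves the product at \<open>p\<close> times the
  remaining overlap. The decreasing field at \<open>p\<close> supplies the -q that centres
  it.\<close>

lemma cav_c_cov:
  assumes N: "1 \<le> N" and p: "p < N" and q: "0 \<le> q" and \<sigma>: "\<sigma> \<in> configs N" and \<tau>: "\<tau> \<in> configs N"
  shows "(\<Sum>k\<in>bonds N. cav_c N \<beta> q p \<theta> k * cav_c' N \<beta> q p \<theta> k * (phi k \<sigma> * phi k \<tau>))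
    = sin \<theta> * cos \<theta> * (\<beta>\<^sup>2 * (\<sigma> p * \<tau> p * (ovm N p \<sigma> \<tau> - q)))"
proof -
  let ?x = "\<lambda>i. \<sigma> i * \<tau> i" let ?y = "\<lambda>i. if i = p then 0 else \<sigma> i * \<tau> i"
  have "(\<Sum>i<N. cav_c N \<beta> q p \<theta> (i, i) * cav_c' N \<beta> q p \<theta> (i, i) * (phi (i, i) \<sigma> * phi (i, i) \<tau>))
     = (\<Sum>i<N. if i = p then - (\<beta>\<^sup>2 * q * (sin \<theta> * cos \<theta>)) * ?x p else 0)"
    using q by (intro sum.cong refl) (simp add: cav_c_def cav_c'_def phi_def power2_eq_square)
  then have D: "(\<Sum>i<N. cav_c N \<beta> q p \<theta> (i, i) * cav_c' N \<beta> q p \<theta> (i, i) * (phi (i, i) \<sigma> * phi (i, i) \<tau>))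
     = - (\<beta>\<^sup>2 * q * (sin \<theta> * cos \<theta>)) * ?x p"
    using p by (simp add: sum.delta)
  have O: "(\<Sum>i<N. \<Sum>j\<in>{i<..<N}. cav_c N \<beta> q p \<theta> (i, j) * cav_c' N \<beta> q p \<theta> (i, j) * (phi (i, j) \<sigma> * phi (i, j) \<tau>))
     = (\<beta>\<^sup>2 / N * (sin \<theta> * cos \<theta>)) * ((\<Sum>i<N. \<Sum>j\<in>{i<..<N}. ?x i * ?x j) - (\<Sum>i<N. \<Sum>j\<in>{i<..<N}. ?y i * ?y j))"
    unfolding sum_subtractf[symmetric] sum_distrib_left using N
    by (intro sum.cong refl) (auto simp: cav_c_def cav_c'_def phi_def power2_eq_square field_simps)
  have s0: "(\<Sum>i<N. ?x i) = ?x p + N * ovm N p \<sigma> \<tau>"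
    using N p by (simp add: ovm_def sum.remove[of "{..<N}" p])
  have s1: "(\<Sum>i<N. ?y i) = N * ovm N p \<sigma> \<tau>"
    using N p by (simp add: ovm_def sum.remove[of "{..<N}" p])
  have s2: "(\<Sum>i<N. ?x i * ?x i) = N" using sum_spin_sq[OF \<sigma> \<tau>] by simp
  have s3: "(\<Sum>i<N. ?y i * ?y i) = real N - 1"
  proof -
    have "(\<Sum>i<N. ?y i * ?y i) = (\<Sum>i<N. 1 - (if i = p then 1 else 0))"
      using sum_spin_sq[OF \<sigma> \<tau>] by (intro sum.cong refl) auto
    also have "\<dots> = real N - 1" using p by (simp add: sum_subtractf sum.delta)
    finally show ?thesis .
  qed
  have xp: "?x p * ?x p = 1" using sum_spin_sq[OF \<sigma> \<tau> p] .
  have "((?x p + N * ovm N p \<sigma> \<tau>)\<^sup>2 - N) / 2 - ((N * ovm N p \<sigma> \<tau>)\<^sup>2 - (real N - 1)) / 2 = N * (?x p * ovm N p \<sigma> \<tau>)"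
    using xp by (simp add: power2_eq_square field_simps)
  then show ?thesis
    unfolding sum_bonds D O sum_offdiag s0 s1 s2 s3 using N by (simp add: field_simps)
qed

text \<open>The factor inserted under the average by one derivative along the cavity path, with sin
  \<theta> cos \<theta> split off.\<close>

definition Phi :: "nat \<Rightarrow> real \<Rightarrow> real \<Rightarrow> nat \<Rightarrow> nat \<Rightarrow> (nat \<Rightarrow> nat \<Rightarrow> real) \<Rightarrow> real" where
  "Phi N \<beta> q p m \<rho> = br m (\<lambda>a b. \<beta>\<^sup>2 * (\<rho> a p * \<rho> b p * (ovm N p (\<rho> a) (\<rho> b) - q)))"

text \<open>A convenient upper bound for 5 m^2 + m, the sum of the absolute values arising in
  \<open>br\<close>.\<close>

definition cb :: "nat \<Rightarrow> real" where "cb m = 6 * (real m + 1)\<^sup>2"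

lemma cb_nonneg: "0 \<le> cb m" by (simp add: cb_def)

lemma br_bound:
  assumes "\<And>a b. a < b \<Longrightarrow> b < m + 2 \<Longrightarrow> \<bar>\<Gamma> a b\<bar> \<le> x" and x: "0 \<le> x"
  shows "\<bar>br m \<Gamma>\<bar> \<le> cb m * x"
proof -
  have "\<bar>\<Sum>b<m. \<Sum>a<b. \<Gamma> a b\<bar> \<le> (\<Sum>b<m. \<Sum>a<m. x)"
  proof (rule order_trans[OF sum_abs], rule sum_mono)
    fix b assume b: "b \<in> {..<m}"
    have "\<bar>\<Sum>a<b. \<Gamma> a b\<bar> \<le> (\<Sum>a<b. x)"
      by (rule order_trans[OF sum_abs], rule sum_mono) (use assms b in auto)
    also have "\<dots> \<le> (\<Sum>a<m. x)" using b x by (simp add: mult_right_mono)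
    finally show "\<bar>\<Sum>a<b. \<Gamma> a b\<bar> \<le> (\<Sum>a<m. x)" .
  qed
  then have 1: "\<bar>\<Sum>b<m. \<Sum>a<b. \<Gamma> a b\<bar> \<le> m * (m * x)" by simp
  have "\<bar>\<Sum>a<m. \<Gamma> a m\<bar> \<le> (\<Sum>a<m. x)"
    by (rule order_trans[OF sum_abs], rule sum_mono) (use assms in auto)
  then have "m * \<bar>\<Sum>a<m. \<Gamma> a m\<bar> \<le> m * (m * x)" by (intro mult_left_mono) auto
  then have 2: "\<bar>m * (\<Sum>a<m. \<Gamma> a m)\<bar> \<le> m * (m * x)" by (simp add: abs_mult)
  have "(m * (m + 1)) * \<bar>\<Gamma> m (m + 1)\<bar> \<le> real (m * (m + 1)) * x" using assms by (intro mult_left_mono) auto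
  then have 3: "\<bar>m * (m + 1) * \<Gamma> m (m + 1)\<bar> \<le> m * (m + 1) * x" by (simp add: abs_mult)
  have "br m \<Gamma> = 2 * (\<Sum>b<m. \<Sum>a<b. \<Gamma> a b) - 2 * (m * (\<Sum>a<m. \<Gamma> a m)) + m * (m + 1) * \<Gamma> m (m + 1)"
    unfolding br_def by (simp add: algebra_simps)
  then have "\<bar>br m \<Gamma>\<bar> \<le> 2 * (m * (m * x)) + 2 * (m * (m * x)) + m * (m + 1) * x"
  proof -
    have "\<bar>2 * u - 2 * v + w\<bar> \<le> 2 * U + 2 * V + W" if "\<bar>u\<bar> \<le> U" "\<bar>v\<bar> \<le> V" "\<bar>w\<bar> \<le> W" for u v w U V W :: real
      using that by arith
    from this[OF 1 2 3] \<open>br m \<Gamma> = _\<close> show ?thesis by (simp only:)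
  qed
  also have "\<dots> = (5 * (m * m) + m) * x" by (simp add: algebra_simps)
  also have "\<dots> \<le> cb m * x"
    unfolding cb_def by (intro mult_right_mono x) (simp add: power2_eq_square algebra_simps)
  finally show ?thesis .
qed

lemma Phi_dep: "dep m f \<Longrightarrow> dep (m + 2) (\<lambda>\<rho>. f \<rho> * Phi N \<beta> q p m \<rho>)"
  unfolding dep_def
proof (intro allI impI)
  fix \<rho> \<rho>' :: "nat \<Rightarrow> nat \<Rightarrow> real" assume f: "\<forall>\<rho> \<rho>'. (\<forall>r<m. \<rho> r = \<rho>' r) \<longrightarrow> f \<rho> = f \<rho>'" and eq: "\<forall>r<m + 2. \<rho> r = \<rho>' r"
  have "Phi N \<beta> q p m \<rho> = Phi N \<beta> q p m \<rho>'"
    unfolding Phi_def by (rule br_cong) (use eq in auto)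
  moreover have "f \<rho> = f \<rho>'" using f eq by auto
  ultimately show "f \<rho> * Phi N \<beta> q p m \<rho> = f \<rho>' * Phi N \<beta> q p m \<rho>'" by simp
qed

lemma spin_prod_abs:
  assumes "\<rho> \<in> reps N K" "u < K" "v < K" "p < N"
  shows "\<bar>\<rho> u p * \<rho> v p\<bar> = 1"
  using configs_spin[OF reps_configs[OF assms(1,2)] assms(4)] configs_spin[OF reps_configs[OF assms(1,3)] assms(4)] by auto

lemma ov_abs_le: "\<sigma> \<in> configs N \<Longrightarrow> \<tau> \<in> configs N \<Longrightarrow> \<bar>\<Sum>i\<in>{..<N} - {p}. \<sigma> i * \<tau> i\<bar> \<le> N"
proof -
  assume *: "\<sigma> \<in> configs N" "\<tau> \<in> configs N"
  have "\<bar>\<Sum>i\<in>{..<N} - {p}. \<sigma> i * \<tau> i\<bar> \<le> (\<Sum>i\<in>{..<N} - {p}. 1)"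
  proof (rule order_trans[OF sum_abs], rule sum_mono)
    fix i assume "i \<in> {..<N} - {p}"
    then show "\<bar>\<sigma> i * \<tau> i\<bar> \<le> 1" using configs_spin[OF *(1), of i] configs_spin[OF *(2), of i] by auto
  qed
  also have "\<dots> \<le> N" using card_mono[of "{..<N}" "{..<N} - {p}"] by simp
  finally show ?thesis .
qed

section \<open>Estimates along the cavity path\<close>

context
  fixes h :: real and N :: nat and \<beta> q :: real and t :: "nat \<Rightarrow> real" and p K :: nat
  assumes sk: "sk h N \<beta> q t" and p: "p < N"
begin

lemma sk_facts: "1 \<le> N" "0 < \<beta>" "\<beta> < 1 / 16" "0 \<le> q" "q \<le> 1" "\<beta>\<^sup>2 \<le> 1 / 4"
  using sk power_mono[of \<beta> "1/16" 2] unfolding sk_def by (auto simp: power_divide)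

text \<open>No smallness is claimed: this bound serves the Gronwall argument, which has to run
  before moments are known inside the path. Overlaps minus q are at most 2 and \<beta>^2 is at most
  1/4.\<close>

lemma Phi_crude:
  assumes "\<rho> \<in> reps N K" "m + 2 \<le> K"
  shows "\<bar>Phi N \<beta> q p m \<rho>\<bar> \<le> cb m * 1"
  unfolding Phi_def
proof (rule br_bound)
  fix a b :: nat assume ab: "a < b" "b < m + 2"
  have c: "\<rho> a \<in> configs N" "\<rho> b \<in> configs N" using ab assms reps_configs[of \<rho> N K] by auto
  have "\<bar>ovm N p (\<rho> a) (\<rho> b)\<bar> \<le> 1"
    unfolding ovm_def using ov_abs_le[OF c, of p] sk_facts(1) by (simp add: abs_divide)
  then have "\<bar>ovm N p (\<rho> a) (\<rho> b) - q\<bar> \<le> 2" using sk_facts(4,5) by linarith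
  then have "\<beta>\<^sup>2 * \<bar>ovm N p (\<rho> a) (\<rho> b) - q\<bar> \<le> 1 / 4 * 2" using sk_facts(6) by (intro mult_mono) auto
  then show "\<bar>\<beta>\<^sup>2 * (\<rho> a p * \<rho> b p * (ovm N p (\<rho> a) (\<rho> b) - q))\<bar> \<le> 1"
    using spin_prod_abs[OF assms(1) _ _ p, of a b] ab assms(2) by (simp add: abs_mult[of "\<beta>\<^sup>2"] abs_mult[of "\<rho> a p * \<rho> b p"])
qed simp

text \<open>The summand 1 in \<open>Dom\<close> pays for the removed site, because 1/N is at most
  1/sqrt N.\<close>

lemma ovm_Dom:
  assumes "\<rho> \<in> reps N K" "a' < b" "b < K'" "K' \<le> K"
  shows "\<bar>ovm N p (\<rho> a') (\<rho> b) - q\<bar> \<le> Dom N K' n q t \<rho> / sqrt N"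
proof -
  have N: "1 \<le> sqrt N" using sk_facts(1) by simp
  have "\<bar>\<rho> a' p * \<rho> b p / N\<bar> = 1 / N"
    using spin_prod_abs[OF assms(1) _ _ p, of a' b] assms by (simp add: abs_divide)
  also have "\<dots> \<le> 1 / sqrt N"
  proof -
    have "sqrt N * 1 \<le> sqrt N * sqrt N" using N by (intro mult_left_mono) auto
    then show ?thesis using sk_facts(1) by (intro divide_left_mono) auto
  qed
  finally have "\<bar>ovm N p (\<rho> a') (\<rho> b) - q\<bar> \<le> 1 / sqrt N + \<bar>ov N (\<rho> a') (\<rho> b) - q\<bar>"
    unfolding ovm_ov[OF p] by linarith
  also have "\<dots> = (1 + sqrt N * \<bar>ov N (\<rho> a') (\<rho> b) - q\<bar>) / sqrt N"
    using N by (simp add: field_simps)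
  also have "\<dots> \<le> Dom N K' n q t \<rho> / sqrt N"
    using N Dom_ov[OF assms(2,3)] by (intro divide_right_mono) auto
  finally show ?thesis .
qed

text \<open>The gain of each cavity derivative: a factor 1/sqrt N at the price of one more power of
  \<open>Dom\<close>.\<close>

lemma Phi_Dom:
  assumes "\<rho> \<in> reps N K" "m + 2 \<le> K'" "K' \<le> K"
  shows "\<bar>Phi N \<beta> q p m \<rho>\<bar> \<le> cb m * (Dom N K' n q t \<rho> / sqrt N)"
  unfolding Phi_def
proof (rule br_bound)
  fix a b :: nat assume ab: "a < b" "b < m + 2"
  have "\<beta>\<^sup>2 * \<bar>ovm N p (\<rho> a) (\<rho> b) - q\<bar> \<le> 1 * (Dom N K' n q t \<rho> / sqrt N)"
    using sk_facts(6) ovm_Dom[OF assms(1) ab(1), of K' n] ab assms by (intro mult_mono) auto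
  then show "\<bar>\<beta>\<^sup>2 * (\<rho> a p * \<rho> b p * (ovm N p (\<rho> a) (\<rho> b) - q))\<bar> \<le> Dom N K' n q t \<rho> / sqrt N"
    using spin_prod_abs[OF assms(1) _ _ p, of a b] ab assms(2,3) by (simp add: abs_mult[of "\<beta>\<^sup>2"] abs_mult[of "\<rho> a p * \<rho> b p"])
next
  show "0 \<le> Dom N K' n q t \<rho> / sqrt N" using Dom_ge1[of N K' n q t \<rho>] by simp
qed

lemma cav_deriv:
  assumes "dep m f" "m + 2 \<le> K"
  shows "((\<lambda>\<theta>. nu N h (cav_c N \<beta> q p \<theta>) K f) has_real_derivative
    sin \<theta> * cos \<theta> * nu N h (cav_c N \<beta> q p \<theta>) K (\<lambda>\<rho>. f \<rho> * Phi N \<beta> q p m \<rho>)) (at \<theta>)"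
proof -
  let ?G = "\<lambda>\<sigma> \<tau>. sin \<theta> * cos \<theta> * (\<beta>\<^sup>2 * (\<sigma> p * \<tau> p * (ovm N p \<sigma> \<tau> - q)))"
  have "((\<lambda>\<theta>. nu N h (cav_c N \<beta> q p \<theta>) K f) has_real_derivative
    nu N h (cav_c N \<beta> q p \<theta>) K (\<lambda>_. 0) + nu N h (cav_c N \<beta> q p \<theta>) K (\<lambda>\<rho>. f \<rho> * br m (\<lambda>a b. ?G (\<rho> a) (\<rho> b)))) (at \<theta>)"
    by (rule nu_deriv_cov[where f="\<lambda>_. f" and c'="cav_c' N \<beta> q p" and const=0,
          OF assms DERIV_const cav_c_deriv cav_c'_bound])
      (simp only: cav_c_cov[OF sk_facts(1) p sk_facts(4)] add_0_right)
  moreover have "f \<rho> * br m (\<lambda>a b. ?G (\<rho> a) (\<rho> b)) = (sin \<theta> * cos \<theta>) * (f \<rho> * Phi N \<beta> q p m \<rho>)" for \<rho>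
    unfolding Phi_def br_scale by (simp only: mult_ac)
  ultimately show ?thesis by (simp only: nu_cmult nu_const add_0)
qed

lemma sin_cos_le1: "\<bar>sin \<theta> * cos \<theta>\<bar> \<le> 1" for \<theta> :: real
  unfolding abs_mult using mult_mono[OF abs_sin_le_one abs_cos_le_one, of \<theta> \<theta>] by simp

text \<open>The derivative is at least -\<open>cb m\<close> times the average, so multiplication by
  exp(\<open>cb m\<close> \<theta>) gives a nondecreasing function. The known endpoint is \<theta> =
  pi/2, and the estimate is carried back from there; pi/2 is rounded up to 2.\<close>

lemma cav_gronwall:
  assumes f: "dep m f" "m + 2 \<le> K" "\<And>\<rho>. 0 \<le> f \<rho>" and \<theta>: "0 \<le> \<theta>" "\<theta> \<le> pi / 2"
  shows "nu N h (cav_c N \<beta> q p \<theta>) K f \<le> exp (2 * cb m) * nu N h (skc N \<beta>) K f"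
proof -
  let ?\<psi> = "\<lambda>\<theta>. nu N h (cav_c N \<beta> q p \<theta>) K f"
  have "?\<psi> \<theta> * exp (cb m * \<theta>) \<le> ?\<psi> (pi / 2) * exp (cb m * (pi / 2))"
  proof (rule DERIV_nonneg_imp_nondecreasing[OF \<theta>(2)])
    fix x :: real
    let ?d = "sin x * cos x * nu N h (cav_c N \<beta> q p x) K (\<lambda>\<rho>. f \<rho> * Phi N \<beta> q p m \<rho>)"
    have D: "((\<lambda>\<theta>. ?\<psi> \<theta> * exp (cb m * \<theta>)) has_real_derivative ?d * exp (cb m * x) + exp (cb m * x) * cb m * ?\<psi> x) (at x)"
      by (intro DERIV_mult cav_deriv f(1,2)) (auto intro!: derivative_eq_intros)
    have "\<bar>nu N h (cav_c N \<beta> q p x) K (\<lambda>\<rho>. f \<rho> * Phi N \<beta> q p m \<rho>)\<bar> \<le> nu N h (cav_c N \<beta> q p x) K (\<lambda>\<rho>. cb m * f \<rho>)"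
    proof (rule nu_abs_le)
      fix \<rho> assume "\<rho> \<in> reps N K"
      from mult_left_mono[OF Phi_crude[OF this f(2)] f(3)]
      show "\<bar>f \<rho> * Phi N \<beta> q p m \<rho>\<bar> \<le> cb m * f \<rho>" using f(3)[of \<rho>] by (simp add: abs_mult mult.commute)
    qed
    then have "\<bar>?d\<bar> \<le> 1 * (cb m * ?\<psi> x)"
      unfolding abs_mult[of "sin x * cos x"] nu_cmult using cb_nonneg nu_nonneg[OF f(3)]
      by (intro mult_mono sin_cos_le1) auto
    then have "0 \<le> ?d + cb m * ?\<psi> x" by linarith
    then have "0 \<le> (?d + cb m * ?\<psi> x) * exp (cb m * x)" by simp
    then have "0 \<le> ?d * exp (cb m * x) + exp (cb m * x) * cb m * ?\<psi> x" by (simp add: algebra_simps)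
    then show "\<exists>y. ((\<lambda>\<theta>. ?\<psi> \<theta> * exp (cb m * \<theta>)) has_real_derivative y) (at x) \<and> 0 \<le> y" using D by blast
  qed
  moreover have "?\<psi> \<theta> * 1 \<le> ?\<psi> \<theta> * exp (cb m * \<theta>)"
    using cb_nonneg \<theta> nu_nonneg[OF f(3)] by (intro mult_left_mono) auto
  moreover have "exp (cb m * (pi / 2)) \<le> exp (2 * cb m)"
    using mult_left_mono[of "pi / 2" 2 "cb m"] cb_nonneg[of m] pi_less_4 by (simp add: mult.commute)
  then have "?\<psi> (pi / 2) * exp (cb m * (pi / 2)) \<le> ?\<psi> (pi / 2) * exp (2 * cb m)"
    using nu_nonneg[OF f(3)] by (intro mult_left_mono) auto
  ultimately show ?thesis unfolding cav_c_end by (simp add: mult.commute)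
qed

text \<open>Mean value inequality on a path of length at most 2, with \<open>Phi_Dom\<close>
  bounding the derivative by order 1/sqrt N.\<close>

lemma cav_increment:
  assumes f: "dep m f" "m + 2 \<le> K'" "K' \<le> K" and A: "0 \<le> A"
    and bd: "\<And>\<rho>. \<rho> \<in> reps N K \<Longrightarrow> \<bar>f \<rho>\<bar> \<le> A * Dom N K' n q t \<rho> ^ r"
    and C: "\<And>\<theta>. 0 \<le> \<theta> \<Longrightarrow> \<theta> \<le> pi / 2 \<Longrightarrow> nu N h (cav_c N \<beta> q p \<theta>) K (\<lambda>\<rho>. Dom N K' n q t \<rho> ^ (r + 1)) \<le> C"
    and \<theta>: "0 \<le> \<theta>" "\<theta> \<le> pi / 2"
  shows "\<bar>nu N h (cav_c N \<beta> q p \<theta>) K f - nu N h (cav_c N \<beta> q p 0) K f\<bar> \<le> 2 * (A * cb m * C / sqrt N)"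
proof -
  let ?\<psi> = "\<lambda>\<theta>. nu N h (cav_c N \<beta> q p \<theta>) K f"
  have b: "\<bar>nu N h (cav_c N \<beta> q p x) K (\<lambda>\<rho>. f \<rho> * Phi N \<beta> q p m \<rho>)\<bar> \<le> A * cb m * C / sqrt N"
    if x: "0 \<le> x" "x \<le> pi / 2" for x
  proof -
    have "\<bar>nu N h (cav_c N \<beta> q p x) K (\<lambda>\<rho>. f \<rho> * Phi N \<beta> q p m \<rho>)\<bar>
       \<le> nu N h (cav_c N \<beta> q p x) K (\<lambda>\<rho>. (A * cb m / sqrt N) * Dom N K' n q t \<rho> ^ (r + 1))"
    proof (rule nu_abs_le)
      fix \<rho> assume \<rho>: "\<rho> \<in> reps N K"
      have "\<bar>f \<rho>\<bar> * \<bar>Phi N \<beta> q p m \<rho>\<bar> \<le> (A * Dom N K' n q t \<rho> ^ r) * (cb m * (Dom N K' n q t \<rho> / sqrt N))"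
        using bd[OF \<rho>] Phi_Dom[OF \<rho> f(2,3), of n] by (intro mult_mono) auto
      then show "\<bar>f \<rho> * Phi N \<beta> q p m \<rho>\<bar> \<le> (A * cb m / sqrt N) * Dom N K' n q t \<rho> ^ (r + 1)"
        by (simp add: abs_mult mult_ac)
    qed
    also have "\<dots> \<le> (A * cb m / sqrt N) * C"
      unfolding nu_cmult by (intro mult_left_mono C x divide_nonneg_nonneg mult_nonneg_nonneg A cb_nonneg) simp
    finally show ?thesis by (simp add: mult_ac)
  qed
  have "norm (?\<psi> \<theta> - ?\<psi> 0) \<le> (A * cb m * C / sqrt N) * norm (\<theta> - 0)"
  proof (rule field_differentiable_bound[of "{0..pi/2}"])
    fix x assume x: "x \<in> {0..pi / 2}"
    show "(?\<psi> has_real_derivative sin x * cos x * nu N h (cav_c N \<beta> q p x) K (\<lambda>\<rho>. f \<rho> * Phi N \<beta> q p m \<rho>)) (at x within {0..pi / 2})"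
      by (rule has_field_derivative_at_within[OF cav_deriv]) (use f in auto)
    have "\<bar>sin x * cos x\<bar> * \<bar>nu N h (cav_c N \<beta> q p x) K (\<lambda>\<rho>. f \<rho> * Phi N \<beta> q p m \<rho>)\<bar> \<le> 1 * (A * cb m * C / sqrt N)"
      using b[of x] x by (intro mult_mono sin_cos_le1) auto
    then show "norm (sin x * cos x * nu N h (cav_c N \<beta> q p x) K (\<lambda>\<rho>. f \<rho> * Phi N \<beta> q p m \<rho>)) \<le> A * cb m * C / sqrt N"
      by (simp add: abs_mult)
  qed (use \<theta> in auto)
  moreover have "0 \<le> A * cb m * C / sqrt N" using b[OF \<theta>] by linarith
  then have "(A * cb m * C / sqrt N) * norm (\<theta> - 0) \<le> (A * cb m * C / sqrt N) * 2"
    using \<theta> pi_less_4 by (intro mult_left_mono) auto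
  ultimately have "norm (?\<psi> \<theta> - ?\<psi> 0) \<le> (A * cb m * C / sqrt N) * 2" by (rule order_trans)
  then show ?thesis by (simp only: real_norm_def mult.commute)
qed

text \<open>Let g(\<theta>) be the average of f times \<open>Phi\<close>. Subtracting (1/2) (sin
  \<theta>)^2 g(0) leaves the derivative sin \<theta> cos \<theta> (g(\<theta>) - g(0)), and
  \<open>cav_increment\<close>, applied to f times \<open>Phi\<close> with m + 2 replicas, makes
  this of order 1/N. The coefficient 1/2 of the first-order term is the value of the subtracted
  function at pi/2.\<close>

lemma cav_expansion:
  assumes f: "dep m f" "m + 4 \<le> K'" "K' \<le> K" and A: "0 \<le> A"
    and bd: "\<And>\<rho>. \<rho> \<in> reps N K \<Longrightarrow> \<bar>f \<rho>\<bar> \<le> A * Dom N K' n q t \<rho> ^ r"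
    and C: "\<And>\<theta>. 0 \<le> \<theta> \<Longrightarrow> \<theta> \<le> pi / 2 \<Longrightarrow> nu N h (cav_c N \<beta> q p \<theta>) K (\<lambda>\<rho>. Dom N K' n q t \<rho> ^ (r + 2)) \<le> C"
  shows "\<bar>nu N h (skc N \<beta>) K f - nu N h (cav_c N \<beta> q p 0) K f
      - 1 / 2 * nu N h (cav_c N \<beta> q p 0) K (\<lambda>\<rho>. f \<rho> * Phi N \<beta> q p m \<rho>)\<bar>
    \<le> 4 * (A * cb m * cb (m + 2) * C / N)"
proof -
  let ?\<psi> = "\<lambda>\<theta>. nu N h (cav_c N \<beta> q p \<theta>) K f"
  let ?g = "\<lambda>\<theta>. nu N h (cav_c N \<beta> q p \<theta>) K (\<lambda>\<rho>. f \<rho> * Phi N \<beta> q p m \<rho>)"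
  let ?e = "A * cb m * cb (m + 2) * C / N"
  have inc: "\<bar>?g \<theta> - ?g 0\<bar> \<le> 2 * ?e" if \<theta>: "0 \<le> \<theta>" "\<theta> \<le> pi / 2" for \<theta>
  proof -
    have "\<bar>?g \<theta> - ?g 0\<bar> \<le> 2 * ((A * cb m / sqrt N) * cb (m + 2) * C / sqrt N)"
    proof (rule cav_increment[where K'=K' and n=n and r="r + 1"])
      show "dep (m + 2) (\<lambda>\<rho>. f \<rho> * Phi N \<beta> q p m \<rho>)" by (rule Phi_dep[OF f(1)])
      show "0 \<le> A * cb m / sqrt N" using A cb_nonneg by simp
      show "\<bar>f \<rho> * Phi N \<beta> q p m \<rho>\<bar> \<le> A * cb m / sqrt N * Dom N K' n q t \<rho> ^ (r + 1)" if \<rho>: "\<rho> \<in> reps N K" for \<rho>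
      proof -
        have "\<bar>f \<rho>\<bar> * \<bar>Phi N \<beta> q p m \<rho>\<bar> \<le> (A * Dom N K' n q t \<rho> ^ r) * (cb m * (Dom N K' n q t \<rho> / sqrt N))"
          using bd[OF \<rho>] Phi_Dom[OF \<rho> _ f(3), of m n] f by (intro mult_mono) auto
        then show ?thesis by (simp add: abs_mult mult_ac)
      qed
    qed (use C f \<theta> in auto)
    also have "(A * cb m / sqrt N) * cb (m + 2) * C / sqrt N = A * cb m * cb (m + 2) * C / (sqrt N * sqrt N)"
      by simp
    finally show ?thesis by simp
  qed
  have e0: "0 \<le> ?e" using inc[of 0] by simp
  have "norm ((?\<psi> (pi / 2) - 1 / 2 * (sin (pi / 2))\<^sup>2 * ?g 0) - (?\<psi> 0 - 1 / 2 * (sin 0)\<^sup>2 * ?g 0)) \<le> (2 * ?e) * norm (pi / 2 - 0)"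
  proof (rule field_differentiable_bound[of "{0..pi/2}" "\<lambda>\<theta>. ?\<psi> \<theta> - 1 / 2 * (sin \<theta>)\<^sup>2 * ?g 0"])
    fix x assume x: "x \<in> {0..pi / 2}"
    have Dz: "((\<lambda>\<theta>. 1 / 2 * (sin \<theta>)\<^sup>2 * z) has_real_derivative sin x * cos x * z) (at x)" for z :: real
      by (auto intro!: derivative_eq_intros)
    have "((\<lambda>\<theta>. ?\<psi> \<theta> - 1 / 2 * (sin \<theta>)\<^sup>2 * ?g 0) has_real_derivative sin x * cos x * ?g x - sin x * cos x * ?g 0) (at x)"
      by (rule DERIV_diff[OF cav_deriv[OF f(1)] Dz]) (use f in simp)
    then show "((\<lambda>\<theta>. ?\<psi> \<theta> - 1 / 2 * (sin \<theta>)\<^sup>2 * ?g 0) has_real_derivative sin x * cos x * (?g x - ?g 0)) (at x within {0..pi / 2})"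
      unfolding right_diff_distrib by (rule has_field_derivative_at_within)
    have "\<bar>sin x * cos x\<bar> * \<bar>?g x - ?g 0\<bar> \<le> 1 * (2 * ?e)"
      using inc[of x] x by (intro mult_mono sin_cos_le1) auto
    then show "norm (sin x * cos x * (?g x - ?g 0)) \<le> 2 * ?e" by (simp add: abs_mult)
  qed simp_all
  moreover have "(2 * ?e) * norm (pi / 2 - 0) \<le> (2 * ?e) * 2"
    using e0 pi_less_4 by (intro mult_left_mono) auto
  ultimately show ?thesis unfolding cav_c_end by simp
qed

end

text \<open>Moments of the model itself are transported to every point of every cavity path. The
  exponential loss depends on \<open>K'\<close> alone, so the bound is uniform in the site and the
  angle.\<close>

lemma cav_moment:
  assumes K: "4 \<le> K'" "K' + 2 \<le> K" "2 * n \<le> K'"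
  shows "\<exists>C\<ge>0. \<forall>N \<beta> q t p \<theta>. sk h N \<beta> q t \<longrightarrow> p < N \<longrightarrow> 0 \<le> \<theta> \<longrightarrow> \<theta> \<le> pi / 2 \<longrightarrow>
    nu N h (cav_c N \<beta> q p \<theta>) K (\<lambda>\<rho>. Dom N K' n q t \<rho> ^ r) \<le> C"
proof -
  obtain C where C: "\<And>N \<beta> q t. sk h N \<beta> q t \<Longrightarrow> nu N h (skc N \<beta>) K (\<lambda>\<rho>. Dom N K' n q t \<rho> ^ r) \<le> C"
    using sk_moment[of K K' n h r] K by auto
  have "nu N h (cav_c N \<beta> q p \<theta>) K (\<lambda>\<rho>. Dom N K' n q t \<rho> ^ r) \<le> exp (2 * cb K') * \<bar>C\<bar>"
    if "sk h N \<beta> q t" "p < N" "0 \<le> \<theta>" "\<theta> \<le> pi / 2" for N \<beta> q t p \<theta>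
  proof -
    have "nu N h (cav_c N \<beta> q p \<theta>) K (\<lambda>\<rho>. Dom N K' n q t \<rho> ^ r) \<le> exp (2 * cb K') * nu N h (skc N \<beta>) K (\<lambda>\<rho>. Dom N K' n q t \<rho> ^ r)"
    proof (rule cav_gronwall[OF that(1,2) Dom_dep[OF K(3)] K(2) _ that(3,4)])
      show "0 \<le> Dom N K' n q t \<rho> ^ r" for \<rho> using Dom_ge1[of N K' n q t \<rho>] by simp
    qed
    also have "\<dots> \<le> exp (2 * cb K') * \<bar>C\<bar>" using C[OF that(1)] by (intro mult_left_mono) auto
    finally show ?thesis .
  qed
  then show ?thesis by (intro exI[of _ "exp (2 * cb K') * \<bar>C\<bar>"]) auto
qed

section \<open>The cavity identity\<close>

text \<open>\<open>F0\<close> and \<open>F1\<close> are the terms of order zero and one of \<open>F\<close> in a small parameter \<open>T\<close>; \<open>D\<close> controls the size of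
  the variables. The property is closed under multiplication, which yields Taylor's formula for monomials.\<close>

definition taylor1 :: "real \<Rightarrow> real \<Rightarrow> real \<Rightarrow> nat \<Rightarrow> real \<Rightarrow> real \<Rightarrow> real \<Rightarrow> bool" where
  "taylor1 C T D j F F0 F1 \<longleftrightarrow> \<bar>F0\<bar> \<le> C * D ^ j \<and> \<bar>F1\<bar> \<le> C * T * D ^ j \<and> \<bar>F - F0 - F1\<bar> \<le> C * T\<^sup>2 * D ^ j"

text \<open>The remainder of the product is F1 G1 + (F - F0 - F1) G + (F0 + F1)(G - G0 - G1). As |G|
  is at most three and |F0 + F1| at most two times its leading bound, the constants add up to 1 + 3
  + 2 = 6.\<close>

lemma taylor1_mult:
  assumes F: "taylor1 C T D j F F0 F1" and G: "taylor1 C' T D j' G G0 G1"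
    and T: "0 \<le> T" "T \<le> 1" and D: "1 \<le> D" and C: "0 \<le> C" "0 \<le> C'"
  shows "taylor1 (6 * C * C') T D (j + j') (F * G) (F0 * G0) (F0 * G1 + F1 * G0)"
proof -
  define x where "x = C * D ^ j" define y where "y = C' * D ^ j'"
  have x: "0 \<le> x" and y: "0 \<le> y" unfolding x_def y_def using C D by auto
  have f: "\<bar>F0\<bar> \<le> x" "\<bar>F1\<bar> \<le> x * T" "\<bar>F - F0 - F1\<bar> \<le> x * T\<^sup>2"
    using F unfolding taylor1_def x_def by (simp_all add: mult_ac)
  have g: "\<bar>G0\<bar> \<le> y" "\<bar>G1\<bar> \<le> y * T" "\<bar>G - G0 - G1\<bar> \<le> y * T\<^sup>2"
    using G unfolding taylor1_def y_def by (simp_all add: mult_ac)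
  have xy: "6 * C * C' * D ^ (j + j') = 6 * (x * y)" unfolding x_def y_def by (simp add: power_add)
  have xy0: "0 \<le> x * y" using x y by simp
  have a1: "\<bar>F0 * G0\<bar> \<le> x * y" unfolding abs_mult by (intro mult_mono f g x) auto
  have a2: "\<bar>F0 * G1\<bar> \<le> x * (y * T)" "\<bar>F1 * G0\<bar> \<le> (x * T) * y"
    unfolding abs_mult by (intro mult_mono f g x; use x T in simp)+
  have T2: "T\<^sup>2 \<le> T" using T by (simp add: power2_eq_square mult_left_le)
  have Gb: "\<bar>G\<bar> \<le> 3 * y"
  proof -
    have "y * T \<le> y" "y * T\<^sup>2 \<le> y" using y T T2 by (auto intro: mult_left_le)
    then show ?thesis using g by linarith
  qed
  have Fb: "\<bar>F0 + F1\<bar> \<le> 2 * x"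
  proof -
    have "x * T \<le> x" using x T by (auto intro: mult_left_le)
    then show ?thesis using f by linarith
  qed
  have b1: "\<bar>F1 * G1\<bar> \<le> (x * T) * (y * T)" unfolding abs_mult by (intro mult_mono f g) (use x T in auto)
  have b2: "\<bar>(F - F0 - F1) * G\<bar> \<le> (x * T\<^sup>2) * (3 * y)" unfolding abs_mult by (intro mult_mono f Gb) (use x in auto)
  have b3: "\<bar>(F0 + F1) * (G - G0 - G1)\<bar> \<le> (2 * x) * (y * T\<^sup>2)" unfolding abs_mult by (intro mult_mono g Fb) (use x in auto)
  have "F * G - F0 * G0 - (F0 * G1 + F1 * G0) = F1 * G1 + (F - F0 - F1) * G + (F0 + F1) * (G - G0 - G1)"
    by (simp add: algebra_simps)
  then have "\<bar>F * G - F0 * G0 - (F0 * G1 + F1 * G0)\<bar> \<le> \<bar>F1 * G1\<bar> + \<bar>(F - F0 - F1) * G\<bar> + \<bar>(F0 + F1) * (G - G0 - G1)\<bar>"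
    by linarith
  also have "\<dots> \<le> (x * T) * (y * T) + (x * T\<^sup>2) * (3 * y) + (2 * x) * (y * T\<^sup>2)"
    using b1 b2 b3 by linarith
  also have "\<dots> = 6 * (x * y) * T\<^sup>2" by (simp add: power2_eq_square algebra_simps)
  finally have c: "\<bar>F * G - F0 * G0 - (F0 * G1 + F1 * G0)\<bar> \<le> 6 * (x * y) * T\<^sup>2" .
  have "\<bar>F0 * G1 + F1 * G0\<bar> \<le> x * (y * T) + (x * T) * y" using a2 by linarith
  also have "\<dots> = 2 * (x * y * T)" by (simp add: algebra_simps)
  also have "\<dots> \<le> 6 * (x * y * T)" using xy0 T by simp
  finally have b: "\<bar>F0 * G1 + F1 * G0\<bar> \<le> 6 * (x * y) * T" by (simp add: mult.assoc)
  have a: "\<bar>F0 * G0\<bar> \<le> 6 * (x * y)" using a1 xy0 by linarith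
  show ?thesis unfolding taylor1_def
  proof (intro conjI)
    show "\<bar>F0 * G0\<bar> \<le> 6 * C * C' * D ^ (j + j')" unfolding xy by (rule a)
    show "\<bar>F0 * G1 + F1 * G0\<bar> \<le> 6 * C * C' * T * D ^ (j + j')"
    proof -
      have "6 * C * C' * T * D ^ (j + j') = 6 * (x * y) * T" unfolding xy[symmetric] by (simp only: mult_ac)
      then show ?thesis using b by (simp only:)
    qed
    show "\<bar>F * G - F0 * G0 - (F0 * G1 + F1 * G0)\<bar> \<le> 6 * C * C' * T\<^sup>2 * D ^ (j + j')"
    proof -
      have "6 * C * C' * T\<^sup>2 * D ^ (j + j') = 6 * (x * y) * T\<^sup>2" unfolding xy[symmetric] by (simp only: mult_ac)
      then show ?thesis using c by (simp only:)
    qed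
  qed
qed

text \<open>A single factor satisfies the property with constant 3 and each multiplication costs 6,
  hence 18 per degree.\<close>

lemma taylor1_power:
  assumes x: "\<bar>x\<bar> \<le> 3 * D" and y: "\<bar>y\<bar> \<le> 2 * T" and T: "0 \<le> T" "T \<le> 1" and D: "1 \<le> D"
  shows "taylor1 (18 ^ k) T D k ((x + y) ^ k) (x ^ k) (k * x ^ (k - 1) * y)"
proof (induction k)
  case 0 show ?case using T by (simp add: taylor1_def)
next
  case (Suc k)
  have "2 * T * 1 \<le> 3 * T * D" using T D by (intro mult_mono) auto
  then have base: "taylor1 3 T D 1 (x + y) x y"
    using x y T D unfolding taylor1_def by auto
  have "taylor1 (6 * 18 ^ k * 3) T D (k + 1) ((x + y) ^ k * (x + y)) (x ^ k * x) (x ^ k * y + k * x ^ (k - 1) * y * x)"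
    by (rule taylor1_mult[OF Suc base T D]) auto
  moreover have "x ^ k * y + k * x ^ (k - 1) * y * x = Suc k * x ^ (Suc k - 1) * y"
    by (cases k) (auto simp: algebra_simps)
  ultimately show ?case by (simp add: mult_ac)
qed

lemma taylor1_prod:
  fixes x y :: "nat \<Rightarrow> real"
  assumes x: "\<And>l. l < n \<Longrightarrow> \<bar>x l\<bar> \<le> 3 * D" and y: "\<And>l. l < n \<Longrightarrow> \<bar>y l\<bar> \<le> 2 * T"
    and T: "0 \<le> T" "T \<le> 1" and D: "1 \<le> D"
  shows "taylor1 (6 ^ n * 18 ^ (\<Sum>l<n. k l)) T D (\<Sum>l<n. k l) (\<Prod>l<n. (x l + y l) ^ k l) (\<Prod>l<n. x l ^ k l)
     (\<Sum>l<n. y l * (k l * x l ^ (k l - 1) * (\<Prod>l'\<in>{..<n} - {l}. x l' ^ k l')))"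
  using x y
proof (induction n)
  case 0 show ?case using T by (simp add: taylor1_def)
next
  case (Suc n)
  let ?F1 = "\<lambda>n. \<Sum>l<n. y l * (k l * x l ^ (k l - 1) * (\<Prod>l'\<in>{..<n} - {l}. x l' ^ k l'))"
  have "taylor1 (6 * (6 ^ n * 18 ^ (\<Sum>l<n. k l)) * 18 ^ k n) T D ((\<Sum>l<n. k l) + k n)
     ((\<Prod>l<n. (x l + y l) ^ k l) * (x n + y n) ^ k n) ((\<Prod>l<n. x l ^ k l) * x n ^ k n)
     ((\<Prod>l<n. x l ^ k l) * (k n * x n ^ (k n - 1) * y n) + ?F1 n * x n ^ k n)"
    by (rule taylor1_mult[OF Suc.IH taylor1_power T D]) (use Suc.prems T D in auto)
  moreover have "(\<Prod>l<n. x l ^ k l) * (k n * x n ^ (k n - 1) * y n) + ?F1 n * x n ^ k n = ?F1 (Suc n)"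
  proof -
    have "(\<Prod>l'\<in>{..<Suc n} - {l}. x l' ^ k l') = (\<Prod>l'\<in>{..<n} - {l}. x l' ^ k l') * x n ^ k n" if "l < n" for l
    proof -
      have "{..<Suc n} - {l} = insert n ({..<n} - {l})" using that by auto
      then show ?thesis by (simp add: mult.commute)
    qed
    then have "(\<Sum>l<n. y l * (k l * x l ^ (k l - 1) * (\<Prod>l'\<in>{..<Suc n} - {l}. x l' ^ k l'))) = ?F1 n * x n ^ k n"
      unfolding sum_distrib_right by (intro sum.cong refl) (simp add: mult_ac)
    moreover have "{..<Suc n} - {n} = {..<n}" by auto
    ultimately show ?thesis by (simp add: mult_ac)
  qed
  ultimately show ?case by (simp add: power_add mult_ac)
qed

section \<open>Monomials in the S_l and their cavity versions\<close>

definition Fm :: "nat \<Rightarrow> (nat \<Rightarrow> real) \<Rightarrow> nat \<Rightarrow> (nat \<Rightarrow> nat) \<Rightarrow> (nat \<Rightarrow> nat \<Rightarrow> real) \<Rightarrow> real" where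
  "Fm N t n k \<rho> = (\<Prod>l<n. Sval t N \<rho> l ^ k l)"

text \<open>S_l without its term at \<open>p\<close>: the zeroth-order part in t_p, independent of
  the spins at this site.\<close>

definition Svm :: "(nat \<Rightarrow> real) \<Rightarrow> nat \<Rightarrow> nat \<Rightarrow> (nat \<Rightarrow> nat \<Rightarrow> real) \<Rightarrow> nat \<Rightarrow> real" where
  "Svm t N p \<rho> l = (\<Sum>i\<in>{..<N} - {p}. t i * (\<rho> (2 * l) i - \<rho> (2 * l + 1) i))"

definition Fc :: "nat \<Rightarrow> (nat \<Rightarrow> real) \<Rightarrow> nat \<Rightarrow> nat \<Rightarrow> (nat \<Rightarrow> nat) \<Rightarrow> (nat \<Rightarrow> nat \<Rightarrow> real) \<Rightarrow> real" where
  "Fc N t p n k \<rho> = (\<Prod>l<n. Svm t N p \<rho> l ^ k l)"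

text \<open>The partial derivative of the monomial in its variable of index \<open>l\<close>, at the
  cavity values. For exponent 0 the prefactor \<open>k l\<close> vanishes, so truncated subtraction
  does no harm.\<close>

definition dFc :: "nat \<Rightarrow> (nat \<Rightarrow> real) \<Rightarrow> nat \<Rightarrow> nat \<Rightarrow> (nat \<Rightarrow> nat) \<Rightarrow> nat \<Rightarrow> (nat \<Rightarrow> nat \<Rightarrow> real) \<Rightarrow> real" where
  "dFc N t p n k l \<rho> = k l * Svm t N p \<rho> l ^ (k l - 1) * (\<Prod>l'\<in>{..<n} - {l}. Svm t N p \<rho> l' ^ k l')"

lemma Sval_split: "p < N \<Longrightarrow> Sval t N \<rho> l = Svm t N p \<rho> l + t p * (\<rho> (2 * l) p - \<rho> (2 * l + 1) p)"
  unfolding Sval_def Svm_def by (simp add: sum.remove[of "{..<N}" p])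

lemma nosite_Svm: "Svm t N p (\<rho>(r := (\<rho> r)(p := x))) l = Svm t N p \<rho> l"
  unfolding Svm_def by (intro sum.cong refl) auto

lemma nosite_Fc: "nosite p (Fc N t p n k)"
  unfolding nosite_def Fc_def nosite_Svm by simp

lemma nosite_dFc: "nosite p (dFc N t p n k l)"
  unfolding nosite_def dFc_def nosite_Svm by simp

lemma nosite_ovm: "nosite p (\<lambda>\<rho>. ovm N p (\<rho> u) (\<rho> v))"
  unfolding nosite_def ovm_def by (intro allI arg_cong[where f="\<lambda>x. x / real N"] sum.cong refl) auto

lemma dFc_0:
  assumes "1 \<le> n" shows "dFc N t p n k 0 \<rho> = k 0 * Fc N t p n (k(0 := k 0 - 1)) \<rho>"
proof -
  have "(\<Prod>l<n. Svm t N p \<rho> l ^ (k(0 := k 0 - 1)) l) = Svm t N p \<rho> 0 ^ (k 0 - 1) * (\<Prod>l\<in>{..<n} - {0}. Svm t N p \<rho> l ^ k l)"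
    using assms by (subst prod.remove[of _ 0]) auto
  then show ?thesis unfolding dFc_def Fc_def by (simp add: mult.assoc)
qed

lemma Fm_dep: "2 * n \<le> m \<Longrightarrow> dep m (Fm N t n k)"
  unfolding dep_def Fm_def Sval_def by (intro allI impI prod.cong refl arg_cong2[where f="(^)"] sum.cong) auto

definition Xd :: "nat \<Rightarrow> nat \<Rightarrow> (nat \<Rightarrow> nat \<Rightarrow> real) \<Rightarrow> real" where
  "Xd N d \<rho> = sqrt N * (ov N (\<rho> 0) (\<rho> d) - ov N (\<rho> 1) (\<rho> d))"

text \<open>Symmetric difference with a singleton: since spins square to one, it describes the product of a spin monomial with
  another spin.\<close>

definition sd :: "nat set \<Rightarrow> nat \<Rightarrow> nat set" where
  "sd B r = (if r \<in> B then B - {r} else insert r B)"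

text \<open>The sum of the five error constants that meet in \<open>cavity_total\<close>:
  second-order remainder, Taylor remainder of the monomial, return of its derivative to the full
  model, and the two replacements inside the bracket.\<close>

definition cav_const :: "nat \<Rightarrow> nat \<Rightarrow> (nat \<Rightarrow> nat) \<Rightarrow> (nat \<Rightarrow> real) \<Rightarrow> real" where
  "cav_const m n k Cf =
    (let j = (\<Sum>l<n. k l); L = 6 ^ n * 18 ^ j; j' = (\<Sum>l<n. (k(0 := k 0 - 1)) l); L' = 6 ^ n * 18 ^ j' in
     8 * cb m * cb (m + 2) * Cf (j + 2) + 2 * L * Cf j
     + (8 * real (k 0) * L' * Cf j' + 8 * real (k 0) * cb m * Cf (j' + 1)) + 2 * L * cb m * Cf (j + 1)
     + 4 * real m * (4 * L * Cf (j + 1) + 2 * Cf j + 4 * cb (m + 1) * Cf (j + 2)))"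

lemma cav_const_nonneg: "(\<And>r. 0 \<le> Cf r) \<Longrightarrow> 0 \<le> cav_const m n k Cf"
  unfolding cav_const_def Let_def
  by (intro add_nonneg_nonneg mult_nonneg_nonneg cb_nonneg) simp_all

section \<open>The expansion at one site\<close>

context
  fixes h :: real and N :: nat and \<beta> q :: real and t :: "nat \<Rightarrow> real" and p K m n :: nat and k :: "nat \<Rightarrow> nat"
    and Cf :: "nat \<Rightarrow> real" and B :: "nat set"
  assumes sk: "sk h N \<beta> q t" and p: "p < N" and n: "1 \<le> n" "2 * n \<le> m" and K: "m + 6 \<le> K"
    and CM: "\<And>r \<theta>. 0 \<le> \<theta> \<Longrightarrow> \<theta> \<le> pi / 2 \<Longrightarrow> nu N h (cav_c N \<beta> q p \<theta>) K (\<lambda>\<rho>. Dom N (m + 4) n q t \<rho> ^ r) \<le> Cf r"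
    and B: "B \<subseteq> {2..<m}"
begin

abbreviation "nu0 \<equiv> nu N h (cav_c N \<beta> q p 0) K"
abbreviation "nu1 \<equiv> nu N h (skc N \<beta>) K"
abbreviation "Dm \<equiv> Dom N (m + 4) n q t"
abbreviation "eB A \<rho> \<equiv> \<Prod>r\<in>A. (\<rho> :: nat \<Rightarrow> nat \<Rightarrow> real) r p"
abbreviation "mu \<equiv> mom h (\<beta> * sqrt q)"
text \<open>The decoupled average of 1 minus the product of the spins of the first pair, multiplied
  by i spins of other replicas; see \<open>pair_sq\<close>.\<close>

abbreviation "ee i \<equiv> mu i - mu (i + 2)"
abbreviation "jj \<equiv> \<Sum>l<n. k l"
text \<open>The error allowed at one site. Its sums against |t_p| and against 1/sqrt N are both of
  the order of max |t_i|; see \<open>error_sums\<close>.\<close>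

abbreviation "Er \<equiv> (t p)\<^sup>2 + \<bar>t p\<bar> / sqrt N + 1 / N"
abbreviation "Lam \<equiv> 6 ^ n * 18 ^ jj :: real"

lemmas parameter_facts = sk_facts[OF sk p]

lemma N_ge_1: "1 \<le> N" "1 \<le> sqrt N" using parameter_facts by auto

lemma coeff_abs_le_1: "\<bar>t p\<bar> \<le> 1"
proof -
  have "(t p)\<^sup>2 \<le> (\<Sum>i<N. (t i)\<^sup>2)" by (rule member_le_sum) (use p in auto)
  then have "(t p)\<^sup>2 \<le> 1" using sk by (simp add: sk_def)
  then show ?thesis by (simp add: abs_square_le_1)
qed

lemma Dm_ge_1: "1 \<le> Dm \<rho>" by (rule Dom_ge1)

lemma Dm_power_nonneg: "0 \<le> Dm \<rho> ^ r" using Dm_ge_1[of \<rho>] by simp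

lemma Dm_moment: "nu0 (\<lambda>\<rho>. Dm \<rho> ^ r) \<le> Cf r" by (rule CM) auto

lemma moment_const_nonneg: "0 \<le> Cf r" by (rule order_trans[OF nu_nonneg[OF Dm_power_nonneg] Dm_moment])

lemma Er_bounds: "(t p)\<^sup>2 \<le> Er" "\<bar>t p\<bar> / sqrt N \<le> Er" "1 / N \<le> Er" "0 \<le> Er"
  by auto

lemma nu0_le:
  assumes "0 \<le> A" "\<And>\<rho>. \<rho> \<in> reps N K \<Longrightarrow> \<bar>f \<rho>\<bar> \<le> A * Dm \<rho> ^ r"
  shows "\<bar>nu0 f\<bar> \<le> A * Cf r"
proof -
  have "\<bar>nu0 f\<bar> \<le> nu0 (\<lambda>\<rho>. A * Dm \<rho> ^ r)" by (rule nu_abs_le) (rule assms(2))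
  also have "\<dots> \<le> A * Cf r" unfolding nu_cmult by (rule mult_left_mono[OF Dm_moment assms(1)])
  finally show ?thesis .
qed

lemma decoupled_monomial: 
  assumes "nosite p G" "A \<subseteq> {..<K}"
  shows "nu0 (\<lambda>\<rho>. eB A \<rho> * G \<rho>) = mu (card A) * nu0 G"
proof -
  have "nu0 (\<lambda>\<rho>. eB A \<rho> * G \<rho>) = mom h (cav_c N \<beta> q p 0 (p, p)) (card A) * nu0 G"
    by (rule nu_decoupled[OF p _ assms]) (auto simp: cav_c_def)
  then show ?thesis by (simp add: cav_c_def)
qed

lemma eps_sq: "\<rho> \<in> reps N K \<Longrightarrow> r < K \<Longrightarrow> \<rho> r p * \<rho> r p = 1"
  by (rule configs_sq[OF reps_configs p])

lemma eps_abs: "\<rho> \<in> reps N K \<Longrightarrow> r < K \<Longrightarrow> \<bar>\<rho> r p\<bar> = 1"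
  using configs_spin[OF reps_configs p, of \<rho> K r] by auto

lemma eB_abs: "\<rho> \<in> reps N K \<Longrightarrow> A \<subseteq> {..<K} \<Longrightarrow> \<bar>eB A \<rho>\<bar> = 1"
  unfolding abs_prod using eps_abs by (intro prod.neutral) auto

lemma eB_sd:
  assumes "\<rho> \<in> reps N K" "finite A" "r < K" shows "eB A \<rho> * \<rho> r p = eB (sd A r) \<rho>"
proof (cases "r \<in> A")
  case True
  have "eB A \<rho> = \<rho> r p * eB (A - {r}) \<rho>" using prod.remove[OF assms(2) True, of "\<lambda>r. \<rho> r p"] .
  then show ?thesis using eps_sq[OF assms(1,3)] True by (simp add: sd_def mult_ac)
qed (use assms in \<open>simp add: sd_def mult_ac\<close>)

lemma subset_facts: "A \<subseteq> {2..<K} \<Longrightarrow> finite A" "A \<subseteq> {2..<K} \<Longrightarrow> A \<subseteq> {..<K}" "A \<subseteq> {2..<K} \<Longrightarrow> 0 \<notin> A \<and> 1 \<notin> A"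
  using finite_subset by auto

lemma sd_sub: "A \<subseteq> {2..<K} \<Longrightarrow> 2 \<le> r \<Longrightarrow> r < K \<Longrightarrow> sd A r \<subseteq> {2..<K}"
  by (auto simp: sd_def)

lemma K_large: "2 < K" "0 < K" "1 < K" "m + 4 \<le> K" using K by auto

text \<open>The two spin monomials involve equally many replicas, hence have the same decoupled
  average. This cancellation removes almost every term of the expansion.\<close>

lemma pair_zero:
  assumes "nosite p G" "A \<subseteq> {2..<K}"
  shows "nu0 (\<lambda>\<rho>. (\<rho> 0 p - \<rho> 1 p) * eB A \<rho> * G \<rho>) = 0"
proof -
  note f = subset_facts[OF assms(2)]
  have "nu0 (\<lambda>\<rho>. (\<rho> 0 p - \<rho> 1 p) * eB A \<rho> * G \<rho>) = nu0 (\<lambda>\<rho>. eB (insert 0 A) \<rho> * G \<rho> - eB (insert 1 A) \<rho> * G \<rho>)"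
    using f by (simp add: algebra_simps)
  also have "\<dots> = 0"
    unfolding nu_diff using f K_large by (subst (1 2) decoupled_monomial[OF assms(1)]) auto
  finally show ?thesis .
qed

lemma pair_sq:
  assumes "nosite p G" "A \<subseteq> {2..<K}"
  shows "nu0 (\<lambda>\<rho>. (1 - \<rho> 0 p * \<rho> 1 p) * eB A \<rho> * G \<rho>) = ee (card A) * nu0 G"
proof -
  note f = subset_facts[OF assms(2)]
  have "nu0 (\<lambda>\<rho>. (1 - \<rho> 0 p * \<rho> 1 p) * eB A \<rho> * G \<rho>) = nu0 (\<lambda>\<rho>. eB A \<rho> * G \<rho> - eB (insert 0 (insert 1 A)) \<rho> * G \<rho>)"
    using f by (simp add: algebra_simps)
  also have "\<dots> = ee (card A) * nu0 G"
    unfolding nu_diff using f K_large by (subst (1 2) decoupled_monomial[OF assms(1)]) (auto simp: left_diff_distrib)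
  finally show ?thesis .
qed

lemma Bsub: "B \<subseteq> {2..<K}" using B K by auto

text \<open>Only a bond from replica 0 or 1 to another replica survives: it turns the difference of
  the pair into plus or minus 1 minus their product. The bond between 0 and 1, and bonds avoiding
  both, leave a difference that vanishes by \<open>pair_zero\<close>.\<close>

lemma bond_term:
  assumes G: "nosite p G" and uv: "u < v" "v < K"
  shows "nu0 (\<lambda>\<rho>. (\<rho> 0 p - \<rho> 1 p) * eB B \<rho> * (\<rho> u p * \<rho> v p) * G \<rho>)
    = (if u = 0 \<and> 2 \<le> v then ee (card (sd B v)) * nu0 G
       else if u = 1 then - ee (card (sd B v)) * nu0 G else 0)"
proof -
  note f = subset_facts[OF Bsub]
  consider "u = 0" "v = 1" | "u = 0" "2 \<le> v" | "u = 1" "2 \<le> v" | "2 \<le> u" using uv by linarith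
  then show ?thesis
  proof cases
    case 1
    have "nu0 (\<lambda>\<rho>. (\<rho> 0 p - \<rho> 1 p) * eB B \<rho> * (\<rho> u p * \<rho> v p) * G \<rho>) = nu0 (\<lambda>\<rho>. - ((\<rho> 0 p - \<rho> 1 p) * eB B \<rho> * G \<rho>))"
    proof (rule nu_cong)
      fix \<rho> assume \<rho>: "\<rho> \<in> reps N K"
      have "(\<rho> 0 p - \<rho> 1 p) * (\<rho> 0 p * \<rho> 1 p) = (\<rho> 0 p * \<rho> 0 p) * \<rho> 1 p - \<rho> 0 p * (\<rho> 1 p * \<rho> 1 p)" by (simp add: algebra_simps)
      also have "\<dots> = - (\<rho> 0 p - \<rho> 1 p)" using eps_sq[OF \<rho>] K_large by simp
      finally show "(\<rho> 0 p - \<rho> 1 p) * eB B \<rho> * (\<rho> u p * \<rho> v p) * G \<rho> = - ((\<rho> 0 p - \<rho> 1 p) * eB B \<rho> * G \<rho>)"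
        unfolding 1 by (simp only: mult_ac minus_mult_left) 
    qed
    then show ?thesis using 1 pair_zero[OF G Bsub] by (simp add: nu_uminus)
  next
    case 2
    have "nu0 (\<lambda>\<rho>. (\<rho> 0 p - \<rho> 1 p) * eB B \<rho> * (\<rho> u p * \<rho> v p) * G \<rho>) = nu0 (\<lambda>\<rho>. (1 - \<rho> 0 p * \<rho> 1 p) * eB (sd B v) \<rho> * G \<rho>)"
    proof (rule nu_cong)
      fix \<rho> assume \<rho>: "\<rho> \<in> reps N K"
      have "(\<rho> 0 p - \<rho> 1 p) * \<rho> 0 p = 1 - \<rho> 0 p * \<rho> 1 p" using eps_sq[OF \<rho>, of 0] K_large by (simp add: algebra_simps)
      then show "(\<rho> 0 p - \<rho> 1 p) * eB B \<rho> * (\<rho> u p * \<rho> v p) * G \<rho> = (1 - \<rho> 0 p * \<rho> 1 p) * eB (sd B v) \<rho> * G \<rho>"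
        unfolding eB_sd[OF \<rho> f(1) uv(2), symmetric] 2 by (metis mult.assoc mult.commute)
    qed
    then show ?thesis using 2 pair_sq[OF G sd_sub[OF Bsub _ uv(2)]] by simp
  next
    case 3
    have "nu0 (\<lambda>\<rho>. (\<rho> 0 p - \<rho> 1 p) * eB B \<rho> * (\<rho> u p * \<rho> v p) * G \<rho>) = nu0 (\<lambda>\<rho>. - ((1 - \<rho> 0 p * \<rho> 1 p) * eB (sd B v) \<rho> * G \<rho>))"
    proof (rule nu_cong)
      fix \<rho> assume \<rho>: "\<rho> \<in> reps N K"
      have e: "(\<rho> 0 p - \<rho> 1 p) * \<rho> 1 p = - (1 - \<rho> 0 p * \<rho> 1 p)" using eps_sq[OF \<rho>, of 1] K_large by (simp add: algebra_simps)
      have "(\<rho> 0 p - \<rho> 1 p) * eB B \<rho> * (\<rho> u p * \<rho> v p) * G \<rho> = ((\<rho> 0 p - \<rho> 1 p) * \<rho> 1 p) * (eB B \<rho> * \<rho> v p) * G \<rho>"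
        unfolding 3 by (simp only: mult_ac)
      then show "(\<rho> 0 p - \<rho> 1 p) * eB B \<rho> * (\<rho> u p * \<rho> v p) * G \<rho> = - ((1 - \<rho> 0 p * \<rho> 1 p) * eB (sd B v) \<rho> * G \<rho>)"
        unfolding eB_sd[OF \<rho> f(1) uv(2)] e by (simp only: minus_mult_left)
    qed
    then have "nu0 (\<lambda>\<rho>. (\<rho> 0 p - \<rho> 1 p) * eB B \<rho> * (\<rho> u p * \<rho> v p) * G \<rho>) = - (ee (card (sd B v)) * nu0 G)"
      by (simp only: nu_uminus pair_sq[OF G sd_sub[OF Bsub 3(2) uv(2)]])
    moreover have "(if u = 0 \<and> 2 \<le> v then ee (card (sd B v)) * nu0 G
       else if u = 1 then - ee (card (sd B v)) * nu0 G else 0) = - (ee (card (sd B v)) * nu0 G)"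
      using 3 by (simp add: left_diff_distrib)
    ultimately show ?thesis by (simp only:)
  next
    case 4
    have s: "sd B u \<subseteq> {2..<K}" using 4 uv by (intro sd_sub[OF Bsub]) auto
    have "nu0 (\<lambda>\<rho>. (\<rho> 0 p - \<rho> 1 p) * eB B \<rho> * (\<rho> u p * \<rho> v p) * G \<rho>) = nu0 (\<lambda>\<rho>. (\<rho> 0 p - \<rho> 1 p) * eB (sd (sd B u) v) \<rho> * G \<rho>)"
    proof (rule nu_cong)
      fix \<rho> assume \<rho>: "\<rho> \<in> reps N K"
      have "eB (sd (sd B u) v) \<rho> = eB B \<rho> * \<rho> u p * \<rho> v p"
        using eB_sd[OF \<rho> f(1), of u] eB_sd[OF \<rho> subset_facts(1)[OF s] uv(2)] uv by simp
      then show "(\<rho> 0 p - \<rho> 1 p) * eB B \<rho> * (\<rho> u p * \<rho> v p) * G \<rho> = (\<rho> 0 p - \<rho> 1 p) * eB (sd (sd B u) v) \<rho> * G \<rho>"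
        by (simp only: mult_ac)
    qed
    also have "\<dots> = 0" by (rule pair_zero[OF G sd_sub[OF s]]) (use 4 uv in auto)
    finally show ?thesis using 4 by simp
  qed
qed

abbreviation "Yd d \<rho> \<equiv> ovm N p (\<rho> 0) (\<rho> d) - ovm N p (\<rho> 1) (\<rho> d)"

text \<open>For each replica v the bonds from 0 and from 1 have opposite signs, so q cancels and the
  difference of two overlaps remains. The factor 1/2 turns the coefficients 2 and -2m of
  \<open>br\<close> into 1 and -m; the bond between the two fresh replicas contributes 0.\<close>

lemma bracket_value:
  assumes G: "nosite p G"
  shows "1 / 2 * nu0 (\<lambda>\<rho>. (\<rho> 0 p - \<rho> 1 p) * eB B \<rho> * G \<rho> * Phi N \<beta> q p m \<rho>)
    = \<beta>\<^sup>2 * ((\<Sum>d\<in>{2..<m}. ee (card (sd B d)) * nu0 (\<lambda>\<rho>. Yd d \<rho> * G \<rho>))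
       - m * (ee (card B + 1) * nu0 (\<lambda>\<rho>. Yd m \<rho> * G \<rho>)))"
proof -
  define W where "W u v \<rho> = (ovm N p (\<rho> u) (\<rho> v) - q) * G \<rho>" for u v \<rho>
  have W: "nosite p (W u v)" for u v
    using nosite_ovm[of p N u v] G unfolding nosite_def W_def by simp
  define \<tau> where "\<tau> u v = nu0 (\<lambda>\<rho>. (\<rho> 0 p - \<rho> 1 p) * eB B \<rho> * (\<rho> u p * \<rho> v p) * W u v \<rho>)" for u v
  have \<tau>: "\<tau> u v = (if u = 0 \<and> 2 \<le> v then ee (card (sd B v)) * nu0 (W u v) else if u = 1 then - ee (card (sd B v)) * nu0 (W u v) else 0)"
    if "u < v" "v < K" for u v
    unfolding \<tau>_def by (rule bond_term[OF W that])
  have row: "\<tau> 0 v + \<tau> 1 v = ee (card (sd B v)) * nu0 (\<lambda>\<rho>. Yd v \<rho> * G \<rho>)" if "2 \<le> v" "v < K" for v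
  proof -
    have "nu0 (W 0 v) - nu0 (W 1 v) = nu0 (\<lambda>\<rho>. Yd v \<rho> * G \<rho>)"
      unfolding W_def nu_diff[symmetric] by (rule nu_cong) (simp add: algebra_simps)
    moreover have t0: "\<tau> 0 v = ee (card (sd B v)) * nu0 (W 0 v)" and t1: "\<tau> 1 v = - ee (card (sd B v)) * nu0 (W 1 v)"
      using \<tau>[of 0 v] \<tau>[of 1 v] that by simp_all
    have "\<tau> 0 v + \<tau> 1 v = ee (card (sd B v)) * (nu0 (W 0 v) - nu0 (W 1 v))"
      unfolding t0 t1 by (simp only: right_diff_distrib minus_mult_left[symmetric] add_uminus_conv_diff)
    ultimately show ?thesis by (simp only:)
  qed
  have zero: "\<tau> u v = 0" if "2 \<le> u" "u < v" "v < K" for u v using \<tau>[of u v] that by simp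
  have rsum: "(\<Sum>u<v'. \<tau> u v) = \<tau> 0 v + \<tau> 1 v" if "2 \<le> v'" "v' \<le> v" "v < K" for v' v
  proof -
    have "(\<Sum>u<v'. \<tau> u v) = (\<Sum>u\<in>{0, 1}. \<tau> u v)"
      by (rule sum.mono_neutral_right) (use that zero in auto)
    then show ?thesis by simp
  qed
  have "(\<Sum>v<m. \<Sum>u<v. \<tau> u v) = (\<Sum>v\<in>{2..<m}. \<Sum>u<v. \<tau> u v)"
  proof (rule sum.mono_neutral_right)
    show "\<forall>v\<in>{..<m} - {2..<m}. (\<Sum>u<v. \<tau> u v) = 0"
    proof
      fix v assume "v \<in> {..<m} - {2..<m}"
      then have "v = 0 \<or> v = 1" by auto
      then show "(\<Sum>u<v. \<tau> u v) = 0" using \<tau>[of 0 1] K_large by auto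
    qed
  qed auto
  also have "\<dots> = (\<Sum>v\<in>{2..<m}. ee (card (sd B v)) * nu0 (\<lambda>\<rho>. Yd v \<rho> * G \<rho>))"
    by (intro sum.cong refl) (use rsum row K in auto)
  finally have 1: "(\<Sum>v<m. \<Sum>u<v. \<tau> u v) = (\<Sum>v\<in>{2..<m}. ee (card (sd B v)) * nu0 (\<lambda>\<rho>. Yd v \<rho> * G \<rho>))" .
  have m2: "2 \<le> m" using n by simp
  have cs: "card (sd B m) = card B + 1" using B subset_facts(1)[OF Bsub] by (auto simp: sd_def card_insert_if)
  have 2: "(\<Sum>u<m. \<tau> u m) = ee (card B + 1) * nu0 (\<lambda>\<rho>. Yd m \<rho> * G \<rho>)"
    using rsum[OF m2 order_refl] row[OF m2] K cs by simp
  have 3: "\<tau> m (m + 1) = 0" using zero[OF m2, of "m + 1"] K by simp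
  have "nu0 (\<lambda>\<rho>. (\<rho> 0 p - \<rho> 1 p) * eB B \<rho> * G \<rho> * Phi N \<beta> q p m \<rho>)
     = nu0 (\<lambda>\<rho>. \<beta>\<^sup>2 * (2 * (\<Sum>v<m. \<Sum>u<v. (\<rho> 0 p - \<rho> 1 p) * eB B \<rho> * (\<rho> u p * \<rho> v p) * W u v \<rho>)
         - 2 * m * (\<Sum>u<m. (\<rho> 0 p - \<rho> 1 p) * eB B \<rho> * (\<rho> u p * \<rho> m p) * W u m \<rho>)
         + m * (m + 1) * ((\<rho> 0 p - \<rho> 1 p) * eB B \<rho> * (\<rho> m p * \<rho> (m + 1) p) * W m (m + 1) \<rho>)))"
  proof (rule nu_cong)
    fix \<rho> :: "nat \<Rightarrow> nat \<Rightarrow> real"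
    define x where "x = (\<rho> 0 p - \<rho> 1 p) * eB B \<rho>"
    define g where "g u v = \<rho> u p * \<rho> v p * (ovm N p (\<rho> u) (\<rho> v) - q)" for u v
    have e: "x * (\<rho> u p * \<rho> v p) * W u v \<rho> = (x * G \<rho>) * g u v" for u v
      unfolding W_def g_def by (simp only: mult_ac)
    have P: "Phi N \<beta> q p m \<rho> = \<beta>\<^sup>2 * br m g" unfolding Phi_def g_def br_scale[symmetric] ..
    show "(\<rho> 0 p - \<rho> 1 p) * eB B \<rho> * G \<rho> * Phi N \<beta> q p m \<rho>
       = \<beta>\<^sup>2 * (2 * (\<Sum>v<m. \<Sum>u<v. (\<rho> 0 p - \<rho> 1 p) * eB B \<rho> * (\<rho> u p * \<rho> v p) * W u v \<rho>)
         - 2 * m * (\<Sum>u<m. (\<rho> 0 p - \<rho> 1 p) * eB B \<rho> * (\<rho> u p * \<rho> m p) * W u m \<rho>)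
         + m * (m + 1) * ((\<rho> 0 p - \<rho> 1 p) * eB B \<rho> * (\<rho> m p * \<rho> (m + 1) p) * W m (m + 1) \<rho>))"
      unfolding x_def[symmetric] e sum_distrib_left[symmetric] P br_def by (simp add: algebra_simps)
  qed
  also have "\<dots> = \<beta>\<^sup>2 * (2 * (\<Sum>v<m. \<Sum>u<v. \<tau> u v) - 2 * m * (\<Sum>u<m. \<tau> u m) + m * (m + 1) * \<tau> m (m + 1))"
    unfolding nu_cmult nu_add nu_diff nu_sum \<tau>_def ..
  finally show ?thesis unfolding 1 2 3 by simp
qed

lemma Fm_taylor1:
  assumes "\<rho> \<in> reps N K"
  shows "taylor1 (6 ^ n * 18 ^ (\<Sum>l<n. k' l)) \<bar>t p\<bar> (Dm \<rho>) (\<Sum>l<n. k' l) (Fm N t n k' \<rho>) (Fc N t p n k' \<rho>)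
    (\<Sum>l<n. t p * (\<rho> (2 * l) p - \<rho> (2 * l + 1) p) * dFc N t p n k' l \<rho>)"
proof -
  have y: "\<bar>t p * (\<rho> (2 * l) p - \<rho> (2 * l + 1) p)\<bar> \<le> 2 * \<bar>t p\<bar>" if "l < n" for l
  proof -
    have "\<bar>\<rho> (2 * l) p - \<rho> (2 * l + 1) p\<bar> \<le> 2"
      using eps_abs[OF assms, of "2 * l"] eps_abs[OF assms, of "2 * l + 1"] that n K by linarith
    then have "\<bar>t p\<bar> * \<bar>\<rho> (2 * l) p - \<rho> (2 * l + 1) p\<bar> \<le> \<bar>t p\<bar> * 2" by (intro mult_left_mono) auto
    then show ?thesis by (simp add: abs_mult)
  qed
  \<comment> \<open>Deleting the site changes S_l by at most 2 |t_p|, which is at most 2 and so at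
    most twice \<open>Dm\<close>.\<close>
  have x: "\<bar>Svm t N p \<rho> l\<bar> \<le> 3 * Dm \<rho>" if "l < n" for l
    using Dom_S[OF that, of t N \<rho> "m + 4" q] y[OF that] coeff_abs_le_1 Dm_ge_1[of \<rho>] Sval_split[OF p, of t \<rho> l] by linarith
  show ?thesis
    using taylor1_prod[of n "Svm t N p \<rho>" "Dm \<rho>" "\<lambda>l. t p * (\<rho> (2 * l) p - \<rho> (2 * l + 1) p)" "\<bar>t p\<bar>" k', OF x y abs_ge_zero coeff_abs_le_1 Dm_ge_1]
    unfolding Fm_def Fc_def dFc_def Sval_split[OF p] .
qed

lemma Fm_bound: "\<bar>Fm N t n k' \<rho>\<bar> \<le> Dm \<rho> ^ (\<Sum>l<n. k' l)"
proof -
  have "\<bar>Fm N t n k' \<rho>\<bar> = (\<Prod>l<n. \<bar>Sval t N \<rho> l\<bar> ^ k' l)" unfolding Fm_def abs_prod power_abs ..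
  also have "\<dots> \<le> (\<Prod>l<n. Dm \<rho> ^ k' l)" by (intro prod_mono conjI power_mono Dom_S) auto
  also have "\<dots> = Dm \<rho> ^ (\<Sum>l<n. k' l)" by (simp add: power_sum)
  finally show ?thesis .
qed

lemma Fc_diff:
  assumes "\<rho> \<in> reps N K"
  shows "\<bar>Fm N t n k' \<rho> - Fc N t p n k' \<rho>\<bar> \<le> 2 * (6 ^ n * 18 ^ (\<Sum>l<n. k' l)) * \<bar>t p\<bar> * Dm \<rho> ^ (\<Sum>l<n. k' l)"
proof -
  let ?L = "6 ^ n * 18 ^ (\<Sum>l<n. k' l) :: real" and ?D = "Dm \<rho> ^ (\<Sum>l<n. k' l)"
  have "\<bar>t p\<bar>\<^sup>2 \<le> \<bar>t p\<bar>" unfolding power2_eq_square by (rule mult_left_le[OF coeff_abs_le_1]) simp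
  then have "?L * \<bar>t p\<bar>\<^sup>2 * ?D \<le> ?L * \<bar>t p\<bar> * ?D" by (intro mult_right_mono mult_left_mono Dm_power_nonneg) auto
  then show ?thesis using Fm_taylor1[OF assms, of k'] unfolding taylor1_def by linarith
qed

abbreviation "dF \<rho> \<equiv> k 0 * Fm N t n (k(0 := k 0 - 1)) \<rho>"
abbreviation "j' \<equiv> \<Sum>l<n. (k(0 := k 0 - 1)) l"
abbreviation "Lam' \<equiv> 6 ^ n * 18 ^ j' :: real"
abbreviation "ff \<rho> \<equiv> (\<rho> 0 p - \<rho> 1 p) * eB B \<rho> * Fm N t n k \<rho>"

lemma pair_abs: "\<rho> \<in> reps N K \<Longrightarrow> \<bar>(\<rho> 0 p - \<rho> 1 p) * eB B \<rho> * x\<bar> \<le> 2 * \<bar>x\<bar>"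
proof -
  assume \<rho>: "\<rho> \<in> reps N K"
  have "\<bar>\<rho> 0 p - \<rho> 1 p\<bar> \<le> 2" using eps_abs[OF \<rho>, of 0] eps_abs[OF \<rho>, of 1] K_large by linarith
  then have "\<bar>\<rho> 0 p - \<rho> 1 p\<bar> * \<bar>x\<bar> \<le> 2 * \<bar>x\<bar>" by (rule mult_right_mono) simp
  then show ?thesis using eB_abs[OF \<rho> subset_facts(2)[OF Bsub]] by (simp add: abs_mult)
qed

lemma ff_bound: "\<rho> \<in> reps N K \<Longrightarrow> \<bar>ff \<rho>\<bar> \<le> 2 * Dm \<rho> ^ jj"
  using pair_abs[of \<rho> "Fm N t n k \<rho>"] Fm_bound[of k \<rho>] by linarith

lemma ff_dep: "dep m ff"
  unfolding dep_def
proof (intro allI impI)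
  fix \<rho> \<rho>' :: "nat \<Rightarrow> nat \<Rightarrow> real" assume eq: "\<forall>r<m. \<rho> r = \<rho>' r"
  have "eB B \<rho> = eB B \<rho>'" by (intro prod.cong refl) (use eq B in auto)
  moreover have "Fm N t n k \<rho> = Fm N t n k \<rho>'" using Fm_dep[OF n(2)] eq unfolding dep_def by blast
  ultimately show "ff \<rho> = ff \<rho>'" using eq n by simp
qed

lemma cavity_second_order: "\<bar>nu1 ff - nu0 ff - 1 / 2 * nu0 (\<lambda>\<rho>. ff \<rho> * Phi N \<beta> q p m \<rho>)\<bar> \<le> (8 * cb m * cb (m + 2) * Cf (jj + 2)) * Er"
proof -
  have "\<bar>nu1 ff - nu0 ff - 1 / 2 * nu0 (\<lambda>\<rho>. ff \<rho> * Phi N \<beta> q p m \<rho>)\<bar> \<le> 4 * (2 * cb m * cb (m + 2) * Cf (jj + 2) / N)"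
    by (rule cav_expansion[OF sk p ff_dep order_refl _ _ ff_bound CM]) (use K in auto)
  also have "\<dots> = (8 * cb m * cb (m + 2) * Cf (jj + 2)) * (1 / N)" by simp
  also have "\<dots> \<le> (8 * cb m * cb (m + 2) * Cf (jj + 2)) * Er"
    by (intro mult_left_mono Er_bounds mult_nonneg_nonneg cb_nonneg moment_const_nonneg) simp
  finally show ?thesis .
qed

text \<open>The order-zero term has no further spin at \<open>p\<close> from the monomial and
  vanishes by \<open>pair_zero\<close>. In first order the pairs with l at least 1 vanish for the
  same reason; for l = 0 the squared difference of the spins is 2 (1 - their product), the origin of
  the factor 2.\<close>

lemma decoupled_value: "\<bar>nu0 ff - 2 * t p * ee (card B) * nu0 (dFc N t p n k 0)\<bar> \<le> (2 * Lam * Cf jj) * Er"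
proof -
  let ?F1 = "\<lambda>\<rho>. \<Sum>l<n. t p * (\<rho> (2 * l) p - \<rho> (2 * l + 1) p) * dFc N t p n k l \<rho>"
  let ?e = "\<lambda>\<rho>. (\<rho> 0 p - \<rho> 1 p) * eB B \<rho>"
  let ?w = "\<lambda>l. nu0 (\<lambda>\<rho>. ?e \<rho> * (\<rho> (2 * l) p - \<rho> (2 * l + 1) p) * dFc N t p n k l \<rho>)"
  have w: "?w l = 0" if "1 \<le> l" "l < n" for l
  proof -
    have l: "2 \<le> 2 * l" "2 * l < K" "2 \<le> 2 * l + 1" "2 * l + 1 < K" using that n K by auto
    have "?w l = nu0 (\<lambda>\<rho>. (\<rho> 0 p - \<rho> 1 p) * eB (sd B (2 * l)) \<rho> * dFc N t p n k l \<rho>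
        - (\<rho> 0 p - \<rho> 1 p) * eB (sd B (2 * l + 1)) \<rho> * dFc N t p n k l \<rho>)"
    proof (rule nu_cong)
      fix \<rho> assume \<rho>: "\<rho> \<in> reps N K"
      show "?e \<rho> * (\<rho> (2 * l) p - \<rho> (2 * l + 1) p) * dFc N t p n k l \<rho> =
        (\<rho> 0 p - \<rho> 1 p) * eB (sd B (2 * l)) \<rho> * dFc N t p n k l \<rho>
        - (\<rho> 0 p - \<rho> 1 p) * eB (sd B (2 * l + 1)) \<rho> * dFc N t p n k l \<rho>"
        unfolding eB_sd[OF \<rho> subset_facts(1)[OF Bsub] l(2), symmetric] eB_sd[OF \<rho> subset_facts(1)[OF Bsub] l(4), symmetric]
        by (simp add: algebra_simps)
    qed
    also have "\<dots> = 0"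
      unfolding nu_diff pair_zero[OF nosite_dFc sd_sub[OF Bsub l(1,2)]] pair_zero[OF nosite_dFc sd_sub[OF Bsub l(3,4)]] by simp
    finally show ?thesis .
  qed
  have w0: "?w 0 = 2 * (ee (card B) * nu0 (dFc N t p n k 0))"
  proof -
    have "?w 0 = nu0 (\<lambda>\<rho>. 2 * ((1 - \<rho> 0 p * \<rho> 1 p) * eB B \<rho> * dFc N t p n k 0 \<rho>))"
    proof (rule nu_cong)
      fix \<rho> assume \<rho>: "\<rho> \<in> reps N K"
      have "(\<rho> 0 p - \<rho> 1 p) * (\<rho> 0 p - \<rho> 1 p) = \<rho> 0 p * \<rho> 0 p + \<rho> 1 p * \<rho> 1 p - 2 * (\<rho> 0 p * \<rho> 1 p)"
        by (simp add: algebra_simps)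
      then have "(\<rho> 0 p - \<rho> 1 p) * (\<rho> 0 p - \<rho> 1 p) = 2 * (1 - \<rho> 0 p * \<rho> 1 p)"
        using eps_sq[OF \<rho>] K_large by simp
      moreover have "?e \<rho> * (\<rho> (2 * 0) p - \<rho> (2 * 0 + 1) p) * dFc N t p n k 0 \<rho> = (\<rho> 0 p - \<rho> 1 p) * (\<rho> 0 p - \<rho> 1 p) * eB B \<rho> * dFc N t p n k 0 \<rho>"
        by (simp add: mult_ac)
      ultimately show "?e \<rho> * (\<rho> (2 * 0) p - \<rho> (2 * 0 + 1) p) * dFc N t p n k 0 \<rho> = 2 * ((1 - \<rho> 0 p * \<rho> 1 p) * eB B \<rho> * dFc N t p n k 0 \<rho>)"
        by (simp only: mult.assoc)
    qed
    then show ?thesis unfolding nu_cmult pair_sq[OF nosite_dFc Bsub] .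
  qed
  have "nu0 (\<lambda>\<rho>. ?e \<rho> * ?F1 \<rho>) = nu0 (\<lambda>\<rho>. \<Sum>l<n. t p * (?e \<rho> * (\<rho> (2 * l) p - \<rho> (2 * l + 1) p) * dFc N t p n k l \<rho>))"
    by (rule nu_cong) (simp only: sum_distrib_left mult_ac)
  also have "\<dots> = (\<Sum>l<n. t p * ?w l)" unfolding nu_sum nu_cmult ..
  also have "\<dots> = (\<Sum>l\<in>{0}. t p * ?w l)"
    by (rule sum.mono_neutral_right) (use n w in auto)
  finally have A: "nu0 (\<lambda>\<rho>. ?e \<rho> * ?F1 \<rho>) = 2 * t p * ee (card B) * nu0 (dFc N t p n k 0)"
    using w0 by simp
  have eq: "nu0 ff - 2 * t p * ee (card B) * nu0 (dFc N t p n k 0) = nu0 (\<lambda>\<rho>. ?e \<rho> * (Fm N t n k \<rho> - Fc N t p n k \<rho> - ?F1 \<rho>))"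
  proof -
    have "nu0 ff - 2 * t p * ee (card B) * nu0 (dFc N t p n k 0) = nu0 ff - nu0 (\<lambda>\<rho>. ?e \<rho> * Fc N t p n k \<rho>) - nu0 (\<lambda>\<rho>. ?e \<rho> * ?F1 \<rho>)"
      unfolding A pair_zero[OF nosite_Fc Bsub] by simp
    also have "\<dots> = nu0 (\<lambda>\<rho>. ff \<rho> - ?e \<rho> * Fc N t p n k \<rho> - ?e \<rho> * ?F1 \<rho>)"
      by (simp only: nu_diff)
    also have "\<dots> = nu0 (\<lambda>\<rho>. ?e \<rho> * (Fm N t n k \<rho> - Fc N t p n k \<rho> - ?F1 \<rho>))"
      by (rule nu_cong) (simp only: right_diff_distrib)
    finally show ?thesis .
  qed
  have "\<bar>nu0 (\<lambda>\<rho>. ?e \<rho> * (Fm N t n k \<rho> - Fc N t p n k \<rho> - ?F1 \<rho>))\<bar> \<le> (2 * Lam * (t p)\<^sup>2) * Cf jj"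
  proof (rule nu0_le)
    fix \<rho> assume \<rho>: "\<rho> \<in> reps N K"
    have "\<bar>Fm N t n k \<rho> - Fc N t p n k \<rho> - ?F1 \<rho>\<bar> \<le> Lam * \<bar>t p\<bar>\<^sup>2 * Dm \<rho> ^ jj"
      using Fm_taylor1[OF \<rho>, of k] unfolding taylor1_def by blast
    then show "\<bar>?e \<rho> * (Fm N t n k \<rho> - Fc N t p n k \<rho> - ?F1 \<rho>)\<bar> \<le> 2 * Lam * (t p)\<^sup>2 * Dm \<rho> ^ jj"
      using pair_abs[OF \<rho>, of "Fm N t n k \<rho> - Fc N t p n k \<rho> - ?F1 \<rho>"] by (simp add: power2_abs)
  qed simp
  also have "\<dots> = (2 * Lam * Cf jj) * (t p)\<^sup>2" by simp
  also have "\<dots> \<le> (2 * Lam * Cf jj) * Er"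
    by (intro mult_left_mono Er_bounds mult_nonneg_nonneg moment_const_nonneg) auto
  finally show ?thesis unfolding eq .
qed

lemma ee_abs: "\<bar>ee i\<bar> \<le> 2"
  using mom_abs_le[of h "\<beta> * sqrt q" i] mom_abs_le[of h "\<beta> * sqrt q" "i + 2"] by linarith

text \<open>Restoring the site in the monomial costs |t_p| and returning to the full model costs
  1/sqrt N. The prefactor t_p already present makes both admissible errors.\<close>

lemma decoupled_derivative: "\<bar>2 * t p * ee (card B) * nu0 (dFc N t p n k 0) - 2 * t p * ee (card B) * nu1 dF\<bar>
    \<le> (8 * real (k 0) * Lam' * Cf j' + 8 * real (k 0) * cb m * Cf (j' + 1)) * Er"
proof -
  have k0: "0 \<le> real (k 0)" by simp
  have bd: "\<bar>dF \<rho>\<bar> \<le> k 0 * Dm \<rho> ^ j'" for \<rho>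
    unfolding abs_mult using Fm_bound[of "k(0 := k 0 - 1)" \<rho>] by (simp add: mult_left_mono)
  have dep: "dep m dF" using Fm_dep[OF n(2), of N t "k(0 := k 0 - 1)"] unfolding dep_def by metis
  have 1: "\<bar>nu1 dF - nu0 dF\<bar> \<le> 2 * (k 0 * cb m * Cf (j' + 1) / sqrt N)"
  proof -
    have "\<bar>nu N h (cav_c N \<beta> q p (pi / 2)) K dF - nu0 dF\<bar> \<le> 2 * (k 0 * cb m * Cf (j' + 1) / sqrt N)"
    proof (rule cav_increment[OF sk p dep _ K_large(4) k0, where n=n and r=j'])
      show "\<bar>dF \<rho>\<bar> \<le> k 0 * Dm \<rho> ^ j'" for \<rho> by (rule bd)
      show "nu N h (cav_c N \<beta> q p \<theta>) K (\<lambda>\<rho>. Dm \<rho> ^ (j' + 1)) \<le> Cf (j' + 1)" if "0 \<le> \<theta>" "\<theta> \<le> pi / 2" for \<theta>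
        by (rule CM[OF that])
    qed simp_all
    then show ?thesis unfolding cav_c_end .
  qed
  have "\<bar>nu0 (dFc N t p n k 0) - nu0 dF\<bar> \<le> (2 * real (k 0) * Lam' * \<bar>t p\<bar>) * Cf j'"
    unfolding nu_diff[symmetric]
  proof (rule nu0_le)
    fix \<rho> assume \<rho>: "\<rho> \<in> reps N K"
    have "\<bar>dFc N t p n k 0 \<rho> - dF \<rho>\<bar> = k 0 * \<bar>Fm N t n (k(0 := k 0 - 1)) \<rho> - Fc N t p n (k(0 := k 0 - 1)) \<rho>\<bar>"
      unfolding dFc_0[OF n(1)] right_diff_distrib[symmetric] abs_mult by (simp add: abs_minus_commute)
    also have "\<dots> \<le> k 0 * (2 * Lam' * \<bar>t p\<bar> * Dm \<rho> ^ j')"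
      by (rule mult_left_mono[OF Fc_diff[OF \<rho>]]) simp
    finally show "\<bar>dFc N t p n k 0 \<rho> - dF \<rho>\<bar> \<le> 2 * real (k 0) * Lam' * \<bar>t p\<bar> * Dm \<rho> ^ j'" by (simp only: mult_ac)
  qed simp
  then have d: "\<bar>nu0 (dFc N t p n k 0) - nu1 dF\<bar> \<le> 2 * real (k 0) * Lam' * \<bar>t p\<bar> * Cf j' + 2 * (k 0 * cb m * Cf (j' + 1) / sqrt N)"
    using 1 by linarith
  have "\<bar>2 * t p * ee (card B) * nu0 (dFc N t p n k 0) - 2 * t p * ee (card B) * nu1 dF\<bar>
     = \<bar>ee (card B)\<bar> * (2 * \<bar>t p\<bar> * \<bar>nu0 (dFc N t p n k 0) - nu1 dF\<bar>)"
    unfolding right_diff_distrib[symmetric] by (simp add: abs_mult)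
  also have "\<dots> \<le> 2 * (2 * \<bar>t p\<bar> * (2 * real (k 0) * Lam' * \<bar>t p\<bar> * Cf j' + 2 * (k 0 * cb m * Cf (j' + 1) / sqrt N)))"
    by (intro mult_mono ee_abs mult_left_mono d) auto
  also have "\<dots> = (8 * real (k 0) * Lam' * Cf j') * (\<bar>t p\<bar> * \<bar>t p\<bar>) + (8 * real (k 0) * cb m * Cf (j' + 1)) * (\<bar>t p\<bar> / sqrt N)"
    by (simp add: algebra_simps)
  also have "\<dots> \<le> (8 * real (k 0) * Lam' * Cf j') * Er + (8 * real (k 0) * cb m * Cf (j' + 1)) * Er"
  proof (intro add_mono mult_left_mono)
    show "\<bar>t p\<bar> * \<bar>t p\<bar> \<le> Er" using Er_bounds(1) by (simp add: power2_eq_square)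
  qed (use moment_const_nonneg cb_nonneg Er_bounds in auto)
  finally show ?thesis by (simp only: distrib_right)
qed

text \<open>The difference of the two monomials supplies |t_p| and \<open>Phi\<close> supplies
  1/sqrt N.\<close>

lemma bracket_replace_monomial: "\<bar>1 / 2 * nu0 (\<lambda>\<rho>. ff \<rho> * Phi N \<beta> q p m \<rho>)
    - 1 / 2 * nu0 (\<lambda>\<rho>. (\<rho> 0 p - \<rho> 1 p) * eB B \<rho> * Fc N t p n k \<rho> * Phi N \<beta> q p m \<rho>)\<bar>
    \<le> (2 * Lam * cb m * Cf (jj + 1)) * Er"
proof -
  have "\<bar>nu0 (\<lambda>\<rho>. ff \<rho> * Phi N \<beta> q p m \<rho>) - nu0 (\<lambda>\<rho>. (\<rho> 0 p - \<rho> 1 p) * eB B \<rho> * Fc N t p n k \<rho> * Phi N \<beta> q p m \<rho>)\<bar>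
     \<le> (4 * Lam * \<bar>t p\<bar> * cb m / sqrt N) * Cf (jj + 1)"
    unfolding nu_diff[symmetric]
  proof (rule nu0_le)
    fix \<rho> assume \<rho>: "\<rho> \<in> reps N K"
    let ?d = "Fm N t n k \<rho> - Fc N t p n k \<rho>"
    have eq: "ff \<rho> * Phi N \<beta> q p m \<rho> - (\<rho> 0 p - \<rho> 1 p) * eB B \<rho> * Fc N t p n k \<rho> * Phi N \<beta> q p m \<rho>
      = ((\<rho> 0 p - \<rho> 1 p) * eB B \<rho> * ?d) * Phi N \<beta> q p m \<rho>" by (simp only: right_diff_distrib left_diff_distrib)
    have "\<bar>((\<rho> 0 p - \<rho> 1 p) * eB B \<rho> * ?d) * Phi N \<beta> q p m \<rho>\<bar> \<le> (2 * (2 * Lam * \<bar>t p\<bar> * Dm \<rho> ^ jj)) * (cb m * (Dm \<rho> / sqrt N))"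
      unfolding abs_mult[of "(\<rho> 0 p - \<rho> 1 p) * eB B \<rho> * ?d"]
    proof (rule mult_mono)
      show "\<bar>(\<rho> 0 p - \<rho> 1 p) * eB B \<rho> * ?d\<bar> \<le> 2 * (2 * Lam * \<bar>t p\<bar> * Dm \<rho> ^ jj)"
        by (rule order_trans[OF pair_abs[OF \<rho>] mult_left_mono[OF Fc_diff[OF \<rho>]]]) simp
      show "\<bar>Phi N \<beta> q p m \<rho>\<bar> \<le> cb m * (Dm \<rho> / sqrt N)" by (rule Phi_Dom[OF sk p \<rho> _ K_large(4)]) simp
    qed (use Dm_power_nonneg in auto)
    then show "\<bar>ff \<rho> * Phi N \<beta> q p m \<rho> - (\<rho> 0 p - \<rho> 1 p) * eB B \<rho> * Fc N t p n k \<rho> * Phi N \<beta> q p m \<rho>\<bar>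
      \<le> 4 * Lam * \<bar>t p\<bar> * cb m / sqrt N * Dm \<rho> ^ (jj + 1)"
      unfolding eq by (simp add: mult_ac)
  qed (use cb_nonneg in simp)
  also have "\<dots> = (4 * Lam * cb m * Cf (jj + 1)) * (\<bar>t p\<bar> / sqrt N)" by simp
  also have "\<dots> \<le> (4 * Lam * cb m * Cf (jj + 1)) * Er"
    by (intro mult_left_mono Er_bounds mult_nonneg_nonneg moment_const_nonneg cb_nonneg) auto
  finally have d: "\<bar>nu0 (\<lambda>\<rho>. ff \<rho> * Phi N \<beta> q p m \<rho>) - nu0 (\<lambda>\<rho>. (\<rho> 0 p - \<rho> 1 p) * eB B \<rho> * Fc N t p n k \<rho> * Phi N \<beta> q p m \<rho>)\<bar>
     \<le> (4 * Lam * cb m * Cf (jj + 1)) * Er" .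
  have half: "\<bar>1 / 2 * x - 1 / 2 * y\<bar> \<le> 2 * u * v * w * z" if "\<bar>x - y\<bar> \<le> 4 * u * v * w * z" for x y u v w z :: real
    using that by (simp add: abs_le_iff)
  show ?thesis by (rule half[OF d])
qed

abbreviation "CY \<equiv> 4 * Lam * Cf (jj + 1) + 2 * Cf jj + 4 * cb (m + 1) * Cf (jj + 2)"

text \<open>Three replacements: the cavity monomial by the full one costs |t_p|/sqrt N; restoring
  the site in the overlaps costs 1/N; the passage to the full model costs only 1/N, because the
  overlap difference is itself of order 1/sqrt N.\<close>

lemma cavity_overlap_moment:
  assumes d: "2 \<le> d" "d \<le> m"
  shows "\<bar>nu0 (\<lambda>\<rho>. Yd d \<rho> * Fc N t p n k \<rho>) - 1 / sqrt N * nu1 (\<lambda>\<rho>. Xd N d \<rho> * Fm N t n k \<rho>)\<bar> \<le> CY * Er"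
proof -
  define Z where "Z \<rho> = ov N (\<rho> 0) (\<rho> d) - ov N (\<rho> 1) (\<rho> d)" for \<rho> :: "nat \<Rightarrow> nat \<Rightarrow> real"
  have dK: "d < m + 4" "d < K" using d K by auto
  have Yb: "\<bar>Yd d \<rho>\<bar> \<le> 2 * (Dm \<rho> / sqrt N)" if \<rho>: "\<rho> \<in> reps N K" for \<rho>
    using ovm_Dom[OF sk p \<rho> _ dK(1) K_large(4), of 0 n] ovm_Dom[OF sk p \<rho> _ dK(1) K_large(4), of 1 n] d by linarith
  have Zb: "\<bar>Z \<rho>\<bar> \<le> 2 * (Dm \<rho> / sqrt N)" for \<rho>
  proof -
    have "\<bar>ov N (\<rho> u) (\<rho> d) - q\<bar> \<le> Dm \<rho> / sqrt N" if "u < d" for u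
    proof -
      have "sqrt N * \<bar>ov N (\<rho> u) (\<rho> d) - q\<bar> \<le> Dm \<rho>" using Dom_ov[OF that dK(1), of N \<rho> q n t] by linarith
      then show ?thesis using N_ge_1(2) by (simp add: pos_le_divide_eq mult.commute)
    qed
    from this[of 0] this[of 1] show ?thesis using d unfolding Z_def by linarith
  qed
  have YZ: "\<bar>Yd d \<rho> - Z \<rho>\<bar> \<le> 2 / N" if \<rho>: "\<rho> \<in> reps N K" for \<rho>
  proof -
    have "\<bar>\<rho> u p * \<rho> d p / N\<bar> = 1 / N" if "u < K" for u
      using spin_prod_abs[OF \<rho> that dK(2) p] N_ge_1 by (simp add: abs_divide)
    from this[of 0] this[of 1] show ?thesis unfolding Z_def ovm_ov[OF p] using K_large by linarith
  qed
  have 1: "\<bar>nu0 (\<lambda>\<rho>. Yd d \<rho> * Fc N t p n k \<rho>) - nu0 (\<lambda>\<rho>. Yd d \<rho> * Fm N t n k \<rho>)\<bar> \<le> (4 * Lam * \<bar>t p\<bar> / sqrt N) * Cf (jj + 1)"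
    unfolding nu_diff[symmetric]
  proof (rule nu0_le)
    fix \<rho> assume \<rho>: "\<rho> \<in> reps N K"
    have "\<bar>Yd d \<rho> * (Fm N t n k \<rho> - Fc N t p n k \<rho>)\<bar> \<le> 2 * (Dm \<rho> / sqrt N) * (2 * Lam * \<bar>t p\<bar> * Dm \<rho> ^ jj)"
      unfolding abs_mult[of "Yd d \<rho>"] using Dm_ge_1[of \<rho>] by (intro mult_mono Yb[OF \<rho>] Fc_diff[OF \<rho>]) auto
    also have "\<dots> = 4 * Lam * \<bar>t p\<bar> / sqrt N * Dm \<rho> ^ (jj + 1)" by simp
    finally show "\<bar>Yd d \<rho> * Fc N t p n k \<rho> - Yd d \<rho> * Fm N t n k \<rho>\<bar> \<le> 4 * Lam * \<bar>t p\<bar> / sqrt N * Dm \<rho> ^ (jj + 1)"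
      by (simp add: right_diff_distrib abs_minus_commute)
  qed simp
  have 2: "\<bar>nu0 (\<lambda>\<rho>. Yd d \<rho> * Fm N t n k \<rho>) - nu0 (\<lambda>\<rho>. Z \<rho> * Fm N t n k \<rho>)\<bar> \<le> (2 / N) * Cf jj"
    unfolding nu_diff[symmetric] left_diff_distrib[symmetric]
  proof (rule nu0_le)
    fix \<rho> assume \<rho>: "\<rho> \<in> reps N K"
    show "\<bar>(Yd d \<rho> - Z \<rho>) * Fm N t n k \<rho>\<bar> \<le> 2 / N * Dm \<rho> ^ jj"
      unfolding abs_mult[of "Yd d \<rho> - Z \<rho>"] by (intro mult_mono YZ[OF \<rho>] Fm_bound) auto
  qed simp
  have "\<bar>nu N h (cav_c N \<beta> q p (pi / 2)) K (\<lambda>\<rho>. Z \<rho> * Fm N t n k \<rho>) - nu0 (\<lambda>\<rho>. Z \<rho> * Fm N t n k \<rho>)\<bar>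
     \<le> 2 * ((2 / sqrt N) * cb (m + 1) * Cf (jj + 1 + 1) / sqrt N)"
  proof (rule cav_increment[OF sk p _ _ K_large(4), where r="jj + 1" and n=n])
    show "dep (m + 1) (\<lambda>\<rho>. Z \<rho> * Fm N t n k \<rho>)"
      using Fm_dep[of n "m + 1" N t k] n d unfolding dep_def Z_def by simp
    show "\<bar>Z \<rho> * Fm N t n k \<rho>\<bar> \<le> 2 / sqrt N * Dm \<rho> ^ (jj + 1)" for \<rho>
    proof -
      have "\<bar>Z \<rho> * Fm N t n k \<rho>\<bar> \<le> 2 * (Dm \<rho> / sqrt N) * Dm \<rho> ^ jj"
        unfolding abs_mult[of "Z \<rho>"] using Dm_ge_1[of \<rho>] by (intro mult_mono Zb Fm_bound) auto
      then show ?thesis by simp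
    qed
    show "nu N h (cav_c N \<beta> q p \<theta>) K (\<lambda>\<rho>. Dm \<rho> ^ (jj + 1 + 1)) \<le> Cf (jj + 1 + 1)" if "0 \<le> \<theta>" "\<theta> \<le> pi / 2" for \<theta>
      by (rule CM[OF that])
  qed simp_all
  also have "2 * ((2 / sqrt N) * cb (m + 1) * Cf (jj + 1 + 1) / sqrt N) = (4 * cb (m + 1) * Cf (jj + 2)) * (1 / N)"
    using N_ge_1 by (simp add: field_simps)
  finally have 3: "\<bar>nu1 (\<lambda>\<rho>. Z \<rho> * Fm N t n k \<rho>) - nu0 (\<lambda>\<rho>. Z \<rho> * Fm N t n k \<rho>)\<bar> \<le> (4 * cb (m + 1) * Cf (jj + 2)) * (1 / N)"
    unfolding cav_c_end .
  have "1 / sqrt N * nu1 (\<lambda>\<rho>. Xd N d \<rho> * Fm N t n k \<rho>) = nu1 (\<lambda>\<rho>. Z \<rho> * Fm N t n k \<rho>)"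
    unfolding nu_cmult[symmetric] Xd_def Z_def using N_ge_1 by (intro nu_cong) simp
  then have "\<bar>nu0 (\<lambda>\<rho>. Yd d \<rho> * Fc N t p n k \<rho>) - 1 / sqrt N * nu1 (\<lambda>\<rho>. Xd N d \<rho> * Fm N t n k \<rho>)\<bar>
     = \<bar>nu0 (\<lambda>\<rho>. Yd d \<rho> * Fc N t p n k \<rho>) - nu1 (\<lambda>\<rho>. Z \<rho> * Fm N t n k \<rho>)\<bar>" by (simp only:)
  also have "\<dots> \<le> (4 * Lam * \<bar>t p\<bar> / sqrt N) * Cf (jj + 1) + (2 / N) * Cf jj + (4 * cb (m + 1) * Cf (jj + 2)) * (1 / N)"
  proof -
    have "\<bar>x - w\<bar> \<le> u1 + u2 + u3" if "\<bar>x - y\<bar> \<le> u1" "\<bar>y - z\<bar> \<le> u2" "\<bar>w - z\<bar> \<le> u3" for x y z w u1 u2 u3 :: real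
      using that by arith
    from this[OF 1 2 3] show ?thesis .
  qed
  also have "\<dots> = (4 * Lam * Cf (jj + 1)) * (\<bar>t p\<bar> / sqrt N) + (2 * Cf jj) * (1 / N) + (4 * cb (m + 1) * Cf (jj + 2)) * (1 / N)"
    by simp
  also have "\<dots> \<le> (4 * Lam * Cf (jj + 1)) * Er + (2 * Cf jj) * Er + (4 * cb (m + 1) * Cf (jj + 2)) * Er"
    by (intro add_mono mult_left_mono Er_bounds mult_nonneg_nonneg moment_const_nonneg cb_nonneg) auto
  finally show ?thesis by (simp only: distrib_right)
qed

abbreviation "AA d \<equiv> nu1 (\<lambda>\<rho>. Xd N d \<rho> * Fm N t n k \<rho>)"

lemma bracket_value_approx:
  "\<bar>1 / 2 * nu0 (\<lambda>\<rho>. (\<rho> 0 p - \<rho> 1 p) * eB B \<rho> * Fc N t p n k \<rho> * Phi N \<beta> q p m \<rho>)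
    - \<beta>\<^sup>2 / sqrt N * ((\<Sum>d\<in>{2..<m}. ee (card (sd B d)) * AA d) - m * (ee (card B + 1) * AA m))\<bar>
   \<le> (4 * real m * CY) * Er"
proof -
  have CY0: "0 \<le> CY" using moment_const_nonneg cb_nonneg by simp
  let ?y = "\<lambda>d. nu0 (\<lambda>\<rho>. Yd d \<rho> * Fc N t p n k \<rho>)"
  have t: "\<bar>e * (?y d - 1 / sqrt N * AA d)\<bar> \<le> 2 * (CY * Er)" if "\<bar>e\<bar> \<le> 2" "2 \<le> d" "d \<le> m" for d and e :: real
    unfolding abs_mult using that CY0 Er_bounds by (intro mult_mono cavity_overlap_moment) auto
  let ?r = "\<beta>\<^sup>2 * ((\<Sum>d\<in>{2..<m}. ee (card (sd B d)) * (?y d - 1 / sqrt N * AA d)) - m * (ee (card B + 1) * (?y m - 1 / sqrt N * AA m)))"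
  have lin: "x * ((\<Sum>d\<in>S. e d * u d) - M * (e' * u')) - x / s * ((\<Sum>d\<in>S. e d * v d) - M * (e' * v'))
     = x * ((\<Sum>d\<in>S. e d * (u d - 1 / s * v d)) - M * (e' * (u' - 1 / s * v')))"
    for x s M e' u' v' :: real and e u v :: "nat \<Rightarrow> real" and S
  proof -
    have e: "(\<Sum>d\<in>S. e d * (u d - 1 / s * v d)) = (\<Sum>d\<in>S. e d * u d) - 1 / s * (\<Sum>d\<in>S. e d * v d)"
      unfolding sum_distrib_left sum_subtractf[symmetric] by (intro sum.cong refl) (simp add: algebra_simps)
    show ?thesis unfolding e by (simp add: algebra_simps)
  qed
  have eq: "1 / 2 * nu0 (\<lambda>\<rho>. (\<rho> 0 p - \<rho> 1 p) * eB B \<rho> * Fc N t p n k \<rho> * Phi N \<beta> q p m \<rho>)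
    - \<beta>\<^sup>2 / sqrt N * ((\<Sum>d\<in>{2..<m}. ee (card (sd B d)) * AA d) - m * (ee (card B + 1) * AA m)) = ?r"
    unfolding bracket_value[OF nosite_Fc] by (rule lin)
  have "\<bar>?r\<bar> \<le> 1 * ((\<Sum>d\<in>{2..<m}. 2 * (CY * Er)) + m * (2 * (CY * Er)))"
    unfolding abs_mult[of "\<beta>\<^sup>2"]
  proof (rule mult_mono)
    have "\<bar>\<Sum>d\<in>{2..<m}. ee (card (sd B d)) * (?y d - 1 / sqrt N * AA d)\<bar> \<le> (\<Sum>d\<in>{2..<m}. 2 * (CY * Er))"
      by (rule order_trans[OF sum_abs], rule sum_mono, rule t[OF ee_abs]) auto
    moreover have "\<bar>m * (ee (card B + 1) * (?y m - 1 / sqrt N * AA m))\<bar> \<le> m * (2 * (CY * Er))"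
      unfolding abs_mult[of "real m"] using t[OF ee_abs _ order_refl, of "card B + 1"] n by (simp add: mult_left_mono)
    ultimately show "\<bar>(\<Sum>d\<in>{2..<m}. ee (card (sd B d)) * (?y d - 1 / sqrt N * AA d)) - m * (ee (card B + 1) * (?y m - 1 / sqrt N * AA m))\<bar>
      \<le> (\<Sum>d\<in>{2..<m}. 2 * (CY * Er)) + m * (2 * (CY * Er))" by linarith
  qed (use parameter_facts in auto)
  also have "\<dots> \<le> 1 * (m * (2 * (CY * Er)) + m * (2 * (CY * Er)))"
    using CY0 Er_bounds(4) by (intro mult_left_mono add_mono order_refl) (auto intro!: mult_right_mono)
  also have "\<dots> = (4 * real m * CY) * Er" by simp
  finally show ?thesis unfolding eq .
qed

lemma cavity_total:
  "\<bar>nu1 ff - (2 * t p * ee (card B) * nu1 dF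
     + \<beta>\<^sup>2 / sqrt N * ((\<Sum>d\<in>{2..<m}. ee (card (sd B d)) * AA d) - m * (ee (card B + 1) * AA m)))\<bar> \<le> cav_const m n k Cf * Er"
proof -
  have "\<bar>x - (d + f)\<bar> \<le> u1 + u2 + u3 + u4 + u5"
    if "\<bar>x - y - z\<bar> \<le> u1" "\<bar>y - c\<bar> \<le> u2" "\<bar>c - d\<bar> \<le> u3" "\<bar>z - e\<bar> \<le> u4" "\<bar>e - f\<bar> \<le> u5"
    for x y z c d e f u1 u2 u3 u4 u5 :: real
    using that by linarith
  from this[OF cavity_second_order decoupled_value decoupled_derivative bracket_replace_monomial bracket_value_approx] show ?thesis
    unfolding cav_const_def Let_def by (simp only: distrib_right)
qed

end

text \<open>The empty \<open>B\<close> will give the equation for S_1 and singletons those for X_d.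
  Two derivatives bring in four fresh replicas, and carrying the moments of \<open>Dom\<close> for
  \<open>m + 4\<close> replicas along the path takes two more, hence \<open>m + 6\<close>.\<close>

lemma cavity_identity:
  assumes n: "1 \<le> n" "2 * n \<le> m" and K: "m + 6 \<le> K"
  shows "\<exists>C\<ge>0. \<forall>N \<beta> q t p B. sk h N \<beta> q t \<longrightarrow> p < N \<longrightarrow> B \<subseteq> {2..<m} \<longrightarrow>
    \<bar>nu N h (skc N \<beta>) K (\<lambda>\<rho>. (\<rho> 0 p - \<rho> 1 p) * (\<Prod>r\<in>B. \<rho> r p) * Fm N t n k \<rho>)
     - (2 * t p * (mom h (\<beta> * sqrt q) (card B) - mom h (\<beta> * sqrt q) (card B + 2)) * nu N h (skc N \<beta>) K (\<lambda>\<rho>. k 0 * Fm N t n (k(0 := k 0 - 1)) \<rho>)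
     + \<beta>\<^sup>2 / sqrt N * ((\<Sum>d\<in>{2..<m}. (mom h (\<beta> * sqrt q) (card (sd B d)) - mom h (\<beta> * sqrt q) (card (sd B d) + 2))
             * nu N h (skc N \<beta>) K (\<lambda>\<rho>. Xd N d \<rho> * Fm N t n k \<rho>))
         - m * ((mom h (\<beta> * sqrt q) (card B + 1) - mom h (\<beta> * sqrt q) (card B + 1 + 2))
             * nu N h (skc N \<beta>) K (\<lambda>\<rho>. Xd N m \<rho> * Fm N t n k \<rho>))))\<bar>
    \<le> C * ((t p)\<^sup>2 + \<bar>t p\<bar> / sqrt N + 1 / N)"
proof -
  have "\<forall>r. \<exists>C\<ge>0. \<forall>N \<beta> q t p \<theta>. sk h N \<beta> q t \<longrightarrow> p < N \<longrightarrow> 0 \<le> \<theta> \<longrightarrow> \<theta> \<le> pi / 2 \<longrightarrow>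
    nu N h (cav_c N \<beta> q p \<theta>) K (\<lambda>\<rho>. Dom N (m + 4) n q t \<rho> ^ r) \<le> C"
    using cav_moment[of "m + 4" K n h] K n by auto
  then obtain Cf where Cf: "\<And>r. 0 \<le> Cf r" "\<And>r N \<beta> q t p \<theta>. sk h N \<beta> q t \<Longrightarrow> p < N \<Longrightarrow> 0 \<le> \<theta> \<Longrightarrow> \<theta> \<le> pi / 2 \<Longrightarrow>
    nu N h (cav_c N \<beta> q p \<theta>) K (\<lambda>\<rho>. Dom N (m + 4) n q t \<rho> ^ r) \<le> Cf r"
    by metis
  have "0 \<le> cav_const m n k Cf" by (rule cav_const_nonneg[OF Cf(1)])
  then show ?thesis
    using cavity_total[OF _ _ n K Cf(2), where k=k] by (intro exI[of _ "cav_const m n k Cf"] conjI allI impI) auto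
qed

section \<open>Moments\<close>

definition tmax :: "nat \<Rightarrow> (nat \<Rightarrow> real) \<Rightarrow> real" where
  "tmax N t = Max ((\<lambda>i. \<bar>t i\<bar>) ` {..<N})"

lemma tmax_ge: "i < N \<Longrightarrow> \<bar>t i\<bar> \<le> tmax N t"
  unfolding tmax_def by (rule Max_ge) auto

text \<open>The second bound says that a unit vector has an entry of size at least 1/sqrt N; the
  third is the Cauchy-Schwarz inequality.\<close>

lemma unit_vector_facts:
  assumes N: "1 \<le> N" and t: "(\<Sum>i<N. (t i)\<^sup>2) = 1"
  shows "0 \<le> tmax N t" "1 / sqrt N \<le> tmax N t" "(\<Sum>i<N. \<bar>t i\<bar>) \<le> sqrt N"
    "\<bar>(\<Sum>i<N. t i) / sqrt N\<bar> \<le> 1"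
proof -
  have sN: "0 < sqrt N" using N by simp
  show d0: "0 \<le> tmax N t" using tmax_ge[of 0 N t] N by linarith
  have "1 = (\<Sum>i<N. (t i)\<^sup>2)" using t by simp
  also have "\<dots> \<le> (\<Sum>i<N. (tmax N t)\<^sup>2)"
  proof (rule sum_mono)
    fix i assume "i \<in> {..<N}"
    then have "\<bar>t i\<bar>\<^sup>2 \<le> (tmax N t)\<^sup>2" by (intro power_mono tmax_ge) auto
    then show "(t i)\<^sup>2 \<le> (tmax N t)\<^sup>2" by simp
  qed
  also have "\<dots> = (sqrt N * tmax N t)\<^sup>2" by (simp add: power_mult_distrib)
  finally have "1\<^sup>2 \<le> (sqrt N * tmax N t)\<^sup>2" by simp
  then have "1 \<le> sqrt N * tmax N t" by (rule power2_le_imp_le) (use d0 in simp)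
  then show "1 / sqrt N \<le> tmax N t" using sN by (simp add: pos_divide_le_eq mult.commute)
  have "(\<Sum>i<N. \<bar>t i\<bar> * 1)\<^sup>2 \<le> (\<Sum>i<N. \<bar>t i\<bar>\<^sup>2) * (\<Sum>i<N. 1\<^sup>2)"
    by (rule Cauchy_Schwarz_ineq_sum)
  then have "(\<Sum>i<N. \<bar>t i\<bar>)\<^sup>2 \<le> (sqrt N)\<^sup>2" using t by simp
  then show 1: "(\<Sum>i<N. \<bar>t i\<bar>) \<le> sqrt N" by (rule power2_le_imp_le) simp
  have "\<bar>\<Sum>i<N. t i\<bar> \<le> sqrt N" by (rule order_trans[OF sum_abs 1])
  then show "\<bar>(\<Sum>i<N. t i) / sqrt N\<bar> \<le> 1" using sN by (simp add: abs_divide)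
qed

text \<open>Each of the three parts of the error sums to at most \<open>tmax N t\<close>, by the
  normalisation of t and the previous bounds.\<close>

lemma error_sums:
  assumes N: "1 \<le> N" and t: "(\<Sum>i<N. (t i)\<^sup>2) = 1"
  shows "(\<Sum>p<N. \<bar>t p\<bar> * ((t p)\<^sup>2 + \<bar>t p\<bar> / sqrt N + 1 / N)) \<le> 3 * tmax N t"
    and "(\<Sum>p<N. 1 / sqrt N * ((t p)\<^sup>2 + \<bar>t p\<bar> / sqrt N + 1 / N)) \<le> 3 * tmax N t"
proof -
  note f = unit_vector_facts[OF N t]
  have sN: "0 < sqrt N" "sqrt N * sqrt N = N" using N by simp_all
  have S: "(\<Sum>p<N. \<bar>t p\<bar>) / N \<le> 1 / sqrt N"
  proof -
    have "(\<Sum>p<N. \<bar>t p\<bar>) / N \<le> sqrt N / N" by (rule divide_right_mono[OF f(3)]) simp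
    also have "\<dots> = 1 / sqrt N" by (simp add: sqrt_divide_self_eq inverse_eq_divide)
    finally show ?thesis .
  qed
  have "(\<Sum>p<N. \<bar>t p\<bar> * ((t p)\<^sup>2 + \<bar>t p\<bar> / sqrt N + 1 / N))
     = (\<Sum>p<N. \<bar>t p\<bar> * (t p)\<^sup>2) + (\<Sum>p<N. (t p)\<^sup>2) / sqrt N + (\<Sum>p<N. \<bar>t p\<bar>) / N"
    unfolding sum_divide_distrib sum.distrib[symmetric]
    by (intro sum.cong refl) (simp add: distrib_left power2_eq_square abs_mult_self_eq)
  also have "(\<Sum>p<N. \<bar>t p\<bar> * (t p)\<^sup>2) \<le> (\<Sum>p<N. tmax N t * (t p)\<^sup>2)"
    by (intro sum_mono mult_right_mono tmax_ge) auto
  also have "\<dots> = tmax N t" unfolding sum_distrib_left[symmetric] t by simp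
  finally show "(\<Sum>p<N. \<bar>t p\<bar> * ((t p)\<^sup>2 + \<bar>t p\<bar> / sqrt N + 1 / N)) \<le> 3 * tmax N t"
    using S f(2) t by simp
  have "(\<Sum>p<N. 1 / sqrt N * ((t p)\<^sup>2 + \<bar>t p\<bar> / sqrt N + 1 / N))
     = 1 / sqrt N * ((\<Sum>p<N. (t p)\<^sup>2) + (\<Sum>p<N. \<bar>t p\<bar>) / sqrt N + (\<Sum>p<N. 1 / N))"
    unfolding sum_divide_distrib sum.distrib[symmetric] sum_distrib_left ..
  also have "\<dots> \<le> 1 / sqrt N * (1 + 1 + 1)"
  proof (intro mult_left_mono add_mono)
    show "(\<Sum>p<N. \<bar>t p\<bar>) / sqrt N \<le> 1" using f(3) sN by (simp add: pos_divide_le_eq)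
  qed (use t N in auto)
  also have "\<dots> \<le> 3 * tmax N t" using f(2) by simp
  finally show "(\<Sum>p<N. 1 / sqrt N * ((t p)\<^sup>2 + \<bar>t p\<bar> / sqrt N + 1 / N)) \<le> 3 * tmax N t" .
qed

abbreviation "egap h \<beta> q i \<equiv> mom h (\<beta> * sqrt q) i - mom h (\<beta> * sqrt q) (i + 2)"

text \<open>The approximate variance of \<open>S_1\<close>, obtained by solving the linear system below.\<close>

definition vlim :: "real \<Rightarrow> nat \<Rightarrow> real \<Rightarrow> real \<Rightarrow> (nat \<Rightarrow> real) \<Rightarrow> real" where
  "vlim h N \<beta> q t = 2 * egap h \<beta> q 0 - 4 * \<beta>\<^sup>2 * ((\<Sum>i<N. t i) / sqrt N)\<^sup>2 * (egap h \<beta> q 1)\<^sup>2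
     / (1 - \<beta>\<^sup>2 * (egap h \<beta> q 0 - egap h \<beta> q 2) + 2 * (\<beta>\<^sup>2 * egap h \<beta> q 2))"

lemma egap_abs: "\<bar>egap h \<beta> q i\<bar> \<le> 2"
  using mom_abs_le[of h "\<beta> * sqrt q" i] mom_abs_le[of h "\<beta> * sqrt q" "i + 2"] by linarith

lemma sk_small:
  assumes "sk h N \<beta> q t"
  shows "\<bar>\<beta>\<^sup>2 * (egap h \<beta> q 0 - egap h \<beta> q 2)\<bar> \<le> 1 / 8" "\<bar>\<beta>\<^sup>2 * egap h \<beta> q 2\<bar> \<le> 1 / 8" "\<bar>\<beta>\<^sup>2 * egap h \<beta> q 1\<bar> \<le> 1 / 8"
proof -
  have b: "\<beta>\<^sup>2 \<le> 1 / 256" using power_mono[of \<beta> "1 / 16" 2] assms by (auto simp: sk_def power_divide)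
  have s: "\<bar>\<beta>\<^sup>2 * x\<bar> \<le> 1 / 8" if "\<bar>x\<bar> \<le> 4" for x :: real
  proof -
    have "\<beta>\<^sup>2 * \<bar>x\<bar> \<le> 1 / 256 * 4" using b that by (intro mult_mono) auto
    then show ?thesis by (simp add: abs_mult)
  qed
  have "\<bar>egap h \<beta> q 0 - egap h \<beta> q 2\<bar> \<le> 4" "\<bar>egap h \<beta> q 2\<bar> \<le> 4" "\<bar>egap h \<beta> q 1\<bar> \<le> 4"
    using egap_abs[of h \<beta> q 0] egap_abs[of h \<beta> q 2] egap_abs[of h \<beta> q 1] by linarith+
  from s[OF this(1)] s[OF this(2)] s[OF this(3)]
  show "\<bar>\<beta>\<^sup>2 * (egap h \<beta> q 0 - egap h \<beta> q 2)\<bar> \<le> 1 / 8" "\<bar>\<beta>\<^sup>2 * egap h \<beta> q 2\<bar> \<le> 1 / 8" "\<bar>\<beta>\<^sup>2 * egap h \<beta> q 1\<bar> \<le> 1 / 8" .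
qed

text \<open>With q the second moment and r the fourth, the denominator is 1 - \<beta>^2 (1 - 4 q + 3
  r), familiar from fluctuations of the overlap; small \<beta> keeps it above 1/2. A uniform bound
  is required since each step of \<open>even_moments\<close> multiplies the earlier error by
  \<open>vlim\<close>.\<close>

lemma vlim_bound:
  assumes sk: "sk h N \<beta> q t" shows "\<bar>vlim h N \<beta> q t\<bar> \<le> 8"
proof -
  define u where "u = 1 - \<beta>\<^sup>2 * (egap h \<beta> q 0 - egap h \<beta> q 2) + 2 * (\<beta>\<^sup>2 * egap h \<beta> q 2)"
  define w where "w = 4 * ((\<Sum>i<N. t i) / sqrt N)\<^sup>2 * (\<beta>\<^sup>2 * egap h \<beta> q 1) * egap h \<beta> q 1"
  note s = sk_small[OF sk]
  have u: "1 / 2 \<le> u" unfolding u_def using s(1,2) by linarith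
  have "\<bar>(\<Sum>i<N. t i) / sqrt N\<bar> \<le> 1" using unit_vector_facts(4) sk unfolding sk_def by blast
  then have \<tau>: "((\<Sum>i<N. t i) / sqrt N)\<^sup>2 \<le> 1" by (simp add: abs_square_le_1)
  have "\<bar>w\<bar> \<le> 4 * 1 * (1 / 8) * 2"
    unfolding w_def abs_mult using \<tau> s(3) egap_abs by (intro mult_mono) auto
  then have "\<bar>w\<bar> \<le> 2 * u" using u by simp
  then have "\<bar>w / u\<bar> \<le> 2" using u by (simp add: abs_divide pos_divide_le_eq)
  moreover have "vlim h N \<beta> q t = 2 * egap h \<beta> q 0 - w / u"
    unfolding vlim_def u_def w_def by (simp add: power2_eq_square mult_ac)
  moreover have "\<bar>v\<bar> \<le> 8" if "\<bar>z\<bar> \<le> 2" "v = 2 * e - z" "\<bar>e\<bar> \<le> 2" for v z e :: real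
    using that by linarith
  ultimately show ?thesis using egap_abs[of h \<beta> q 0] by blast
qed

text \<open>The quantities \<open>A b\<close> for the replicas \<open>b\<close> occurring in the monomial and \<open>As\<close> for a fresh replica satisfy, up to
  errors, the same affine equation, hence they nearly coincide and \<open>Y\<close> is close to \<open>-2 As\<close>. In particular the
  smallness required of \<open>\<beta>\<close> does not depend on the number of replicas.\<close>

lemma linear_system:
  fixes A :: "nat \<Rightarrow> real" and As c x y \<epsilon> s :: real
  assumes x: "\<bar>x\<bar> \<le> 1 / 8" and y: "\<bar>y\<bar> \<le> 1 / 8"
    and Ab: "\<And>b. b \<in> I \<Longrightarrow> \<bar>A b - (c + x * A b + y * Y)\<bar> \<le> \<epsilon>"
    and As: "\<bar>As - (c + x * As + y * Y)\<bar> \<le> \<epsilon>"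
    and Y: "Y = (\<Sum>b\<in>I. A b) - (real (card I) + 2) * As"
  shows "\<bar>Y + 2 * c / (1 - x + 2 * y)\<bar> \<le> (12 * real (card I) + 4) * \<epsilon>"
proof -
  define M where "M = real (card I)"
  have M: "0 \<le> M" by (simp add: M_def)
  have e: "0 \<le> \<epsilon>" using As by linarith
  \<comment> \<open>In the difference of the two equations \<open>c\<close> and \<open>Y\<close>
    cancel, leaving a contraction with factor at most 1/8; hence (7/8) |A b - As| is at most 2
    \<epsilon>.\<close>
  have d: "\<bar>A b - As\<bar> \<le> 4 * \<epsilon>" if "b \<in> I" for b
  proof -
    have "\<bar>x * (A b - As)\<bar> \<le> 1 / 8 * \<bar>A b - As\<bar>" unfolding abs_mult by (intro mult_right_mono x) simp
    moreover have "A b - As = (A b - (c + x * A b + y * Y)) - (As - (c + x * As + y * Y)) + x * (A b - As)"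
      by (simp add: algebra_simps)
    moreover have "\<bar>z\<bar> \<le> 4 * \<epsilon>" if "\<bar>w\<bar> \<le> 1 / 8 * \<bar>z\<bar>" "z = u - v + w" "\<bar>u\<bar> \<le> \<epsilon>" "\<bar>v\<bar> \<le> \<epsilon>" for z u v w :: real
      using that by linarith
    ultimately show ?thesis using Ab[OF that] As by blast
  qed
  have "\<bar>\<Sum>b\<in>I. A b - As\<bar> \<le> (\<Sum>b\<in>I. 4 * \<epsilon>)"
    by (rule order_trans[OF sum_abs]) (intro sum_mono d)
  then have D: "\<bar>\<Sum>b\<in>I. A b - As\<bar> \<le> 4 * M * \<epsilon>" by (simp add: M_def mult_ac)
  \<comment> \<open>The coefficient \<open>card I + 2\<close> is decisive: once the A b are compared
    with \<open>As\<close>, just -2 \<open>As\<close> remains, whatever the number of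
    replicas.\<close>
  have Y2: "Y = (\<Sum>b\<in>I. A b - As) - 2 * As"
    unfolding Y sum_subtractf by (simp add: algebra_simps)
  define R where "R = (\<Sum>b\<in>I. A b - As)"
  define u where "u = 1 - x + 2 * y"
  have u: "1 / 2 \<le> u" unfolding u_def using x y by linarith
  define r where "r = As - (c + x * As + y * Y)"
  have r: "\<bar>r\<bar> \<le> \<epsilon>" unfolding r_def by (rule As)
  have As': "u * As = c + y * R + r"
    unfolding u_def r_def Y2 R_def[symmetric] by (simp add: algebra_simps)
  have "u * (Y + 2 * c / u) = u * R - 2 * (u * As) + 2 * c"
    unfolding Y2 R_def[symmetric] using u by (simp add: algebra_simps)
  also have "\<dots> = (1 - x) * R - 2 * r" unfolding As' unfolding u_def by (simp add: algebra_simps)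
  finally have E: "u * (Y + 2 * c / u) = (1 - x) * R - 2 * r" .
  have "\<bar>(1 - x) * R\<bar> \<le> 3 / 2 * \<bar>R\<bar>" unfolding abs_mult by (intro mult_right_mono) (use x in auto)
  then have "\<bar>u * (Y + 2 * c / u)\<bar> \<le> 3 / 2 * (4 * M * \<epsilon>) + 2 * \<epsilon>"
    unfolding E using D[folded R_def] r by linarith
  then have "u * \<bar>Y + 2 * c / u\<bar> \<le> 6 * M * \<epsilon> + 2 * \<epsilon>" using u by (simp add: abs_mult)
  moreover have "1 / 2 * \<bar>Y + 2 * c / u\<bar> \<le> u * \<bar>Y + 2 * c / u\<bar>" by (intro mult_right_mono u) simp
  moreover have "z \<le> 12 * M * \<epsilon> + 4 * \<epsilon>" if "u * z \<le> 6 * M * \<epsilon> + 2 * \<epsilon>" "1 / 2 * z \<le> u * z" for z :: real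
    using order_trans[OF that(2,1)] by simp
  ultimately have "\<bar>Y + 2 * c / u\<bar> \<le> 12 * M * \<epsilon> + 4 * \<epsilon>" by blast
  then show ?thesis unfolding u_def M_def by (simp only: distrib_right)
qed

section \<open>Summation over the sites\<close>

lemma Xd_expand: "1 \<le> N \<Longrightarrow> Xd N d \<rho> = (\<Sum>p<N. 1 / sqrt N * ((\<rho> 0 p - \<rho> 1 p) * \<rho> d p))"
proof -
  assume N: "1 \<le> N"
  have "sqrt N / N = 1 / sqrt N" by (simp add: sqrt_divide_self_eq inverse_eq_divide)
  then have "1 / sqrt N * (\<Sum>p<N. (\<rho> 0 p - \<rho> 1 p) * \<rho> d p) = sqrt N / N * (\<Sum>p<N. (\<rho> 0 p - \<rho> 1 p) * \<rho> d p)" by simp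
  also have "\<dots> = Xd N d \<rho>"
    unfolding Xd_def ov_def left_diff_distrib sum_subtractf by (simp add: diff_divide_distrib[symmetric])
  finally show ?thesis unfolding sum_distrib_left ..
qed

text \<open>Applied with weights t_p, which reassemble S_1, and with constant weights 1/sqrt N,
  which reassemble X_d.\<close>

lemma weighted_average:
  fixes w :: "nat \<Rightarrow> real" and x E :: "nat \<Rightarrow> real"
  assumes "\<And>p. p < N \<Longrightarrow> \<bar>x p - (2 * t p * u + v / sqrt N * z)\<bar> \<le> C * E p"
  shows "\<bar>(\<Sum>p<N. w p * x p) - (2 * (\<Sum>p<N. w p * t p) * u + (\<Sum>p<N. w p) / sqrt N * (v * z))\<bar> \<le> C * (\<Sum>p<N. \<bar>w p\<bar> * E p)"
proof -
  have "(\<Sum>p<N. w p * x p) - (2 * (\<Sum>p<N. w p * t p) * u + (\<Sum>p<N. w p) / sqrt N * (v * z))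
    = (\<Sum>p<N. w p * (x p - (2 * t p * u + v / sqrt N * z)))"
    unfolding sum_distrib_left sum_distrib_right sum_divide_distrib sum.distrib[symmetric] sum_subtractf[symmetric]
    by (intro sum.cong refl) (simp add: algebra_simps)
  also have "\<bar>\<dots>\<bar> \<le> (\<Sum>p<N. \<bar>w p\<bar> * (C * E p))"
    by (rule order_trans[OF sum_abs], rule sum_mono) (use assms in \<open>auto simp: abs_mult intro!: mult_left_mono\<close>)
  also have "\<dots> = C * (\<Sum>p<N. \<bar>w p\<bar> * E p)"
    unfolding sum_distrib_left by (intro sum.cong refl) simp
  finally show ?thesis .
qed

lemma sd_empty: "sd {} d = {d}" by (simp add: sd_def)

lemma card_sd_single: "card (sd {b} d) = (if d = b then 0 else 2)"
  by (auto simp: sd_def)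

text \<open>The empty set of extra spins expresses the left side through W, the average of the
  derivative of the monomial, and a combination Y of the A_d; the singletons give the system
  determining Y in terms of W. The number of replicas is (2 n + 1) + 6, enough for both uses of
  \<open>cavity_identity\<close>.\<close>

lemma moment_recursion:
  assumes n: "1 \<le> n"
  shows "\<exists>C\<ge>0. \<forall>N \<beta> q t. sk h N \<beta> q t \<longrightarrow>
    \<bar>nu N h (skc N \<beta>) (2 * n + 7) (\<lambda>\<rho>. Sval t N \<rho> 0 * Fm N t n k \<rho>)
      - vlim h N \<beta> q t * nu N h (skc N \<beta>) (2 * n + 7) (\<lambda>\<rho>. k 0 * Fm N t n (k(0 := k 0 - 1)) \<rho>)\<bar> \<le> C * tmax N t"
proof -
  let ?K = "2 * n + 7"
  note ci = cavity_identity[OF n, where K="?K" and h=h and k=k]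
  obtain C1 where C1: "0 \<le> C1" "\<And>N \<beta> q t B p. sk h N \<beta> q t \<Longrightarrow> p < N \<Longrightarrow> B \<subseteq> {2..<2 * n} \<Longrightarrow>
    \<bar>nu N h (skc N \<beta>) ?K (\<lambda>\<rho>. (\<rho> 0 p - \<rho> 1 p) * (\<Prod>r\<in>B. \<rho> r p) * Fm N t n k \<rho>)
     - (2 * t p * egap h \<beta> q (card B) * nu N h (skc N \<beta>) ?K (\<lambda>\<rho>. k 0 * Fm N t n (k(0 := k 0 - 1)) \<rho>)
     + \<beta>\<^sup>2 / sqrt N * ((\<Sum>d\<in>{2..<2 * n}. egap h \<beta> q (card (sd B d)) * nu N h (skc N \<beta>) ?K (\<lambda>\<rho>. Xd N d \<rho> * Fm N t n k \<rho>))
         - real (2 * n) * (egap h \<beta> q (card B + 1) * nu N h (skc N \<beta>) ?K (\<lambda>\<rho>. Xd N (2 * n) \<rho> * Fm N t n k \<rho>))))\<bar>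
    \<le> C1 * ((t p)\<^sup>2 + \<bar>t p\<bar> / sqrt N + 1 / N)"
    using ci[of "2 * n"] by auto
  \<comment> \<open>Counting replica 2n as one of the given replicas allows \<open>B\<close> to be
    {2n}; this yields an equation for A (2n), the quantity with a replica absent from the
    monomial.\<close>
  obtain C2 where C2: "0 \<le> C2" "\<And>N \<beta> q t B p. sk h N \<beta> q t \<Longrightarrow> p < N \<Longrightarrow> B \<subseteq> {2..<2 * n + 1} \<Longrightarrow>
    \<bar>nu N h (skc N \<beta>) ?K (\<lambda>\<rho>. (\<rho> 0 p - \<rho> 1 p) * (\<Prod>r\<in>B. \<rho> r p) * Fm N t n k \<rho>)
     - (2 * t p * egap h \<beta> q (card B) * nu N h (skc N \<beta>) ?K (\<lambda>\<rho>. k 0 * Fm N t n (k(0 := k 0 - 1)) \<rho>)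
     + \<beta>\<^sup>2 / sqrt N * ((\<Sum>d\<in>{2..<2 * n + 1}. egap h \<beta> q (card (sd B d)) * nu N h (skc N \<beta>) ?K (\<lambda>\<rho>. Xd N d \<rho> * Fm N t n k \<rho>))
         - real (2 * n + 1) * (egap h \<beta> q (card B + 1) * nu N h (skc N \<beta>) ?K (\<lambda>\<rho>. Xd N (2 * n + 1) \<rho> * Fm N t n k \<rho>))))\<bar>
    \<le> C2 * ((t p)\<^sup>2 + \<bar>t p\<bar> / sqrt N + 1 / N)"
    using ci[of "2 * n + 1"] by auto
  have main: "\<bar>nu N h (skc N \<beta>) ?K (\<lambda>\<rho>. Sval t N \<rho> 0 * Fm N t n k \<rho>)
      - vlim h N \<beta> q t * nu N h (skc N \<beta>) ?K (\<lambda>\<rho>. k 0 * Fm N t n (k(0 := k 0 - 1)) \<rho>)\<bar>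
      \<le> (3 * C1 + (12 * real (2 * n) + 4) * (3 * (C1 + C2))) * tmax N t"
    if sk: "sk h N \<beta> q t" for N \<beta> q t
  proof -
    let ?nu = "nu N h (skc N \<beta>) ?K" and ?F = "Fm N t n k" and ?e = "egap h \<beta> q"
    define W where "W = ?nu (\<lambda>\<rho>. k 0 * Fm N t n (k(0 := k 0 - 1)) \<rho>)"
    define A where "A d = ?nu (\<lambda>\<rho>. Xd N d \<rho> * ?F \<rho>)" for d
    define \<tau> where "\<tau> = (\<Sum>p<N. t p) / sqrt N"
    define Y where "Y = (\<Sum>d\<in>{2..<2 * n}. A d) - real (2 * n) * A (2 * n)"
    have N: "1 \<le> N" and t: "(\<Sum>i<N. (t i)\<^sup>2) = 1" using sk by (auto simp: sk_def)
    have sN: "0 < sqrt N" "sqrt N * sqrt N = N" using N by simp_all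
    note uf = unit_vector_facts[OF N t] and es = error_sums[OF N t]
    have sw: "(\<Sum>p<N. 1 / sqrt N) / sqrt N = 1" using N by simp
    have swt: "(\<Sum>p<N. 1 / sqrt N * t p) = \<tau>" unfolding \<tau>_def by (simp add: sum_divide_distrib)
    have S_exp: "?nu (\<lambda>\<rho>. Sval t N \<rho> 0 * ?F \<rho>) = (\<Sum>p<N. t p * ?nu (\<lambda>\<rho>. (\<rho> 0 p - \<rho> 1 p) * (\<Prod>r\<in>{}. \<rho> r p) * ?F \<rho>))"
      unfolding nu_cmult[symmetric] nu_sum[symmetric] Sval_def sum_distrib_right by (rule nu_cong) (simp add: mult.assoc)
    have A_exp: "A d = (\<Sum>p<N. 1 / sqrt N * ?nu (\<lambda>\<rho>. (\<rho> 0 p - \<rho> 1 p) * (\<Prod>r\<in>{d}. \<rho> r p) * ?F \<rho>))" for d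
      unfolding A_def nu_cmult[symmetric] nu_sum[symmetric] Xd_expand[OF N] sum_distrib_right
      by (rule nu_cong) (simp add: mult.assoc)
    \<comment> \<open>The system closes here: all replicas absent from the monomial are
      exchangeable, so the new unknown A (2n + 1) equals A (2n).\<close>
    have As': "A (2 * n + 1) = A (2 * n)"
    proof -
      define \<pi> where "\<pi> = Transposition.transpose (2 * n) (2 * n + 1)"
      have \<pi>: "\<pi> permutes {..<?K}" unfolding \<pi>_def by (rule permutes_swap_id) auto
      have fx: "\<pi> r = r" if "r < 2 * n" for r using that unfolding \<pi>_def by (simp add: Transposition.transpose_def)
      have "?F (\<rho> \<circ> \<pi>) = ?F \<rho>" for \<rho>
        using Fm_dep[of n "2 * n" N t k] fx unfolding dep_def by simp
      moreover have "Xd N (2 * n) (\<rho> \<circ> \<pi>) = Xd N (2 * n + 1) \<rho>" for \<rho>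
        using fx[of 0] fx[of 1] n unfolding Xd_def \<pi>_def by simp
      ultimately show ?thesis
        unfolding A_def using nu_perm[OF \<pi>, of N h "skc N \<beta>" "\<lambda>\<rho>. Xd N (2 * n) \<rho> * ?F \<rho>"] by simp
    qed
    have S_eq: "\<bar>?nu (\<lambda>\<rho>. Sval t N \<rho> 0 * ?F \<rho>) - (2 * (?e 0 * W) + \<tau> * (\<beta>\<^sup>2 * (?e 1 * Y)))\<bar> \<le> 3 * C1 * tmax N t"
    proof -
      have "\<bar>?nu (\<lambda>\<rho>. (\<rho> 0 p - \<rho> 1 p) * (\<Prod>r\<in>{}. \<rho> r p) * ?F \<rho>) - (2 * t p * (?e 0 * W) + \<beta>\<^sup>2 / sqrt N * (?e 1 * Y))\<bar>
        \<le> C1 * ((t p)\<^sup>2 + \<bar>t p\<bar> / sqrt N + 1 / N)" if "p < N" for p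
      proof -
        have "(\<Sum>d\<in>{2..<2 * n}. ?e (card (sd {} d)) * A d) - real (2 * n) * (?e (card {} + 1) * A (2 * n)) = ?e 1 * Y"
          unfolding Y_def sd_empty right_diff_distrib[of "?e 1"] sum_distrib_left by simp
        then show ?thesis
          using C1(2)[OF sk that, of "{}"] unfolding W_def[symmetric] A_def[symmetric] by (simp add: mult.assoc)
      qed
      note Q = this
      have "\<bar>(\<Sum>p<N. t p * ?nu (\<lambda>\<rho>. (\<rho> 0 p - \<rho> 1 p) * (\<Prod>r\<in>{}. \<rho> r p) * ?F \<rho>))
          - (2 * (\<Sum>p<N. t p * t p) * (?e 0 * W) + (\<Sum>p<N. t p) / sqrt N * (\<beta>\<^sup>2 * (?e 1 * Y)))\<bar>
        \<le> C1 * (\<Sum>p<N. \<bar>t p\<bar> * ((t p)\<^sup>2 + \<bar>t p\<bar> / sqrt N + 1 / N))"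
        by (rule weighted_average) (rule Q)
      then have "\<bar>?nu (\<lambda>\<rho>. Sval t N \<rho> 0 * ?F \<rho>) - (2 * (\<Sum>p<N. t p * t p) * (?e 0 * W) + \<tau> * (\<beta>\<^sup>2 * (?e 1 * Y)))\<bar>
        \<le> C1 * (\<Sum>p<N. \<bar>t p\<bar> * ((t p)\<^sup>2 + \<bar>t p\<bar> / sqrt N + 1 / N))"
        unfolding S_exp \<tau>_def .
      also have "\<dots> \<le> C1 * (3 * tmax N t)" by (rule mult_left_mono[OF es(1) C1(1)])
      finally show ?thesis using t by (simp add: power2_eq_square mult_ac)
    qed
    define x where "x = \<beta>\<^sup>2 * (?e 0 - ?e 2)"
    define y where "y = \<beta>\<^sup>2 * ?e 2"
    define c where "c = 2 * \<tau> * (?e 1 * W)"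
    define \<epsilon> where "\<epsilon> = 3 * (C1 + C2) * tmax N t"
    have val: "2 * \<tau> * (?e 1 * W) + 1 * (\<beta>\<^sup>2 * ((?e 0 - ?e 2) * A b + ?e 2 * Y)) = c + x * A b + y * Y" for b
      unfolding c_def x_def y_def by (simp add: algebra_simps)
    have A_eq: "\<bar>A b - (c + x * A b + y * Y)\<bar> \<le> \<epsilon>" if b: "b \<in> {2..<2 * n}" for b
    proof -
      \<comment> \<open>For d = b the two spins at the site cancel and \<open>?e 0\<close> appears;
        every other d, and the fresh replica, gives two spins and \<open>?e 2\<close>. The excess at
        d = b is split off, so that the rest is a multiple of Y.\<close>
      have br: "(\<Sum>d\<in>{2..<2 * n}. ?e (card (sd {b} d)) * A d) - real (2 * n) * (?e (card {b} + 1) * A (2 * n)) = (?e 0 - ?e 2) * A b + ?e 2 * Y"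
      proof -
        have "(\<Sum>d\<in>{2..<2 * n}. ?e (card (sd {b} d)) * A d) = (\<Sum>d\<in>{2..<2 * n}. (if d = b then (?e 0 - ?e 2) * A b else 0) + ?e 2 * A d)"
          unfolding card_sd_single by (intro sum.cong refl) (auto simp: left_diff_distrib)
        also have "\<dots> = (?e 0 - ?e 2) * A b + ?e 2 * (\<Sum>d\<in>{2..<2 * n}. A d)"
          unfolding sum.distrib sum_distrib_left using b by (simp add: sum.delta)
        finally have e: "(\<Sum>d\<in>{2..<2 * n}. ?e (card (sd {b} d)) * A d) = (?e 0 - ?e 2) * A b + ?e 2 * (\<Sum>d\<in>{2..<2 * n}. A d)" .
        have "card {b} + 1 = 2" by simp
        then show ?thesis unfolding e Y_def by (simp only: right_diff_distrib[of "?e 2"] mult.left_commute[of "real (2 * n)"])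
      qed
      have "\<bar>?nu (\<lambda>\<rho>. (\<rho> 0 p - \<rho> 1 p) * (\<Prod>r\<in>{b}. \<rho> r p) * ?F \<rho>) - (2 * t p * (?e 1 * W) + \<beta>\<^sup>2 / sqrt N * ((?e 0 - ?e 2) * A b + ?e 2 * Y))\<bar>
        \<le> C1 * ((t p)\<^sup>2 + \<bar>t p\<bar> / sqrt N + 1 / N)" if "p < N" for p
        using C1(2)[OF sk that, of "{b}"] b unfolding W_def[symmetric] A_def[symmetric] br by (simp add: mult.assoc)
      note Q = this
      have "\<bar>(\<Sum>p<N. 1 / sqrt N * ?nu (\<lambda>\<rho>. (\<rho> 0 p - \<rho> 1 p) * (\<Prod>r\<in>{b}. \<rho> r p) * ?F \<rho>))
          - (2 * (\<Sum>p<N. 1 / sqrt N * t p) * (?e 1 * W) + (\<Sum>p<N. 1 / sqrt N) / sqrt N * (\<beta>\<^sup>2 * ((?e 0 - ?e 2) * A b + ?e 2 * Y)))\<bar>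
        \<le> C1 * (\<Sum>p<N. \<bar>1 / sqrt N\<bar> * ((t p)\<^sup>2 + \<bar>t p\<bar> / sqrt N + 1 / N))"
        by (rule weighted_average) (rule Q)
      then have "\<bar>A b - (c + x * A b + y * Y)\<bar> \<le> C1 * (\<Sum>p<N. \<bar>1 / sqrt N\<bar> * ((t p)\<^sup>2 + \<bar>t p\<bar> / sqrt N + 1 / N))"
        unfolding A_exp[symmetric] swt sw val .
      also have "\<dots> \<le> C1 * (3 * tmax N t)" using es(2) by (intro mult_left_mono C1(1)) simp
      also have "\<dots> \<le> \<epsilon>" unfolding \<epsilon>_def using C2(1) uf(1) by (simp add: distrib_left distrib_right mult_nonneg_nonneg)
      finally show ?thesis .
    qed
    have As_eq: "\<bar>A (2 * n) - (c + x * A (2 * n) + y * Y)\<bar> \<le> \<epsilon>"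
    proof -
      have br: "(\<Sum>d\<in>{2..<2 * n + 1}. ?e (card (sd {2 * n} d)) * A d) - real (2 * n + 1) * (?e (card {2 * n} + 1) * A (2 * n + 1))
         = (?e 0 - ?e 2) * A (2 * n) + ?e 2 * Y"
      proof -
        have "{2..<2 * n + 1} = insert (2 * n) {2..<2 * n}" using n by auto
        then have "(\<Sum>d\<in>{2..<2 * n + 1}. ?e (card (sd {2 * n} d)) * A d) = ?e 0 * A (2 * n) + (\<Sum>d\<in>{2..<2 * n}. ?e (card (sd {2 * n} d)) * A d)"
          by (simp add: card_sd_single)
        also have "(\<Sum>d\<in>{2..<2 * n}. ?e (card (sd {2 * n} d)) * A d) = ?e 2 * (\<Sum>d\<in>{2..<2 * n}. A d)"
          unfolding card_sd_single sum_distrib_left by (intro sum.cong refl) auto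
        finally have e: "(\<Sum>d\<in>{2..<2 * n + 1}. ?e (card (sd {2 * n} d)) * A d) = ?e 0 * A (2 * n) + ?e 2 * (\<Sum>d\<in>{2..<2 * n}. A d)" .
        have c2: "card {2 * n} + 1 = 2" by simp
        have alg: "e0 * X + e2 * S - (M + 1) * (e2 * X) = (e0 - e2) * X + e2 * (S - M * X)" for e0 X e2 S M :: real
          by (simp add: algebra_simps)
        have "real (2 * n + 1) = real (2 * n) + 1" by simp
        then show ?thesis unfolding e c2 As' Y_def by (simp only: alg)
      qed
      have "\<bar>?nu (\<lambda>\<rho>. (\<rho> 0 p - \<rho> 1 p) * (\<Prod>r\<in>{2 * n}. \<rho> r p) * ?F \<rho>) - (2 * t p * (?e 1 * W) + \<beta>\<^sup>2 / sqrt N * ((?e 0 - ?e 2) * A (2 * n) + ?e 2 * Y))\<bar>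
        \<le> C2 * ((t p)\<^sup>2 + \<bar>t p\<bar> / sqrt N + 1 / N)" if "p < N" for p
        using C2(2)[OF sk that, of "{2 * n}"] n unfolding W_def[symmetric] A_def[symmetric] br by (simp add: mult.assoc)
      note Q = this
      have "\<bar>(\<Sum>p<N. 1 / sqrt N * ?nu (\<lambda>\<rho>. (\<rho> 0 p - \<rho> 1 p) * (\<Prod>r\<in>{2 * n}. \<rho> r p) * ?F \<rho>))
          - (2 * (\<Sum>p<N. 1 / sqrt N * t p) * (?e 1 * W) + (\<Sum>p<N. 1 / sqrt N) / sqrt N * (\<beta>\<^sup>2 * ((?e 0 - ?e 2) * A (2 * n) + ?e 2 * Y)))\<bar>
        \<le> C2 * (\<Sum>p<N. \<bar>1 / sqrt N\<bar> * ((t p)\<^sup>2 + \<bar>t p\<bar> / sqrt N + 1 / N))"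
        by (rule weighted_average) (rule Q)
      then have "\<bar>A (2 * n) - (c + x * A (2 * n) + y * Y)\<bar> \<le> C2 * (\<Sum>p<N. \<bar>1 / sqrt N\<bar> * ((t p)\<^sup>2 + \<bar>t p\<bar> / sqrt N + 1 / N))"
        unfolding A_exp[symmetric] swt sw val .
      also have "\<dots> \<le> C2 * (3 * tmax N t)" using es(2) by (intro mult_left_mono C2(1)) simp
      also have "\<dots> \<le> \<epsilon>" unfolding \<epsilon>_def using C1(1) uf(1) by (simp add: distrib_left distrib_right mult_nonneg_nonneg)
      finally show ?thesis .
    qed
    note ss = sk_small[OF sk]
    have cardI: "real (card {2..<2 * n}) + 2 = real (2 * n)" using n by simp
    have Yv: "\<bar>Y + 2 * c / (1 - x + 2 * y)\<bar> \<le> (12 * real (2 * n) + 4) * \<epsilon>"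
    proof -
      have "\<bar>Y + 2 * c / (1 - x + 2 * y)\<bar> \<le> (12 * real (card {2..<2 * n}) + 4) * \<epsilon>"
        by (rule linear_system[where A=A and As="A (2 * n)", OF _ _ A_eq As_eq])
          (use ss in \<open>simp_all only: x_def y_def Y_def cardI\<close>)
      also have "\<dots> \<le> (12 * real (2 * n) + 4) * \<epsilon>"
        using C1(1) C2(1) uf(1) by (intro mult_right_mono) (auto simp: \<epsilon>_def)
      finally show ?thesis .
    qed
    \<comment> \<open>The definition of \<open>vlim\<close> is the equation for S_1 with Y replaced
      by the solution -2c/(1 - x + 2y) of the linear system.\<close>
    have "vlim h N \<beta> q t * W = 2 * (?e 0 * W) + \<tau> * (\<beta>\<^sup>2 * (?e 1 * (- (2 * c / (1 - x + 2 * y)))))"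
      unfolding vlim_def \<tau>_def[symmetric] x_def[symmetric] y_def[symmetric] c_def
      by (simp add: power2_eq_square algebra_simps)
    then have "(2 * (?e 0 * W) + \<tau> * (\<beta>\<^sup>2 * (?e 1 * Y))) - vlim h N \<beta> q t * W = \<tau> * ((\<beta>\<^sup>2 * ?e 1) * (Y + 2 * c / (1 - x + 2 * y)))"
    proof -
      have "(u + \<tau> * (b * (e * Y))) - V = \<tau> * ((b * e) * (Y + z))" if "V = u + \<tau> * (b * (e * (- z)))" for u b e z V
        unfolding that by (simp add: algebra_simps)
      then show ?thesis using \<open>vlim h N \<beta> q t * W = _\<close> by blast
    qed
    moreover have "\<bar>\<tau> * ((\<beta>\<^sup>2 * ?e 1) * (Y + 2 * c / (1 - x + 2 * y)))\<bar> \<le> 1 * (1 * ((12 * real (2 * n) + 4) * \<epsilon>))"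
      unfolding abs_mult[of \<tau>] abs_mult[of "\<beta>\<^sup>2 * ?e 1"] using uf(4) ss(3) Yv unfolding \<tau>_def
      by (intro mult_mono) auto
    ultimately have "\<bar>?nu (\<lambda>\<rho>. Sval t N \<rho> 0 * ?F \<rho>) - vlim h N \<beta> q t * W\<bar> \<le> 3 * C1 * tmax N t + (12 * real (2 * n) + 4) * \<epsilon>"
    proof -
      have "\<bar>u - w\<bar> \<le> d1 + d2" if "v - w = z" "\<bar>z\<bar> \<le> 1 * (1 * d2)" "\<bar>u - v\<bar> \<le> d1" for u v w z d1 d2 :: real
        using that by linarith
      then show ?thesis using S_eq \<open>_ - _ = \<tau> * _\<close> \<open>\<bar>\<tau> * _\<bar> \<le> _\<close> by blast
    qed
    also have "\<dots> = (3 * C1 + (12 * real (2 * n) + 4) * (3 * (C1 + C2))) * tmax N t"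
      unfolding \<epsilon>_def by (simp only: distrib_right mult.assoc)
    finally show ?thesis unfolding W_def .
  qed
  show ?thesis
    by (rule exI[of _ "3 * C1 + (12 * real (2 * n) + 4) * (3 * (C1 + C2))"]) (use main C1(1) C2(1) in auto)
qed

section \<open>Iterating the recursion\<close>

lemma Fm_perm:
  assumes l: "l < n"
  shows "nu N h (skc N \<beta>) (2 * n + 7) (Fm N t n (k \<circ> Transposition.transpose 0 l)) = nu N h (skc N \<beta>) (2 * n + 7) (Fm N t n k)"
proof -
  let ?s = "Transposition.transpose 0 l"
  define \<pi> where "\<pi> = Transposition.transpose 0 (2 * l) \<circ> Transposition.transpose 1 (2 * l + 1)"
  have \<pi>: "\<pi> permutes {..<2 * n + 7}"
    unfolding \<pi>_def by (rule permutes_compose; rule permutes_swap_id) (use l in auto)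
  have v: "\<pi> (2 * i) = 2 * ?s i" "\<pi> (2 * i + 1) = 2 * ?s i + 1" for i
    unfolding \<pi>_def comp_def Transposition.transpose_def by presburger+
  have S: "Sval t N (\<rho> \<circ> \<pi>) i = Sval t N \<rho> (?s i)" for \<rho> i
    unfolding Sval_def comp_def v ..
  have sp: "?s permutes {..<n}" by (rule permutes_swap_id) (use l in auto)
  have "Fm N t n (k \<circ> ?s) (\<rho> \<circ> \<pi>) = Fm N t n k \<rho>" for \<rho>
    unfolding Fm_def S using prod.permute[OF sp, of "\<lambda>i. Sval t N \<rho> i ^ k i"] by (simp add: comp_def)
  then show ?thesis
    using nu_perm[OF \<pi>, of N h "skc N \<beta>" "Fm N t n (k \<circ> ?s)"] by simp
qed

lemma Fm_odd:
  assumes l: "l < n" "odd (k l)"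
  shows "nu N h (skc N \<beta>) (2 * n + 7) (Fm N t n k) = 0"
proof -
  define \<pi> where "\<pi> = Transposition.transpose (2 * l) (2 * l + 1)"
  have \<pi>: "\<pi> permutes {..<2 * n + 7}"
    unfolding \<pi>_def by (rule permutes_swap_id) (use l in auto)
  have o: "\<pi> (2 * i) = 2 * i" "\<pi> (2 * i + 1) = 2 * i + 1" if "i \<noteq> l" for i
    using that unfolding \<pi>_def Transposition.transpose_def by presburger+
  have s: "\<pi> (2 * l) = 2 * l + 1" "\<pi> (2 * l + 1) = 2 * l" unfolding \<pi>_def by simp_all
  have So: "Sval t N (\<rho> \<circ> \<pi>) i = Sval t N \<rho> i" if "i \<noteq> l" for \<rho> i
    unfolding Sval_def comp_def o[OF that] ..
  have Sl: "Sval t N (\<rho> \<circ> \<pi>) l = - Sval t N \<rho> l" for \<rho>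
    unfolding Sval_def comp_def s sum_negf[symmetric] by (simp add: algebra_simps)
  have "Fm N t n k (\<rho> \<circ> \<pi>) = - Fm N t n k \<rho>" for \<rho>
  proof -
    have "(\<Prod>i\<in>{..<n} - {l}. Sval t N (\<rho> \<circ> \<pi>) i ^ k i) = (\<Prod>i\<in>{..<n} - {l}. Sval t N \<rho> i ^ k i)"
      by (intro prod.cong refl) (simp add: So)
    then show ?thesis
      unfolding Fm_def using l by (simp add: prod.remove[of "{..<n}" l] Sl power_minus_odd)
  qed
  then have "nu N h (skc N \<beta>) (2 * n + 7) (Fm N t n k) = - nu N h (skc N \<beta>) (2 * n + 7) (Fm N t n k)"
    using nu_perm[OF \<pi>, of N h "skc N \<beta>" "Fm N t n k"] by (simp add: nu_uminus)
  then show ?thesis by simp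
qed

lemma a_step: "even j \<Longrightarrow> a (j + 2) = (real j + 1) * a j"
proof (elim evenE)
  fix i assume j: "j = 2 * i"
  have "a (2 * Suc i) = (real (2 * i) + 1) * a (2 * i)"
  proof -
    have f1: "fact (2 * Suc i) = 2 * (real i + 1) * ((real (2 * i) + 1) * fact (2 * i))"
      by (simp add: algebra_simps)
    have f2: "2 ^ Suc i * fact (Suc i) = 2 * (real i + 1) * (2 ^ i * fact i)"
      by (simp add: algebra_simps)
    have nz: "2 * (real i + 1) \<noteq> 0" using of_nat_0_le_iff[of i, where 'a=real] by auto
    have "a (2 * Suc i) = ((real (2 * i) + 1) * fact (2 * i)) / (2 ^ i * fact i)"
      unfolding a_even f1 f2 by (rule nonzero_mult_divide_mult_cancel_left[OF nz])
    then show ?thesis unfolding a_even by simp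
  qed
  then show ?thesis by (simp add: j)
qed

lemma a_0: "a 0 = 1" using a_even[of 0] by simp

lemma a_2: "a 2 = 1" using a_step[of 0] a_0 by (simp add: numeral_2_eq_2)

text \<open>Induction on the total degree. A variable with nonzero exponent j + 2 is moved to
  position 0, and the recursion lowers the degree by 2 with factor (j + 1) times
  \<open>vlim\<close>; this is the recursion of the Gaussian moments, \<open>a_step\<close>.\<close>

lemma even_moments:
  assumes "\<And>l. l < n \<Longrightarrow> even (k l)"
  shows "\<exists>C\<ge>0. \<forall>N \<beta> q t. sk h N \<beta> q t \<longrightarrow>
    \<bar>nu N h (skc N \<beta>) (2 * n + 7) (Fm N t n k) - (\<Prod>l<n. a (k l)) * vlim h N \<beta> q t ^ ((\<Sum>l<n. k l) div 2)\<bar> \<le> C * tmax N t"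
  using assms
proof (induction "\<Sum>l<n. k l" arbitrary: k rule: less_induct)
  case less
  show ?case
  proof (cases "\<forall>l<n. k l = 0")
    case True
    then have "Fm N t n k = (\<lambda>_. 1)" for N t by (simp add: Fm_def fun_eq_iff)
    then show ?thesis using True by (intro exI[of _ 0]) (simp add: nu_one a_0)
  next
    case False
    then obtain l where l: "l < n" "k l \<noteq> 0" by auto
    then have "2 \<le> k l" using less.prems[OF l(1)] by (cases "k l"; cases "k l - 1") auto
    then obtain j where j: "k l = j + 2" by (metis add.commute le_Suc_ex)
    have ej: "even j" using less.prems[OF l(1)] j by simp
    let ?s = "Transposition.transpose 0 l"
    have n: "1 \<le> n" using l by simp
    have sp: "?s permutes {..<n}" by (rule permutes_swap_id) (use l in auto)
    define k2 where "k2 = k \<circ> ?s"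
    \<comment> \<open>One factor S_1 is split off, leaving exponent j + 1; differentiating the rest
      gives j + 1 times the monomial \<open>k0\<close>.\<close>
    define k1 where "k1 = k2(0 := j + 1)"
    define k0 where "k0 = k2(0 := j)"
    have k20: "k2 0 = j + 2" by (simp add: k2_def j)
    have split: "{..<n} = insert 0 {1..<n}" using n by auto
    have sum2: "(\<Sum>i<n. k i) = (\<Sum>i<n. k2 i)" unfolding k2_def using sum.permute[OF sp, of k] by simp
    have sum0: "(\<Sum>i<n. k2 i) = (\<Sum>i<n. k0 i) + 2"
      unfolding split k0_def by (simp add: k20)
    have prod2: "(\<Prod>i<n. a (k i)) = (\<Prod>i<n. a (k2 i))" unfolding k2_def using prod.permute[OF sp, of "\<lambda>i. a (k i)"] by (simp add: comp_def)
    have prod0: "(\<Prod>i<n. a (k2 i)) = (real j + 1) * (\<Prod>i<n. a (k0 i))"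
      unfolding split k0_def by (simp add: k20 a_step[OF ej, simplified])
    have ev: "even (k0 i)" if "i < n" for i
    proof (cases "i = 0")
      case False
      have "?s i < n" using permutes_in_image[OF sp, of i] that by simp
      then show ?thesis using False less.prems by (simp add: k0_def k2_def)
    qed (simp add: k0_def ej)
    have "\<exists>C\<ge>0. \<forall>N \<beta> q t. sk h N \<beta> q t \<longrightarrow>
      \<bar>nu N h (skc N \<beta>) (2 * n + 7) (Fm N t n k0) - (\<Prod>l<n. a (k0 l)) * vlim h N \<beta> q t ^ ((\<Sum>l<n. k0 l) div 2)\<bar> \<le> C * tmax N t"
      by (rule less.hyps) (use sum2 sum0 ev in auto)
    then obtain C0 where C0: "0 \<le> C0" "\<And>N \<beta> q t. sk h N \<beta> q t \<Longrightarrow>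
      \<bar>nu N h (skc N \<beta>) (2 * n + 7) (Fm N t n k0) - (\<Prod>l<n. a (k0 l)) * vlim h N \<beta> q t ^ ((\<Sum>l<n. k0 l) div 2)\<bar> \<le> C0 * tmax N t"
      by blast
    obtain C1 where C1: "0 \<le> C1" "\<And>N \<beta> q t. sk h N \<beta> q t \<Longrightarrow>
      \<bar>nu N h (skc N \<beta>) (2 * n + 7) (\<lambda>\<rho>. Sval t N \<rho> 0 * Fm N t n k1 \<rho>)
      - vlim h N \<beta> q t * nu N h (skc N \<beta>) (2 * n + 7) (\<lambda>\<rho>. k1 0 * Fm N t n (k1(0 := k1 0 - 1)) \<rho>)\<bar> \<le> C1 * tmax N t"
      using moment_recursion[OF n, of h k1] by blast
    have k10: "k1 0 = j + 1" "k1(0 := k1 0 - 1) = k0" "k1(0 := j) = k0" by (auto simp: k1_def k0_def)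
    have F2: "Sval t N \<rho> 0 * Fm N t n k1 \<rho> = Fm N t n k2 \<rho>" for N t \<rho>
      unfolding Fm_def split k1_def by (simp add: k20)
    show ?thesis
    proof (intro exI[of _ "C1 + 8 * ((real j + 1) * C0)"] conjI allI impI)
      show "0 \<le> C1 + 8 * ((real j + 1) * C0)" using C0(1) C1(1) by simp
      fix N \<beta> q t assume sk: "sk h N \<beta> q t"
      let ?nu = "nu N h (skc N \<beta>) (2 * n + 7)" and ?v = "vlim h N \<beta> q t"
      define P where "P = (\<Prod>l<n. a (k0 l)) * ?v ^ ((\<Sum>l<n. k0 l) div 2)"
      have \<delta>: "0 \<le> tmax N t" using unit_vector_facts(1)[of N t] sk by (simp add: sk_def)
      have 1: "\<bar>?nu (Fm N t n k) - ?v * ((real j + 1) * ?nu (Fm N t n k0))\<bar> \<le> C1 * tmax N t"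
        using C1(2)[OF sk] unfolding k10(2) unfolding k10(1) F2 nu_cmult k2_def using Fm_perm[OF l(1), of N h \<beta> t k]
        by (simp add: add.commute)
      have "?v * ((real j + 1) * ?nu (Fm N t n k0)) - ?v * ((real j + 1) * P) = ?v * ((real j + 1) * (?nu (Fm N t n k0) - P))"
        by (simp only: right_diff_distrib)
      moreover have "\<bar>?v * ((real j + 1) * (?nu (Fm N t n k0) - P))\<bar> \<le> 8 * ((real j + 1) * (C0 * tmax N t))"
        unfolding abs_mult P_def using C0(2)[OF sk] by (intro mult_mono vlim_bound[OF sk]) auto
      moreover have "(\<Prod>l<n. a (k l)) * ?v ^ ((\<Sum>l<n. k l) div 2) = ?v * ((real j + 1) * P)"
        unfolding prod2 prod0 sum2 sum0 P_def by (simp add: mult_ac)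
      ultimately show "\<bar>?nu (Fm N t n k) - (\<Prod>l<n. a (k l)) * ?v ^ ((\<Sum>l<n. k l) div 2)\<bar> \<le> (C1 + 8 * ((real j + 1) * C0)) * tmax N t"
        using 1 by (simp add: distrib_right mult.assoc)
    qed
  qed
qed

lemma qavg_mult_last2:
  assumes f: "dep m f"
  shows "qavg N h c (m + 2) g (\<lambda>\<rho>. f \<rho> * X (\<rho> m) (\<rho> (m + 1)))
    = qavg N h c m g f * (\<Sum>\<sigma>\<in>configs N. gw N h c g \<sigma> * (\<Sum>\<tau>\<in>configs N. gw N h c g \<tau> * X \<tau> \<sigma>))"
proof -
  have f': "f (\<rho>(Suc m := \<sigma>)) = f \<rho>" for \<rho> \<sigma> using f unfolding dep_def by auto
  have "qavg N h c (Suc (Suc m)) g (\<lambda>\<rho>. f \<rho> * X (\<rho> m) (\<rho> (m + 1)))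
     = (\<Sum>\<sigma>\<in>configs N. gw N h c g \<sigma> * (qavg N h c m g f * (\<Sum>\<tau>\<in>configs N. gw N h c g \<tau> * X \<tau> \<sigma>)))"
    unfolding qavg_Suc[of N h c "Suc m"] using qavg_mult_last[OF f, of N h c g "\<lambda>\<tau>. X \<tau> _"] by (simp add: f')
  also have "\<dots> = qavg N h c m g f * (\<Sum>\<sigma>\<in>configs N. gw N h c g \<sigma> * (\<Sum>\<tau>\<in>configs N. gw N h c g \<tau> * X \<tau> \<sigma>))"
  proof -
    have "(\<Sum>\<sigma>\<in>C. w \<sigma> * (x * u \<sigma>)) = x * (\<Sum>\<sigma>\<in>C. w \<sigma> * u \<sigma>)" for C :: "(nat \<Rightarrow> real) set" and w u :: "_ \<Rightarrow> real" and x
      unfolding sum_distrib_left by (intro sum.cong refl) (simp only: mult.left_commute)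
    then show ?thesis .
  qed
  finally show ?thesis by simp
qed

text \<open>Given the disorder, the pairs of replicas are independent and identically distributed;
  the last pair is integrated out first, by \<open>qavg_mult_last2\<close>.\<close>

lemma qavg_power:
  "qavg N h c (2 * j) g (Fm N t j (\<lambda>_. 2)) = qavg N h c 2 g (\<lambda>\<rho>. (Sval t N \<rho> 0)\<^sup>2) ^ j"
proof -
  define X where "X \<sigma> \<tau> = (\<Sum>i<N. t i * (\<sigma> i - \<tau> i))\<^sup>2" for \<sigma> \<tau>
  define V where "V = (\<Sum>\<sigma>\<in>configs N. gw N h c g \<sigma> * (\<Sum>\<tau>\<in>configs N. gw N h c g \<tau> * X \<tau> \<sigma>))"
  have V: "qavg N h c 2 g (\<lambda>\<rho>. (Sval t N \<rho> 0)\<^sup>2) = V"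
    using qavg_mult_last2[of 0 "\<lambda>_. 1" N h c g X] qavg_one[of N h c 0 g]
    by (simp add: dep_def V_def X_def Sval_def numeral_2_eq_2)
  show ?thesis
    unfolding V
  proof (induction j)
    case 0
    have "Fm N t 0 (\<lambda>_. 2) = (\<lambda>_. 1)" by (simp add: Fm_def fun_eq_iff)
    then show ?case by (simp add: qavg_one)
  next
    case (Suc j)
    have "Fm N t (Suc j) (\<lambda>_. 2) = (\<lambda>\<rho>. Fm N t j (\<lambda>_. 2) \<rho> * X (\<rho> (2 * j)) (\<rho> (2 * j + 1)))"
      by (simp add: Fm_def X_def Sval_def fun_eq_iff)
    moreover have "2 * Suc j = 2 * j + 2" by simp
    ultimately show ?case
      using qavg_mult_last2[OF Fm_dep[where n=j and N=N and t=t and k="\<lambda>_. 2", OF order_refl], of N h c g X] Suc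
      by (simp only: V_def[symmetric] power_Suc2)
  qed
qed

text \<open>Both moments are compared with the same power of \<open>vlim\<close>. The power of the
  Gibbs variance is a monomial with j exponents equal to 2, hence Gaussian factor 1, in a different
  number of variables; \<open>even_moments\<close> is used once for each monomial.\<close>

lemma moments_comparison:
  fixes ks :: "nat \<Rightarrow> nat"
  shows "\<exists>C. \<forall>N \<beta> q t. sk h N \<beta> q t \<longrightarrow>
      \<bar>(\<integral>g. gibbs_avg N \<beta> h g (2 * n) (\<lambda>\<rho>. \<Prod>l<n. Sval t N \<rho> l ^ ks l) \<partial>disorder N)
       - (\<Prod>l<n. a (ks l)) *
         (\<integral>g. sqrt (gibbs_avg N \<beta> h g 2 (\<lambda>\<rho>. (Sval t N \<rho> 0)\<^sup>2)) ^ (\<Sum>l<n. ks l) \<partial>disorder N)\<bar>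
      \<le> C * tmax N t"
proof -
  have L: "(\<integral>g. gibbs_avg N \<beta> h g (2 * n) (\<lambda>\<rho>. \<Prod>l<n. Sval t N \<rho> l ^ ks l) \<partial>disorder N)
     = nu N h (skc N \<beta>) (2 * n + 7) (Fm N t n ks)" for N \<beta> t
  proof -
    have "(\<lambda>\<rho>. \<Prod>l<n. Sval t N \<rho> l ^ ks l) = Fm N t n ks" by (simp add: Fm_def fun_eq_iff)
    then have "(\<integral>g. gibbs_avg N \<beta> h g (2 * n) (\<lambda>\<rho>. \<Prod>l<n. Sval t N \<rho> l ^ ks l) \<partial>disorder N)
       = nu N h (skc N \<beta>) (2 * n) (Fm N t n ks)"
      unfolding nu_def gibbs_avg_eq by (simp only:)
    also have "\<dots> = nu N h (skc N \<beta>) (2 * n + 7) (Fm N t n ks)"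
      by (rule nu_dep[OF Fm_dep, symmetric]) auto
    finally show ?thesis .
  qed
  show ?thesis
  proof (cases "\<forall>l<n. even (ks l)")
    case False
    then obtain l where l: "l < n" "odd (ks l)" by auto
    then have "(\<Prod>l<n. a (ks l)) = 0" using a_odd[OF l(2)] by (intro prod_zero) auto
    then show ?thesis unfolding L using Fm_odd[where l=l and n=n and k=ks, OF l] by (intro exI[of _ 0]) simp
  next
    case True
    define j where "j = (\<Sum>l<n. ks l) div 2"
    have "even (\<Sum>l<n. ks l)" using True by (intro dvd_sum) auto
    then have j: "(\<Sum>l<n. ks l) = 2 * j" by (simp add: j_def)
    have R: "(\<integral>g. sqrt (gibbs_avg N \<beta> h g 2 (\<lambda>\<rho>. (Sval t N \<rho> 0)\<^sup>2)) ^ (\<Sum>l<n. ks l) \<partial>disorder N)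
       = nu N h (skc N \<beta>) (2 * j + 7) (Fm N t j (\<lambda>_. 2))" for N \<beta> t
    proof -
      have "0 \<le> qavg N h (skc N \<beta>) 2 g (\<lambda>\<rho>. (Sval t N \<rho> 0)\<^sup>2)" for g
        unfolding qavg_def by (intro sum_nonneg mult_nonneg_nonneg prod_nonneg gw_nonneg) auto
      then have "sqrt (gibbs_avg N \<beta> h g 2 (\<lambda>\<rho>. (Sval t N \<rho> 0)\<^sup>2)) ^ (\<Sum>l<n. ks l)
        = qavg N h (skc N \<beta>) (2 * j) g (Fm N t j (\<lambda>_. 2))" for g
        unfolding gibbs_avg_eq j power_mult qavg_power by simp
      then have "(\<integral>g. sqrt (gibbs_avg N \<beta> h g 2 (\<lambda>\<rho>. (Sval t N \<rho> 0)\<^sup>2)) ^ (\<Sum>l<n. ks l) \<partial>disorder N)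
        = nu N h (skc N \<beta>) (2 * j) (Fm N t j (\<lambda>_. 2))" unfolding nu_def by (simp only:)
      also have "\<dots> = nu N h (skc N \<beta>) (2 * j + 7) (Fm N t j (\<lambda>_. 2))"
        by (rule nu_dep[OF Fm_dep, symmetric]) auto
      finally show ?thesis .
    qed
    obtain C1 where C1: "\<And>N \<beta> q t. sk h N \<beta> q t \<Longrightarrow>
      \<bar>nu N h (skc N \<beta>) (2 * n + 7) (Fm N t n ks) - (\<Prod>l<n. a (ks l)) * vlim h N \<beta> q t ^ ((\<Sum>l<n. ks l) div 2)\<bar> \<le> C1 * tmax N t"
      using even_moments[of n ks h] True by blast
    obtain C2 where C2: "\<And>N \<beta> q t. sk h N \<beta> q t \<Longrightarrow>
      \<bar>nu N h (skc N \<beta>) (2 * j + 7) (Fm N t j (\<lambda>_. 2)) - (\<Prod>l<j. a 2) * vlim h N \<beta> q t ^ ((\<Sum>l<j. 2) div 2)\<bar> \<le> C2 * tmax N t"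
      using even_moments[of j "\<lambda>_. 2" h] by auto
    let ?P = "\<Prod>l<n. a (ks l)"
    show ?thesis
    proof (intro exI[of _ "C1 + \<bar>?P\<bar> * C2"] allI impI)
      fix N \<beta> q t assume sk: "sk h N \<beta> q t"
      let ?x = "nu N h (skc N \<beta>) (2 * n + 7) (Fm N t n ks)" and ?y = "nu N h (skc N \<beta>) (2 * j + 7) (Fm N t j (\<lambda>_. 2))"
      let ?w = "vlim h N \<beta> q t ^ j"
      have 1: "\<bar>?x - ?P * ?w\<bar> \<le> C1 * tmax N t" using C1[OF sk] unfolding j by simp
      have "\<bar>?y - ?w\<bar> \<le> C2 * tmax N t" using C2[OF sk] by (simp add: a_2)
      then have "\<bar>?P\<bar> * \<bar>?y - ?w\<bar> \<le> \<bar>?P\<bar> * (C2 * tmax N t)" by (rule mult_left_mono) simp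
      then have 2: "\<bar>?P * ?y - ?P * ?w\<bar> \<le> \<bar>?P\<bar> * C2 * tmax N t"
        by (simp only: right_diff_distrib[symmetric] abs_mult mult.assoc)
      have "\<bar>?x - ?P * ?y\<bar> \<le> C1 * tmax N t + \<bar>?P\<bar> * C2 * tmax N t"
        using 1 2 by linarith
      then show "\<bar>(\<integral>g. gibbs_avg N \<beta> h g (2 * n) (\<lambda>\<rho>. \<Prod>l<n. Sval t N \<rho> l ^ ks l) \<partial>disorder N)
       - ?P * (\<integral>g. sqrt (gibbs_avg N \<beta> h g 2 (\<lambda>\<rho>. (Sval t N \<rho> 0)\<^sup>2)) ^ (\<Sum>l<n. ks l) \<partial>disorder N)\<bar>
        \<le> (C1 + \<bar>?P\<bar> * C2) * tmax N t"
        unfolding L R by (simp only: distrib_right)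
    qed
  qed
qed

theorem theorem1:
  fixes h :: real
  assumes "h \<ge> 0"
  shows "\<exists>\<beta>0>0. \<forall>n\<ge>1. \<forall>ks :: nat \<Rightarrow> nat. \<exists>C::real.
    \<forall>\<beta> N (t :: nat \<Rightarrow> real). 0 < \<beta> \<and> \<beta> < \<beta>0 \<and> (\<Sum>i<N. (t i)\<^sup>2) = 1 \<longrightarrow>
      \<bar>(\<integral>g. gibbs_avg N \<beta> h g (2 * n) (\<lambda>\<rho>. \<Prod>l<n. Sval t N \<rho> l ^ ks l) \<partial>disorder N)
       - (\<Prod>l<n. a (ks l)) *
         (\<integral>g. sqrt (gibbs_avg N \<beta> h g 2 (\<lambda>\<rho>. (Sval t N \<rho> 0)\<^sup>2)) ^ (\<Sum>l<n. ks l) \<partial>disorder N)\<bar>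
      \<le> C * Max ((\<lambda>i. \<bar>t i\<bar>) ` {..<N})"
\<comment> \<open>The bound on \<beta> required in \<open>sk\<close>, used both in the exponential
  moment and to make the linear system a contraction.\<close>
proof (rule exI[of _ "1 / 16"], intro conjI allI impI)
  fix n :: nat and ks :: "nat \<Rightarrow> nat"
  obtain C where C: "\<And>N \<beta> q t. sk h N \<beta> q t \<Longrightarrow>
      \<bar>(\<integral>g. gibbs_avg N \<beta> h g (2 * n) (\<lambda>\<rho>. \<Prod>l<n. Sval t N \<rho> l ^ ks l) \<partial>disorder N)
       - (\<Prod>l<n. a (ks l)) *
         (\<integral>g. sqrt (gibbs_avg N \<beta> h g 2 (\<lambda>\<rho>. (Sval t N \<rho> 0)\<^sup>2)) ^ (\<Sum>l<n. ks l) \<partial>disorder N)\<bar>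
      \<le> C * tmax N t"
    using moments_comparison[of h n ks] by blast
  show "\<exists>C::real. \<forall>\<beta> N (t :: nat \<Rightarrow> real). 0 < \<beta> \<and> \<beta> < 1 / 16 \<and> (\<Sum>i<N. (t i)\<^sup>2) = 1 \<longrightarrow>
      \<bar>(\<integral>g. gibbs_avg N \<beta> h g (2 * n) (\<lambda>\<rho>. \<Prod>l<n. Sval t N \<rho> l ^ ks l) \<partial>disorder N)
       - (\<Prod>l<n. a (ks l)) *
         (\<integral>g. sqrt (gibbs_avg N \<beta> h g 2 (\<lambda>\<rho>. (Sval t N \<rho> 0)\<^sup>2)) ^ (\<Sum>l<n. ks l) \<partial>disorder N)\<bar>
      \<le> C * Max ((\<lambda>i. \<bar>t i\<bar>) ` {..<N})"
  proof (intro exI[of _ C] allI impI)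
    fix \<beta> :: real and N :: nat and t :: "nat \<Rightarrow> real"
    assume *: "0 < \<beta> \<and> \<beta> < 1 / 16 \<and> (\<Sum>i<N. (t i)\<^sup>2) = 1"
    \<comment> \<open>For N = 0 the sum of squares would be 0 rather than 1.\<close>
    then have "N \<noteq> 0" by (cases "N = 0") auto
    obtain q where "0 \<le> q" "q \<le> 1" "q = mom h (\<beta> * sqrt q) 2" using q_exists by blast
    then have "sk h N \<beta> q t" using * \<open>N \<noteq> 0\<close> by (simp add: sk_def)
    from C[OF this] show "\<bar>(\<integral>g. gibbs_avg N \<beta> h g (2 * n) (\<lambda>\<rho>. \<Prod>l<n. Sval t N \<rho> l ^ ks l) \<partial>disorder N)
       - (\<Prod>l<n. a (ks l)) *
         (\<integral>g. sqrt (gibbs_avg N \<beta> h g 2 (\<lambda>\<rho>. (Sval t N \<rho> 0)\<^sup>2)) ^ (\<Sum>l<n. ks l) \<partial>disorder N)\<bar>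
      \<le> C * Max ((\<lambda>i. \<bar>t i\<bar>) ` {..<N})"
      unfolding tmax_def .
  qed
qed simp

end
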